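(* Let $I\subset\mathbb{R}$ be an interval and let $\alpha=(\alpha_1,\alpha_2,\alpha_3)$, $U=(U_1,U_2,U_3):I\to\mathbb{R}^3$ be an admissible pair of curves for $\xi=(0,0,1)$, that is, $\alpha$ and $U$ are regular analytic curves and there is an analytic positive function $\lambda:I\to\mathbb{R}^+$ with $\langle\alpha',U\rangle=0$, $\langle\xi,U\rangle=1$ and $\lambda=\langle\alpha'',U\rangle=-\langle\alpha',U'\rangle$ on $I$. Then the unique indefinite improper affine sphere $\psi=(\psi_1,\psi_2,\psi_3)$ with affine normal $\xi=(0,0,1)$ containing $\alpha(I)$ with affine conormal $U(s)$ at $\alpha(s)$ for all $s\in I$ is given, together with its affine conormal $N=(N_1,N_2,N_3)$, by $$N=\mathrm{Re}(2\Phi_1,2\Phi_2,1),\qquad (\psi_1,\psi_2)=\mathrm{Im}(2\Phi_2,-2\Phi_1),\qquad -\psi_{3z}=\psi_{1z}N_1+\psi_{2z}N_2,$$ where $2(\Phi_1,\Phi_2)=(U_1-j\alpha_2,\;U_2+j\alpha_1)$ in a neighborhood of $I$ in the split-complex numbers $\mathbb{C}'$ (here $U_i$ and $\alpha_i$ denote the split-holomorphic extensions).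
   Context: $\langle\cdot,\cdot\rangle$ is the standard inner product of $\mathbb{R}^3$, $[\cdot,\cdot,\cdot]$ the determinant. An indefinite improper affine sphere with (constant) affine normal $\xi$ is an immersion $\psi:\Sigma\to\mathbb{R}^3$ of a surface, transversal to the constant vector $\xi\neq0$, such that the symmetric bilinear form $h$ (the affine metric) defined by $D_X d\psi(Y)=d\psi(\nabla_XY)+h(X,Y)\xi$, with $D$ the flat connection of $\mathbb{R}^3$, is a Lorentzian metric and $\sqrt{h(X,Y)^2-h(X,X)h(Y,Y)}=|[d\psi(X),d\psi(Y),\xi]|$ for all tangent vectors $X,Y$. The affine conormal is the map $N:\Sigma\to\mathbb{R}^3$ determined by $\langle N,\xi\rangle=1$, $\langle N,d\psi\rangle=0$. "$\psi$ contains $\alpha(I)$ with affine conormal $U(s)$ at $\alpha(s)$" means that there is a regular analytic curve $\beta:I\to\Sigma$ with $\psi\circ\beta=\alpha$ and $N\circ\beta=U$; in the representation of the claim, $\beta(s)=s\in I\subset\mathbb{C}'$ (so the integration constant of $\psi_3$ is fixed by $\psi_3=\alpha_3$ at a point of $I$). Everything is local around the curve: uniqueness means that any two solutions agree, up to reparametrization, in a neighborhood of the curve. Split-complex numbers: $\mathbb{C}'=\{z=s+jt: s,t\in\mathbb{R}\}$, $j^2=1$, commutative; $\overline z=s-jt$, $\mathrm{Re}(z)=s$, $\mathrm{Im}(z)=t$. Subscript $z$ denotes $\partial_z=\tfrac12(\partial_s+j\,\partial_t)$; similarly $\partial_{\overline z}=\tfrac12(\partial_s-j\,\partial_t)$,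 and $F$ is split-holomorphic if $F_{\overline z}=0$. The split-holomorphic extension of an analytic function $g$ on $I$ is $g(s+jt)=\tfrac12(g(s+t)+g(s-t))+\tfrac{j}{2}(g(s+t)-g(s-t))$. *)

theory Defs
  imports "HOL-Analysis.Analysis"
begin

section \<open>Smooth and real-analytic maps\<close>

text \<open>Both notions are meant for open sets \<open>S\<close>. The class \<open>C^k\<close> is described through
  directional derivatives, which in finite dimension agrees with the usual definition.\<close>

primrec Ck_on :: "nat \<Rightarrow> 'a::euclidean_space set \<Rightarrow> ('a \<Rightarrow> 'b::real_normed_vector) \<Rightarrow> bool" where
  "Ck_on 0 S f \<longleftrightarrow> continuous_on S f"
| "Ck_on (Suc k) S f \<longleftrightarrow> f differentiable_on S \<and>
     (\<forall>v. Ck_on k S (\<lambda>p. frechet_derivative f (at p) v))"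

definition smooth_on :: "'a::euclidean_space set \<Rightarrow> ('a \<Rightarrow> 'b::real_normed_vector) \<Rightarrow> bool" where
  "smooth_on S f \<longleftrightarrow> (\<forall>k. Ck_on k S f)"

text \<open>A multi-index \<open>m\<close> assigns an exponent to every basis vector; the family of monomials is
  summed unconditionally.\<close>

definition real_analytic_on :: "'a::euclidean_space set \<Rightarrow> ('a \<Rightarrow> 'b::real_normed_vector) \<Rightarrow> bool" where
  "real_analytic_on S f \<longleftrightarrow> (\<forall>p\<in>S. \<exists>r>0. \<exists>a :: ('a \<Rightarrow> nat) \<Rightarrow> 'b. \<forall>q\<in>ball p r.
     ((\<lambda>m. (\<Prod>i\<in>Basis. ((q - p) \<bullet> i) ^ m i) *\<^sub>R a m) has_sum f q) (Basis \<rightarrow>\<^sub>E UNIV))"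

definition regular_analytic_curve :: "real set \<Rightarrow> (real \<Rightarrow> 'b::real_normed_vector) \<Rightarrow> bool" where
  "regular_analytic_curve I c \<longleftrightarrow>
     real_analytic_on I c \<and> (\<forall>s\<in>I. vector_derivative c (at s) \<noteq> 0)"


section \<open>Parametrized indefinite improper affine spheres\<close>

definition second_derivative ::
    "('a::real_normed_vector \<Rightarrow> 'b::real_normed_vector) \<Rightarrow> 'a \<Rightarrow> 'a \<Rightarrow> 'a \<Rightarrow> 'b" where
  "second_derivative f p X Y =
     frechet_derivative (\<lambda>q. frechet_derivative f (at q) Y) (at p) X"

text \<open>The coefficient \<open>c\<close> is \<open>h(X,Y)\<close> in \<open>D_X d\<psi>(Y) = d\<psi>(\<nabla>_X Y) + h(X,Y) \<xi>\<close>. Replacing the constant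
  coordinate field \<open>Y\<close> by a nonconstant one changes the left-hand side only by a tangential
  term, so constant fields suffice. For an immersion transversal to \<open>\<xi>\<close> the coefficient exists
  and is unique.\<close>

definition affine_metric ::
    "real^3 \<Rightarrow> (real \<times> real \<Rightarrow> real^3) \<Rightarrow> real \<times> real \<Rightarrow> real \<times> real \<Rightarrow> real \<times> real \<Rightarrow> real" where
  "affine_metric \<xi> f p X Y =
     (THE c. \<exists>Z. second_derivative f p X Y = frechet_derivative f (at p) Z + c *\<^sub>R \<xi>)"

definition lorentzian :: "(real \<times> real \<Rightarrow> real \<times> real \<Rightarrow> real) \<Rightarrow> bool" where
  "lorentzian h \<longleftrightarrow> bilinear h \<and> (\<forall>X Y. h X Y = h Y X) \<and>
     (\<exists>e1 e2. h e1 e1 = 1 \<and> h e2 e2 = - 1 \<and> h e1 e2 = 0)"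

definition indef_improper_affine_sphere_param ::
    "real^3 \<Rightarrow> (real \<times> real) set \<Rightarrow> (real \<times> real \<Rightarrow> real^3) \<Rightarrow> bool" where
  "indef_improper_affine_sphere_param \<xi> S f \<longleftrightarrow> smooth_on S f \<and>
     (\<forall>p\<in>S. inj (frechet_derivative f (at p)) \<and>
        \<xi> \<notin> range (frechet_derivative f (at p)) \<and>
        lorentzian (affine_metric \<xi> f p) \<and>
        (\<forall>X Y. sqrt ((affine_metric \<xi> f p X Y)\<^sup>2 - affine_metric \<xi> f p X X * affine_metric \<xi> f p Y Y)
           = \<bar>det (vector [frechet_derivative f (at p) X, frechet_derivative f (at p) Y, \<xi>] :: real^3^3)\<bar>))"

definition affine_conormal_at ::
    "real^3 \<Rightarrow> (real \<times> real \<Rightarrow> real^3) \<Rightarrow> real \<times> real \<Rightarrow> real^3 \<Rightarrow> bool" where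
  "affine_conormal_at \<xi> f p n \<longleftrightarrow> n \<bullet> \<xi> = 1 \<and> (\<forall>X. n \<bullet> frechet_derivative f (at p) X = 0)"


section \<open>Surfaces and indefinite improper affine spheres\<close>

text \<open>A surface is a topological space with an atlas of pairs (domain, coordinate map). The
  transition maps are real-analytic, so that analytic curves in the surface make sense.\<close>

type_synonym 'p atlas = "('p set \<times> ('p \<Rightarrow> real \<times> real)) set"

definition analytic_surface :: "'p topology \<Rightarrow> 'p atlas \<Rightarrow> bool" where
  "analytic_surface X A \<longleftrightarrow> Hausdorff_space X \<and> second_countable X \<and>
     \<Union>(fst ` A) = topspace X \<and>
     (\<forall>(D, \<kappa>)\<in>A. openin X D \<and> open (\<kappa> ` D) \<and>
        homeomorphic_map (subtopology X D) (top_of_set (\<kappa> ` D)) \<kappa>) \<and>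
     (\<forall>(D, \<kappa>)\<in>A. \<forall>(E, \<theta>)\<in>A. real_analytic_on (\<kappa> ` (D \<inter> E)) (\<theta> \<circ> inv_into D \<kappa>))"

definition indef_improper_affine_sphere ::
    "real^3 \<Rightarrow> 'p topology \<Rightarrow> 'p atlas \<Rightarrow> ('p \<Rightarrow> real^3) \<Rightarrow> bool" where
  "indef_improper_affine_sphere \<xi> X A \<psi> \<longleftrightarrow> \<xi> \<noteq> 0 \<and> analytic_surface X A \<and>
     (\<forall>(D, \<kappa>)\<in>A. indef_improper_affine_sphere_param \<xi> (\<kappa> ` D) (\<psi> \<circ> inv_into D \<kappa>))"

definition affine_conormal ::
    "real^3 \<Rightarrow> 'p atlas \<Rightarrow> ('p \<Rightarrow> real^3) \<Rightarrow> ('p \<Rightarrow> real^3) \<Rightarrow> bool" where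
  "affine_conormal \<xi> A \<psi> N \<longleftrightarrow>
     (\<forall>(D, \<kappa>)\<in>A. \<forall>x\<in>D. affine_conormal_at \<xi> (\<psi> \<circ> inv_into D \<kappa>) (\<kappa> x) (N x))"

definition surface_curve :: "'p topology \<Rightarrow> 'p atlas \<Rightarrow> real set \<Rightarrow> (real \<Rightarrow> 'p) \<Rightarrow> bool" where
  "surface_curve X A I \<beta> \<longleftrightarrow> continuous_map (top_of_set I) X \<beta> \<and>
     (\<forall>(D, \<kappa>)\<in>A. regular_analytic_curve {s \<in> I. \<beta> s \<in> D} (\<kappa> \<circ> \<beta>))"

definition contains_with_conormal ::
    "real^3 \<Rightarrow> 'p topology \<Rightarrow> 'p atlas \<Rightarrow> ('p \<Rightarrow> real^3) \<Rightarrow>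
     real set \<Rightarrow> (real \<Rightarrow> real^3) \<Rightarrow> (real \<Rightarrow> real^3) \<Rightarrow> (real \<Rightarrow> 'p) \<Rightarrow> bool" where
  "contains_with_conormal \<xi> X A \<psi> I \<alpha> U \<beta> \<longleftrightarrow> surface_curve X A I \<beta> \<and>
     (\<exists>N. affine_conormal \<xi> A \<psi> N \<and> (\<forall>s\<in>I. \<psi> (\<beta> s) = \<alpha> s \<and> N (\<beta> s) = U s))"

text \<open>If \<open>\<phi>\<close> is moreover injective, it is a diffeomorphism from \<open>V\<close> onto an open subset.\<close>

definition local_diffeo :: "(real \<times> real) set \<Rightarrow> 'p topology \<Rightarrow> 'p atlas \<Rightarrow> (real \<times> real \<Rightarrow> 'p) \<Rightarrow> bool" where
  "local_diffeo V X A \<phi> \<longleftrightarrow> continuous_map (top_of_set V) X \<phi> \<and>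
     (\<forall>(D, \<kappa>)\<in>A. smooth_on {p \<in> V. \<phi> p \<in> D} (\<kappa> \<circ> \<phi>) \<and>
        (\<forall>p\<in>V. \<phi> p \<in> D \<longrightarrow> bij (frechet_derivative (\<kappa> \<circ> \<phi>) (at p))))"

abbreviation planar_atlas :: "(real \<times> real) set \<Rightarrow> (real \<times> real) atlas" where
  "planar_atlas W \<equiv> {(W, \<lambda>p. p)}"


section \<open>Admissible pairs\<close>

definition admissible_pair :: "real^3 \<Rightarrow> real set \<Rightarrow> (real \<Rightarrow> real^3) \<Rightarrow> (real \<Rightarrow> real^3) \<Rightarrow> bool" where
  "admissible_pair \<xi> I \<alpha> U \<longleftrightarrow> regular_analytic_curve I \<alpha> \<and> regular_analytic_curve I U \<and>
     (\<exists>l :: real \<Rightarrow> real. real_analytic_on I l \<and>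
       (\<forall>s\<in>I. l s > 0 \<and>
          vector_derivative \<alpha> (at s) \<bullet> U s = 0 \<and>
          \<xi> \<bullet> U s = 1 \<and>
          l s = vector_derivative (\<lambda>u. vector_derivative \<alpha> (at u)) (at s) \<bullet> U s \<and>
          l s = - (vector_derivative \<alpha> (at s) \<bullet> vector_derivative U (at s))))"


section \<open>Split-complex numbers and the representation\<close>

text \<open>The split-complex number \<open>s + jt\<close> is the pair \<open>(s, t)\<close>, so \<open>Re\<close> and \<open>Im\<close> are \<open>fst\<close> and \<open>snd\<close>,
  and a real number acts by scalar multiplication.\<close>

type_synonym split_complex = "real \<times> real"

definition split_mult :: "split_complex \<Rightarrow> split_complex \<Rightarrow> split_complex" (infixl \<open>\<odot>\<close> 70) where
  "z \<odot> w = (fst z * fst w + snd z * snd w, fst z * snd w + snd z * fst w)"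

definition split_j :: split_complex where
  "split_j = (0, 1)"

definition split_ext :: "(real \<Rightarrow> real) \<Rightarrow> split_complex \<Rightarrow> split_complex" where
  "split_ext g = (\<lambda>(s, t). ((g (s + t) + g (s - t)) / 2, (g (s + t) - g (s - t)) / 2))"

definition split_dz :: "(split_complex \<Rightarrow> real) \<Rightarrow> split_complex \<Rightarrow> split_complex" where
  "split_dz f p = (1/2) *\<^sub>R ((frechet_derivative f (at p) (1, 0), 0)
                    + split_j \<odot> (frechet_derivative f (at p) (0, 1), 0))"

definition Phi1 :: "(real \<Rightarrow> real^3) \<Rightarrow> (real \<Rightarrow> real^3) \<Rightarrow> split_complex \<Rightarrow> split_complex" where
  "Phi1 \<alpha> U z = (1/2) *\<^sub>R (split_ext (\<lambda>s. U s $ 1) z - split_j \<odot> split_ext (\<lambda>s. \<alpha> s $ 2) z)"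

definition Phi2 :: "(real \<Rightarrow> real^3) \<Rightarrow> (real \<Rightarrow> real^3) \<Rightarrow> split_complex \<Rightarrow> split_complex" where
  "Phi2 \<alpha> U z = (1/2) *\<^sub>R (split_ext (\<lambda>s. U s $ 2) z + split_j \<odot> split_ext (\<lambda>s. \<alpha> s $ 1) z)"

definition split_representation ::
    "real set \<Rightarrow> (real \<Rightarrow> real^3) \<Rightarrow> (real \<Rightarrow> real^3) \<Rightarrow> split_complex set \<Rightarrow>
     (split_complex \<Rightarrow> real^3) \<Rightarrow> (split_complex \<Rightarrow> real^3) \<Rightarrow> bool" where
  "split_representation I \<alpha> U W \<psi> N \<longleftrightarrow>
     (\<forall>z\<in>W. N z = vector [fst (2 *\<^sub>R Phi1 \<alpha> U z), fst (2 *\<^sub>R Phi2 \<alpha> U z), 1]) \<and>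
     (\<forall>z\<in>W. \<psi> z $ 1 = snd (2 *\<^sub>R Phi2 \<alpha> U z) \<and> \<psi> z $ 2 = snd (- 2 *\<^sub>R Phi1 \<alpha> U z)) \<and>
     (\<lambda>z. \<psi> z $ 3) differentiable_on W \<and>
     (\<forall>z\<in>W. - split_dz (\<lambda>z. \<psi> z $ 3) z =
        (N z $ 1) *\<^sub>R split_dz (\<lambda>z. \<psi> z $ 1) z + (N z $ 2) *\<^sub>R split_dz (\<lambda>z. \<psi> z $ 2) z) \<and>
     (\<exists>s0\<in>I. \<psi> (s0, 0) $ 3 = \<alpha> s0 $ 3)"

end

theory Submission
  imports Defs
begin

text \<open>
  Let \<open>\<psi>\<close> be an indefinite improper affine sphere with normal \<open>(0, 0, 1)\<close> and conormal \<open>N\<close>. The planar maps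
  \<open>a = (N\<^sub>1 - \<psi>\<^sub>2, N\<^sub>2 + \<psi>\<^sub>1)\<close> and \<open>b = (N\<^sub>1 + \<psi>\<^sub>2, N\<^sub>2 - \<psi>\<^sub>1)\<close>, which are the values of \<open>2(\<Phi>\<^sub>1, \<Phi>\<^sub>2)\<close> at \<open>j = 1\<close> and
  \<open>j = -1\<close>, both have differentials of rank one: the Jacobian of either is the sum of a trace term, which
  vanishes because the affine metric is symmetric, and a term that vanishes by the volume condition. Along
  the given curve \<open>a\<close> and \<open>b\<close> are regular since \<open>\<langle>\<alpha>', U'\<rangle> \<noteq> 0\<close>. So near the curve there are coordinates
  \<open>(u, v)\<close> in which \<open>a\<close> depends only on \<open>u\<close>, \<open>b\<close> only on \<open>v\<close>, and the curve is the diagonal; with \<open>u = s + t\<close>,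
  \<open>v = s - t\<close> this is the representation, and \<open>\<psi>\<^sub>3\<close> is recovered from \<open>\<langle>N, d\<psi>\<rangle> = 0\<close>.

  The local reparametrizations are lifts through the local homeomorphism \<open>\<psi>\<close>, so they agree on overlapping
  diamonds \<open>{s + t \<in> J, s - t \<in> J}\<close> and glue. Their smoothness in every chart is read off the projection
  to the first two coordinates, a local diffeomorphism.
\<close>

section \<open>Calculus of smooth maps\<close>

text \<open>The idempotents (1 + j)/2 and (1 - j)/2 split C' into R x R, so a split-holomorphic
  function is a pair of one-variable functions, one of s + t and one of s - t. That is why the
  formulas for N and for the first two coordinates amount to a and b each depending on a single null
  coordinate. The competing sphere is only smooth, so it cannot be matched with the formula by
  comparing power series; the rank condition does that work. It also lives on an abstract surface,
  and its curve may run through many charts. What holds the local pieces together is that an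
  immersion is locally injective: two continuous lifts through it that agree at one point of a
  connected set agree on all of it. The explicit surface has the metric \<mu> (ds^2 - dt^2), where
  \<mu> = - <\<alpha>', U'> on the curve; away from the curve \<mu> may vanish, so the domain is cut
  down to \<mu> > 0. A final difficulty is global: the reparametrization is a local diffeomorphism,
  and making it injective near a possibly non-compact embedded curve needs a neighbourhood of
  varying width.\<close>

lemma Ck_on_has_derivative:
  assumes "open S" "Ck_on (Suc k) S f" "p \<in> S"
  shows "(f has_derivative frechet_derivative f (at p)) (at p)"
  using assms by (simp add: differentiable_on_eq_differentiable_at frechet_derivative_works)

lemma Ck_on_lower:
  assumes "Ck_on (Suc k) S f"
  shows "Ck_on k S f"
  using assms
proof (induction k arbitrary: f)
  case 0
  then show ?case by (simp add: differentiable_imp_continuous_on)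
next
  case (Suc k)
  then show ?case by (auto simp del: Ck_on.simps(2) simp: Ck_on.simps(2)[of k] Ck_on.simps(2)[of "Suc k"])
qed

lemma Ck_on_continuous_on: "Ck_on k S f \<Longrightarrow> continuous_on S f"
  by (cases k) (auto simp: differentiable_imp_continuous_on)

lemma Ck_on_subset:
  assumes "Ck_on k S f" "T \<subseteq> S"
  shows "Ck_on k T f"
  using assms
proof (induction k arbitrary: f)
  case 0
  then show ?case using continuous_on_subset by auto
next
  case (Suc k)
  then show ?case using differentiable_on_subset by (auto)
qed

lemma Ck_on_cong:
  assumes "open S" "Ck_on k S f" "\<And>p. p \<in> S \<Longrightarrow> f p = g p"
  shows "Ck_on k S g"
  using assms(2,3)
proof (induction k arbitrary: f g)
  case 0
  then show ?case using continuous_on_cong by force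
next
  case (Suc k)
  have eq: "frechet_derivative f (at p) v = frechet_derivative g (at p) v" if "p \<in> S" for p v
    using frechet_derivative_transform_within_open[of f p S g] Suc.prems assms(1) that
    by (simp add: differentiable_on_eq_differentiable_at)
  have "g differentiable_on S"
    unfolding differentiable_on_def
  proof
    fix p assume p: "p \<in> S"
    then have "f differentiable at p within S" using Suc.prems by (simp add: differentiable_on_def)
    then show "g differentiable at p within S"
      by (rule differentiable_transform_within[where d=1]) (use p Suc.prems in auto)
  qed
  then show ?case
    using Suc.IH[OF _ eq] Suc.prems by auto
qed

text \<open>\<open>Ck_on\<close> speaks of \<open>frechet_derivative\<close>; on an open set any
  explicit derivative \<open>D\<close> may replace it, and this is what drives most of the
  inductions on k below.\<close>

lemma Ck_on_SucI:
  assumes S: "open S" and D: "\<And>p. p \<in> S \<Longrightarrow> (f has_derivative D p) (at p)"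
    and C: "\<And>v. Ck_on k S (\<lambda>p. D p v)"
  shows "Ck_on (Suc k) S f"
proof -
  have "f differentiable_on S"
    using D S by (auto simp: differentiable_on_eq_differentiable_at differentiable_def)
  moreover have "Ck_on k S (\<lambda>p. frechet_derivative f (at p) v)" for v
    by (rule Ck_on_cong[OF S C[of v]]) (simp add: frechet_derivative_at[OF D, symmetric])
  ultimately show ?thesis by simp
qed

lemma Ck_on_const [simp]: "Ck_on k S (\<lambda>p. c)"
  by (induction k arbitrary: c) auto

lemma Ck_on_bounded_linear:
  assumes L: "bounded_linear L" and S: "open S" and f: "Ck_on k S f"
  shows "Ck_on k S (\<lambda>p. L (f p))"
  using f
proof (induction k arbitrary: f)
  case 0
  then show ?case by (simp add: L bounded_linear.continuous_on)
next
  case (Suc k)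
  show ?case
  proof (rule Ck_on_SucI[OF S])
    show "((\<lambda>p. L (f p)) has_derivative (\<lambda>v. L (frechet_derivative f (at p) v))) (at p)" if "p \<in> S" for p
      using bounded_linear.has_derivative[OF L Ck_on_has_derivative[OF S Suc.prems that]] .
  qed (use Suc in auto)
qed

lemma Ck_on_add:
  assumes S: "open S" and "Ck_on k S f" "Ck_on k S g"
  shows "Ck_on k S (\<lambda>p. f p + g p)"
  using assms(2,3)
proof (induction k arbitrary: f g)
  case 0
  then show ?case by (simp add: continuous_on_add)
next
  case (Suc k)
  show ?case
  proof (rule Ck_on_SucI[OF S])
    show "((\<lambda>p. f p + g p) has_derivative
        (\<lambda>v. frechet_derivative f (at p) v + frechet_derivative g (at p) v)) (at p)" if "p \<in> S" for p
      using Ck_on_has_derivative[OF S] Suc.prems that by (intro has_derivative_add) auto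
  qed (use Suc in auto)
qed

lemma Ck_on_Pair:
  assumes S: "open S" and "Ck_on k S f" "Ck_on k S g"
  shows "Ck_on k S (\<lambda>p. (f p, g p))"
proof -
  have l: "bounded_linear (\<lambda>x. (x, 0))" "bounded_linear (\<lambda>x. (0, x))"
    by (auto intro!: bounded_linear_Pair bounded_linear_ident bounded_linear_zero)
  have "Ck_on k S (\<lambda>p. (f p, 0) + (0, g p))"
    by (rule Ck_on_add[OF S Ck_on_bounded_linear[OF l(1) S assms(2)] Ck_on_bounded_linear[OF l(2) S assms(3)]])
  then show ?thesis by simp
qed

lemma Ck_on_sum:
  assumes S: "open S" and "\<And>i. i \<in> F \<Longrightarrow> Ck_on k S (f i)"
  shows "Ck_on k S (\<lambda>p. \<Sum>i\<in>F. f i p)"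
  using assms(2) by (induction F rule: infinite_finite_induct) (auto intro: Ck_on_add[OF S])

text \<open>The product rule multiplies f itself by a derivative of g, so the induction needs f and
  g in the lower class as well.\<close>

lemma Ck_on_bilinear:
  assumes B: "bounded_bilinear B" and S: "open S" and "Ck_on k S f" "Ck_on k S g"
  shows "Ck_on k S (\<lambda>p. B (f p) (g p))"
  using assms(3,4)
proof (induction k arbitrary: f g)
  case 0
  then show ?case by (simp add: bounded_bilinear.continuous_on[OF B])
next
  case (Suc k)
  have fg: "Ck_on k S f" "Ck_on k S g" by (rule Ck_on_lower, fact)+
  show ?case
  proof (rule Ck_on_SucI[OF S])
    show "((\<lambda>p. B (f p) (g p)) has_derivative
        (\<lambda>v. B (f p) (frechet_derivative g (at p) v) + B (frechet_derivative f (at p) v) (g p))) (at p)"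
      if "p \<in> S" for p
      by (intro bounded_bilinear.FDERIV[OF B] Ck_on_has_derivative[OF S Suc.prems(1) that]
          Ck_on_has_derivative[OF S Suc.prems(2) that])
    show "Ck_on k S (\<lambda>p. B (f p) (frechet_derivative g (at p) v) + B (frechet_derivative f (at p) v) (g p))" for v
      using Suc.prems by (intro Ck_on_add[OF S] Suc.IH fg) auto
  qed
qed

text \<open>The class controls derivatives in a fixed direction only, whereas the chain rule
  evaluates the derivative of g in the moving direction df(v). Expanding that direction in the basis
  leaves C^k scalars times compositions of fixed-direction derivatives, to which the induction
  hypothesis applies.\<close>

lemma Ck_on_compose:
  fixes f :: "'a::euclidean_space \<Rightarrow> 'b::euclidean_space" and g :: "'b \<Rightarrow> 'c::real_normed_vector"
  assumes S: "open S" and T: "open T" and fST: "f ` S \<subseteq> T"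
    and "Ck_on k S f" "Ck_on k T g"
  shows "Ck_on k S (\<lambda>p. g (f p))"
  using assms(4,5)
proof (induction k arbitrary: g)
  case 0
  then show ?case using fST by (auto intro: continuous_on_compose2)
next
  case (Suc k)
  have f: "Ck_on k S f" by (rule Ck_on_lower, fact)
  have fp: "f p \<in> T" if "p \<in> S" for p using that fST by auto
  have df: "Ck_on k S (\<lambda>p. frechet_derivative f (at p) v \<bullet> i)" for v i
    using Ck_on_bounded_linear[OF bounded_linear_inner_left S] Suc.prems(1) by auto
  show ?case
  proof (rule Ck_on_SucI[OF S])
    show "((\<lambda>p. g (f p)) has_derivative
        (\<lambda>v. \<Sum>i\<in>Basis. (frechet_derivative f (at p) v \<bullet> i) *\<^sub>R frechet_derivative g (at (f p)) i)) (at p)"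
      if p: "p \<in> S" for p
    proof -
      have g: "(g has_derivative frechet_derivative g (at (f p))) (at (f p))"
        using Ck_on_has_derivative[OF T Suc.prems(2) fp[OF p]] .
      have l: "linear (frechet_derivative g (at (f p)))"
        using g has_derivative_linear by blast
      have "(\<Sum>i\<in>Basis. (w \<bullet> i) *\<^sub>R frechet_derivative g (at (f p)) i) = frechet_derivative g (at (f p)) w" for w
        by (subst (2) euclidean_representation[symmetric])
          (simp add: linear_sum[OF l] linear_cmul[OF l])
      then show ?thesis
        using has_derivative_compose[OF Ck_on_has_derivative[OF S Suc.prems(1) p] g] by simp
    qed
    show "Ck_on k S (\<lambda>p. \<Sum>i\<in>Basis. (frechet_derivative f (at p) v \<bullet> i) *\<^sub>R frechet_derivative g (at (f p)) i)" for v
      using Suc.prems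
      by (intro Ck_on_sum[OF S] Ck_on_bilinear[OF bounded_bilinear_scaleR S] df Suc.IH f) auto
  qed
qed

lemma Ck_on_local:
  assumes "\<And>p. p \<in> S \<Longrightarrow> \<exists>T. open T \<and> p \<in> T \<and> Ck_on k T f"
  shows "Ck_on k S f"
  using assms
proof (induction k arbitrary: f)
  case 0
  then show ?case
    by (simp, intro continuous_at_imp_continuous_on ballI) (meson continuous_on_eq_continuous_at)
next
  case (Suc k)
  have "f differentiable_on S"
    unfolding differentiable_on_def
  proof
    fix p assume "p \<in> S"
    then obtain T where "open T" "p \<in> T" "Ck_on (Suc k) T f" using Suc.prems by blast
    then have "f differentiable at p" by (simp add: differentiable_on_eq_differentiable_at)
    then show "f differentiable at p within S" by (rule differentiable_at_withinI)
  qed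
  moreover have "Ck_on k S (\<lambda>p. frechet_derivative f (at p) v)" for v
  proof (rule Suc.IH)
    fix p assume "p \<in> S"
    then obtain T where "open T" "p \<in> T" "Ck_on (Suc k) T f" using Suc.prems by blast
    then show "\<exists>T. open T \<and> p \<in> T \<and> Ck_on k T (\<lambda>p. frechet_derivative f (at p) v)" by auto
  qed
  ultimately show ?case by simp
qed

text \<open>The derivative of the inverse is a polynomial in the inverse itself, so each class feeds
  the next.\<close>

lemma Ck_on_inverse_real: "Ck_on k (- {0}) (inverse :: real \<Rightarrow> real)"
proof (induction k)
  case 0
  then show ?case by (auto intro!: continuous_intros)
next
  case (Suc k)
  have o: "open (- {0::real})" by auto
  show ?case
  proof (rule Ck_on_SucI[OF o])
    show "(inverse has_derivative (\<lambda>v. - (inverse p * v * inverse p))) (at p)" if "p \<in> - {0}" for p :: real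
      using that by (auto intro!: derivative_eq_intros)
    have "Ck_on k (- {0}) (\<lambda>p. inverse p * inverse p :: real)"
      using Ck_on_bilinear[OF bounded_bilinear_mult o Suc Suc] .
    from Ck_on_bounded_linear[OF bounded_linear_mult_right o this]
    show "Ck_on k (- {0}) (\<lambda>p. - (inverse p * v * inverse p))" for v :: real
      by (rule Ck_on_cong[OF o, of _ "\<lambda>p. (- v) * (inverse p * inverse p)"]) auto
  qed
qed

lemma smooth_on_has_derivative:
  "open S \<Longrightarrow> smooth_on S f \<Longrightarrow> p \<in> S \<Longrightarrow> (f has_derivative frechet_derivative f (at p)) (at p)"
  unfolding smooth_on_def by (erule Ck_on_has_derivative) auto

lemma smooth_on_frechet_derivative:
  "smooth_on S f \<Longrightarrow> smooth_on S (\<lambda>p. frechet_derivative f (at p) v)"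
  unfolding smooth_on_def by (metis Ck_on.simps(2))

lemma smooth_on_continuous_on: "smooth_on S f \<Longrightarrow> continuous_on S f"
  unfolding smooth_on_def by (auto intro: Ck_on_continuous_on)

lemma smooth_on_subset: "smooth_on S f \<Longrightarrow> T \<subseteq> S \<Longrightarrow> smooth_on T f"
  unfolding smooth_on_def by (auto intro: Ck_on_subset)

lemma smooth_on_cong:
  "open S \<Longrightarrow> smooth_on S f \<Longrightarrow> (\<And>p. p \<in> S \<Longrightarrow> f p = g p) \<Longrightarrow> smooth_on S g"
  unfolding smooth_on_def by (blast intro: Ck_on_cong[of S _ f g])

lemma smooth_on_compose:
  fixes f :: "'a::euclidean_space \<Rightarrow> 'b::euclidean_space" and g :: "'b \<Rightarrow> 'c::real_normed_vector"
  assumes "open S" "open T" "f ` S \<subseteq> T" "smooth_on S f" "smooth_on T g"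
  shows "smooth_on S (\<lambda>p. g (f p))"
  using assms unfolding smooth_on_def by (blast intro: Ck_on_compose[OF assms(1-3), of _ g])

lemma smooth_on_bounded_linear:
  "bounded_linear L \<Longrightarrow> open S \<Longrightarrow> smooth_on S f \<Longrightarrow> smooth_on S (\<lambda>p. L (f p))"
  unfolding smooth_on_def by (simp add: Ck_on_bounded_linear[of L S _ f])

lemma smooth_on_const: "smooth_on S (\<lambda>p. c)"
  unfolding smooth_on_def by simp

lemma smooth_on_ident: "open S \<Longrightarrow> smooth_on S (\<lambda>p. p)"
  unfolding smooth_on_def
proof
  fix k assume S: "open S"
  show "Ck_on k S (\<lambda>p. p)"
    by (cases k) (auto intro!: Ck_on_SucI[OF S, where D="\<lambda>p v. v"])
qed

lemma smooth_on_linear: "bounded_linear L \<Longrightarrow> open S \<Longrightarrow> smooth_on S L"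
  by (rule smooth_on_bounded_linear[OF _ _ smooth_on_ident])

lemma smooth_on_add:
  "open S \<Longrightarrow> smooth_on S f \<Longrightarrow> smooth_on S g \<Longrightarrow> smooth_on S (\<lambda>p. f p + g p)"
  unfolding smooth_on_def by (simp add: Ck_on_add[of S _ f g])

lemma smooth_on_scaleR:
  "open S \<Longrightarrow> smooth_on S f \<Longrightarrow> smooth_on S g \<Longrightarrow> smooth_on S (\<lambda>p. f p *\<^sub>R g p)"
  unfolding smooth_on_def by (simp add: Ck_on_bilinear[OF bounded_bilinear_scaleR, of S _ f g])

lemma smooth_on_mult:
  fixes f g :: "'a::euclidean_space \<Rightarrow> real"
  shows "open S \<Longrightarrow> smooth_on S f \<Longrightarrow> smooth_on S g \<Longrightarrow> smooth_on S (\<lambda>p. f p * g p)"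
  using smooth_on_scaleR[of S f g] by simp

lemma smooth_on_uminus:
  "open S \<Longrightarrow> smooth_on S f \<Longrightarrow> smooth_on S (\<lambda>p. - f p)"
  by (rule smooth_on_bounded_linear[OF bounded_linear_minus[OF bounded_linear_ident]])

lemma smooth_on_diff:
  "open S \<Longrightarrow> smooth_on S f \<Longrightarrow> smooth_on S g \<Longrightarrow> smooth_on S (\<lambda>p. f p - g p)"
  using smooth_on_add[of S f "\<lambda>p. - g p"] smooth_on_uminus[of S g] by simp

lemma smooth_on_divide:
  fixes f g :: "'a::euclidean_space \<Rightarrow> real"
  assumes S: "open S" and "smooth_on S f" and g: "smooth_on S g" "\<And>p. p \<in> S \<Longrightarrow> g p \<noteq> 0"
  shows "smooth_on S (\<lambda>p. f p / g p)"
proof -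
  have "smooth_on S (\<lambda>p. inverse (g p))"
    by (rule smooth_on_compose[OF S, of "- {0}"])
      (use g in \<open>auto simp: smooth_on_def Ck_on_inverse_real\<close>)
  from smooth_on_mult[OF S assms(2) this] show ?thesis by (simp add: divide_inverse)
qed

lemma smooth_on_vec_nth:
  fixes f :: "'a::euclidean_space \<Rightarrow> real ^ 'n"
  shows "open S \<Longrightarrow> smooth_on S f \<Longrightarrow> smooth_on S (\<lambda>p. f p $ i)"
  by (rule smooth_on_bounded_linear[OF bounded_linear_vec_nth, of S f])

lemma smooth_on_vector_3:
  fixes f g h :: "'a::euclidean_space \<Rightarrow> real"
  assumes S: "open S" and "smooth_on S f" "smooth_on S g" "smooth_on S h"
  shows "smooth_on S (\<lambda>p. vector [f p, g p, h p] :: real^3)"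
proof -
  have "smooth_on S (\<lambda>p. f p *\<^sub>R axis 1 1 + g p *\<^sub>R axis 2 1 + h p *\<^sub>R axis 3 1 :: real^3)"
    by (intro smooth_on_add smooth_on_scaleR smooth_on_const assms)
  then show ?thesis
    by (rule smooth_on_cong[OF S]) (simp add: vec_eq_iff forall_3 axis_def)
qed

lemma smooth_on_Pair:
  "open S \<Longrightarrow> smooth_on S f \<Longrightarrow> smooth_on S g \<Longrightarrow> smooth_on S (\<lambda>p. (f p, g p))"
  unfolding smooth_on_def by (simp add: Ck_on_Pair[of S _ f g])

section \<open>Analytic curves, local inverses and lifts\<close>

lemma smooth_on_antiderivative:
  fixes F g :: "real \<Rightarrow> real"
  assumes S: "open S" and g: "smooth_on S g" and F: "\<And>s. s \<in> S \<Longrightarrow> (F has_real_derivative g s) (at s)"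
  shows "smooth_on S F"
  unfolding smooth_on_def
proof
  fix k
  have "Ck_on (Suc k) S F"
  proof (rule Ck_on_SucI[OF S])
    show "(F has_derivative (\<lambda>v. v * g p)) (at p)" if "p \<in> S" for p
      using F[OF that] by (simp add: has_field_derivative_def mult.commute[of _ "g p"])
    show "Ck_on k S (\<lambda>p. v * g p)" for v
      using smooth_on_mult[OF S smooth_on_const g] by (simp add: smooth_on_def)
  qed
  then show "Ck_on k S F" by (rule Ck_on_lower)
qed

text \<open>Termwise differentiation gives a power series with coefficients \<open>diffs c\<close>
  that converges on the same ball, so the induction runs over all coefficient sequences at
  once.\<close>

lemma Ck_on_power_series:
  fixes c :: "nat \<Rightarrow> real"
  assumes "\<And>x. \<bar>x\<bar> < r \<Longrightarrow> summable (\<lambda>n. c n * x ^ n)"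
  shows "Ck_on k (ball 0 r) (\<lambda>x. \<Sum>n. c n * x ^ n)"
  using assms
proof (induction k arbitrary: c)
  case 0
  have "(\<lambda>x. \<Sum>n. c n * x ^ n) differentiable at x" if "x \<in> ball 0 r" for x
    using termdiffs_strong'[of r c x] 0 that real_differentiable_def by (force simp: dist_real_def)
  then show ?case
    by (simp add: continuous_at_imp_continuous_on differentiable_imp_continuous_within)
next
  case (Suc k)
  show ?case
  proof (rule Ck_on_SucI)
    show "((\<lambda>x. \<Sum>n. c n * x ^ n) has_derivative (\<lambda>v. v * (\<Sum>n. diffs c n * p ^ n))) (at p)"
      if "p \<in> ball 0 r" for p
      using termdiffs_strong'[of r c p] Suc.prems that
      by (auto simp: has_field_derivative_def mult.commute[of _ "\<Sum>n. diffs c n * p ^ n"] dist_real_def)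
    have "Ck_on k (ball 0 r) (\<lambda>x. \<Sum>n. diffs c n * x ^ n)"
      by (rule Suc.IH) (use Suc.prems termdiff_converges[of _ r c] in auto)
    then show "Ck_on k (ball 0 r) (\<lambda>p. v * (\<Sum>n. diffs c n * p ^ n))" for v
      by (intro Ck_on_bounded_linear[OF bounded_linear_mult_right, of _ _ "\<lambda>p. \<Sum>n. diffs c n * p ^ n"]) auto
  qed auto
qed

lemma real_analytic_on_smooth_on:
  fixes f :: "real \<Rightarrow> real"
  assumes "real_analytic_on S f"
  shows "smooth_on S f"
  unfolding smooth_on_def
proof (intro allI Ck_on_local)
  fix k p assume "p \<in> S"
  then obtain r a where r: "r > 0" and a: "\<And>q. q \<in> ball p r \<Longrightarrow>
     ((\<lambda>m. (\<Prod>i\<in>Basis. ((q - p) \<bullet> i) ^ m i) *\<^sub>R a m) has_sum f q) (Basis \<rightarrow>\<^sub>E UNIV)"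
    using assms unfolding real_analytic_on_def by blast
  \<comment> \<open>The line has the single basis vector 1, so a multi-index is one exponent, and
    reindexing along e turns the unconditional sum into an ordinary power series.\<close>
  define e :: "nat \<Rightarrow> real \<Rightarrow> nat" where "e n = (\<lambda>i\<in>{1}. n)" for n
  define c where "c n = a (e n)" for n
  have e: "bij_betw e UNIV ({1} \<rightarrow>\<^sub>E UNIV)"
    by (rule bij_betwI[where g="\<lambda>m. m 1"]) (auto simp: e_def fun_eq_iff PiE_def extensional_def)
  have s: "(\<lambda>n. c n * x ^ n) sums f (p + x)" if "\<bar>x\<bar> < r" for x
  proof -
    have "((\<lambda>n. c n * x ^ n) has_sum f (p + x)) UNIV"
      using a[of "p + x"] that
      by (simp add: has_sum_reindex_bij_betw[OF e, symmetric] c_def e_def dist_real_def mult.commute)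
    then show ?thesis by (rule has_sum_imp_sums)
  qed
  then have "Ck_on k (ball 0 r) (\<lambda>x. \<Sum>n. c n * x ^ n)"
    by (intro Ck_on_power_series) (auto simp: sums_iff)
  moreover have "Ck_on k (ball p r) (\<lambda>q. q + (- p))"
    using smooth_on_add[OF _ smooth_on_ident smooth_on_const, of "ball p r" "-p"] by (simp add: smooth_on_def)
  moreover have "(\<lambda>q. q + (- p)) ` ball p r \<subseteq> ball 0 r"
    by (auto simp: dist_real_def)
  ultimately have "Ck_on k (ball p r) (\<lambda>q. \<Sum>n. c n * (q + (- p)) ^ n)"
    using Ck_on_compose[of "ball p r" "ball 0 r" "\<lambda>q. q + (- p)" k "\<lambda>x. \<Sum>n. c n * x ^ n"] by auto
  then have "Ck_on k (ball p r) f"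
  proof (rule Ck_on_cong[rotated])
    fix q assume "q \<in> ball p r"
    then show "(\<Sum>n. c n * (q + - p) ^ n) = f q"
      using s[of "q - p"] by (simp add: sums_iff dist_real_def abs_minus_commute)
  qed auto
  then show "\<exists>T. open T \<and> p \<in> T \<and> Ck_on k T f"
    using r by (intro exI[of _ "ball p r"]) auto
qed

lemma real_analytic_on_bounded_linear:
  assumes "bounded_linear L" "real_analytic_on S f"
  shows "real_analytic_on S (\<lambda>p. L (f p))"
  unfolding real_analytic_on_def
proof
  fix p assume "p \<in> S"
  then obtain r a where r: "r > 0" and a: "\<And>q. q \<in> ball p r \<Longrightarrow>
     ((\<lambda>m. (\<Prod>i\<in>Basis. ((q - p) \<bullet> i) ^ m i) *\<^sub>R a m) has_sum f q) (Basis \<rightarrow>\<^sub>E UNIV)"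
    using assms(2) unfolding real_analytic_on_def by blast
  interpret bounded_linear L by fact
  show "\<exists>r>0. \<exists>a. \<forall>q\<in>ball p r.
     ((\<lambda>m. (\<Prod>i\<in>Basis. ((q - p) \<bullet> i) ^ m i) *\<^sub>R a m) has_sum L (f q)) (Basis \<rightarrow>\<^sub>E UNIV)"
    using has_sum_bounded_linear[OF assms(1) a] r by (intro exI[of _ r] conjI exI[of _ "\<lambda>m. L (a m)"]) (auto simp: scaleR)
qed

lemma real_analytic_on_smooth_on_vec:
  fixes f :: "real \<Rightarrow> real^3"
  assumes "open I" "real_analytic_on I f"
  shows "smooth_on I f"
proof -
  have "smooth_on I (\<lambda>s. f s $ i)" for i
    by (rule real_analytic_on_smooth_on[OF real_analytic_on_bounded_linear[OF bounded_linear_vec_nth assms(2)]])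
  then have "smooth_on I (\<lambda>s. vector [f s $ 1, f s $ 2, f s $ 3] :: real^3)"
    by (intro smooth_on_vector_3 assms(1))
  then show ?thesis by (rule smooth_on_cong[OF assms(1)]) (simp add: vec_eq_iff forall_3)
qed

section \<open>Local inverses and regularity of lifts\<close>

lemma inverse_function_smooth:
  fixes f :: "'a::euclidean_space \<Rightarrow> 'a"
  assumes S: "open S" and f: "smooth_on S f" and x: "x \<in> S" and inj: "inj (frechet_derivative f (at x))"
  obtains U V g where "open U" "U \<subseteq> S" "x \<in> U" "open V" "f x \<in> V" "homeomorphism U V f g"
    "\<And>y. y \<in> V \<Longrightarrow> (g has_derivative inv (frechet_derivative f (at (g y)))) (at y)"
proof -
  define f' where "f' p = Blinfun (frechet_derivative f (at p))" for p
  have D: "(f has_derivative frechet_derivative f (at p)) (at p)" if "p \<in> S" for p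
    using smooth_on_has_derivative[OF S f that] .
  have f': "blinfun_apply (f' p) = frechet_derivative f (at p)" if "p \<in> S" for p
    using D[OF that] by (simp add: f'_def bounded_linear_Blinfun_apply has_derivative_bounded_linear)
  \<comment> \<open>The class gives continuity of the derivative in each fixed direction; in finite
    dimension this is continuity in the operator norm.\<close>
  have cont: "continuous_on S f'"
  proof (rule continuous_on_blinfun_componentwise)
    fix i
    have "continuous_on S (\<lambda>p. frechet_derivative f (at p) i)"
      using smooth_on_continuous_on[OF smooth_on_frechet_derivative[OF f]] .
    then show "continuous_on S (\<lambda>p. blinfun_apply (f' p) i)"
      using f' continuous_on_cong by force
  qed
  have "linear (frechet_derivative f (at x))" using D[OF x] has_derivative_linear by blast
  then obtain L where L: "linear L" "L \<circ> frechet_derivative f (at x) = id"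
    using inj linear_injective_left_inverse by blast
  have inv: "Blinfun L o\<^sub>L f' x = id_blinfun"
    using L x by (intro blinfun_eqI) (simp add: f' bounded_linear_Blinfun_apply linear_conv_bounded_linear fun_eq_iff)
  obtain U V g g' where *: "open U" "U \<subseteq> S" "x \<in> U" "open V" "f x \<in> V" "homeomorphism U V f g"
    "\<And>y. y \<in> V \<Longrightarrow> (g has_derivative (g' y)) (at y)"
    "\<And>y. y \<in> V \<Longrightarrow> g' y = inv (blinfun_apply (f' (g y)))"
    using inverse_function_theorem[OF S _ cont x inv] D f' by metis
  show thesis
  proof (rule that[OF *(1-6)])
    fix y assume y: "y \<in> V"
    then have "g y \<in> S" using *(2,6) by (auto simp: homeomorphism_def)
    then show "(g has_derivative inv (frechet_derivative f (at (g y)))) (at y)"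
      using *(7,8)[OF y] f' by simp
  qed
qed

text \<open>Cramer's rule. The explicit quotients make it visible that the inverse depends smoothly
  on the entries of L.\<close>

lemma linear_plane_det:
  fixes L :: "real \<times> real \<Rightarrow> real \<times> real"
  assumes L: "linear L" "inj L"
  defines "D \<equiv> fst (L (1, 0)) * snd (L (0, 1)) - fst (L (0, 1)) * snd (L (1, 0))"
  shows "D \<noteq> 0"
    and "inv L w = ((snd (L (0, 1)) * fst w - fst (L (0, 1)) * snd w) / D,
                    (fst (L (1, 0)) * snd w - snd (L (1, 0)) * fst w) / D)"
proof -
  have exp: "L (x, y) = x *\<^sub>R L (1, 0) + y *\<^sub>R L (0, 1)" for x y
    using linear_add[OF L(1), of "(x, 0)" "(0, y)"] linear_cmul[OF L(1), of x "(1, 0)"]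
      linear_cmul[OF L(1), of y "(0, 1)"] by simp
  obtain M where M: "linear M" "M \<circ> L = id"
    using L linear_injective_left_inverse by blast
  have LM: "L \<circ> M = id"
    using L M linear_injective_isomorphism by (metis linear_inverse_left)
  show D: "D \<noteq> 0"
  proof
    assume D0: "D = 0"
    have z: "L v = 0 \<Longrightarrow> v = 0" for v
      using L linear_injective_0 by blast
    \<comment> \<open>If the determinant vanishes, the columns of the adjugate (up to sign) lie in
      the kernel; injectivity then makes all entries zero.\<close>
    have "L (fst (L (0, 1)), - fst (L (1, 0))) = 0" "L (snd (L (0, 1)), - snd (L (1, 0))) = 0"
      using D0 by (subst exp, simp add: prod_eq_iff D_def algebra_simps)+
    from z[OF this(1)] z[OF this(2)] have "L (1, 0) = 0" by (simp add: prod_eq_iff)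
    from z[OF this] show False by (simp add: prod_eq_iff)
  qed
  let ?v = "((snd (L (0, 1)) * fst w - fst (L (0, 1)) * snd w) / D,
             (fst (L (1, 0)) * snd w - snd (L (1, 0)) * fst w) / D)"
  have cramer: "((d * x - b * y) / D) * a + ((a * y - c * x) / D) * b = x"
    "((d * x - b * y) / D) * c + ((a * y - c * x) / D) * d = y" if "D = a * d - b * c" for a b c d x y
  proof -
    have "(d * x - b * y) * a + (a * y - c * x) * b = x * D" "(d * x - b * y) * c + (a * y - c * x) * d = y * D"
      by (simp_all add: that algebra_simps)
    then show "((d * x - b * y) / D) * a + ((a * y - c * x) / D) * b = x"
      "((d * x - b * y) / D) * c + ((a * y - c * x) / D) * d = y"
      using D by (simp_all add: field_simps)
  qed
  have "L ?v = w"
    by (subst exp) (simp add: prod_eq_iff cramer[OF meta_eq_to_obj_eq[OF D_def]] del: times_divide_eq_left)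
  then show "inv L w = ?v" using inv_f_f[OF L(2)] by metis
qed

lemma linear_inj_bij:
  fixes L :: "'a::euclidean_space \<Rightarrow> 'a"
  shows "linear L \<Longrightarrow> inj L \<Longrightarrow> bij L"
  by (simp add: bij_def linear_injective_imp_surjective)

text \<open>A bootstrap. Locally g is a branch of the inverse of P after F, so its derivative is
  P'(g)^{-1} F', a smooth function of g and F'. Hence g in C^k implies g in C^(k+1), starting from
  mere continuity.\<close>

lemma smooth_on_lift:
  fixes g F P :: "real \<times> real \<Rightarrow> real \<times> real"
  assumes S: "open S" and T: "open T" and P: "smooth_on T P"
    and injP: "\<And>y. y \<in> T \<Longrightarrow> inj (frechet_derivative P (at y))"
    and F: "smooth_on S F" and g: "continuous_on S g" "g ` S \<subseteq> T" "\<And>x. x \<in> S \<Longrightarrow> P (g x) = F x"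
  shows "smooth_on S g"
    and "x \<in> S \<Longrightarrow> inj (frechet_derivative F (at x)) \<Longrightarrow> bij (frechet_derivative g (at x))"
proof -
  \<comment> \<open>Continuity keeps g inside one neighbourhood on which h inverts P, so near x it
    coincides with h after F.\<close>
  have D: "(g has_derivative (\<lambda>v. inv (frechet_derivative P (at (g x))) (frechet_derivative F (at x) v))) (at x)"
    if x: "x \<in> S" for x
  proof -
    have gx: "g x \<in> T" using x g by auto
    obtain U V h where U: "open U" "U \<subseteq> T" "g x \<in> U" and V: "open V" "P (g x) \<in> V" and hom: "homeomorphism U V P h"
      and h: "\<And>y. y \<in> V \<Longrightarrow> (h has_derivative inv (frechet_derivative P (at (h y)))) (at y)"
      using inverse_function_smooth[OF T P gx injP[OF gx]] by blast
    have hP: "h (P y) = y" if "y \<in> U" for y using hom that by (simp add: homeomorphism_def)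
    have o: "open (S \<inter> g -` U)" using continuous_open_preimage[OF g(1) S U(1)] .
    have "((\<lambda>y. h (F y)) has_derivative
        (\<lambda>v. inv (frechet_derivative P (at (h (F x)))) (frechet_derivative F (at x) v))) (at x)"
      using V g(3)[OF x] by (intro has_derivative_compose[OF smooth_on_has_derivative[OF S F x] h]) simp
    moreover have "h (F y) = g y" if "y \<in> S \<inter> g -` U" for y
      using that hP[of "g y"] g(3)[of y] by simp
    ultimately show ?thesis
      using has_derivative_transform_within_open[OF _ o, of "\<lambda>y. h (F y)" _ x UNIV g] x U(3) by auto
  qed
  \<comment> \<open>Base point and vector are separate arguments, so the derivative of g is R
    composed with x -> (g x, F'(x) v). \<open>Q\<close> is the same map in Cramer form, from which
    smoothness is read off.\<close>
  define R where "R q = inv (frechet_derivative P (at (fst q))) (snd q)" for q :: "(real \<times> real) \<times> (real \<times> real)"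
  define p where "p i q = frechet_derivative P (at (fst q)) i" for i and q :: "(real \<times> real) \<times> (real \<times> real)"
  define d where "d q = fst (p (1, 0) q) * snd (p (0, 1) q) - fst (p (0, 1) q) * snd (p (1, 0) q)" for q
  define Q where "Q q = ((snd (p (0, 1) q) * fst (snd q) - fst (p (0, 1) q) * snd (snd q)) / d q,
        (fst (p (1, 0) q) * snd (snd q) - snd (p (1, 0) q) * fst (snd q)) / d q)" for q
  have lin: "linear (frechet_derivative P (at y))" if "y \<in> T" for y
    using smooth_on_has_derivative[OF T P that] has_derivative_linear by blast
  have oT: "open (T \<times> (UNIV :: (real \<times> real) set))" by (intro open_Times T) auto
  have RQ: "Q q = R q" and dq: "d q \<noteq> 0" if "q \<in> T \<times> UNIV" for q
    using linear_plane_det[OF lin injP, of "fst q"] that by (auto simp: Q_def R_def d_def p_def)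
  have ps: "smooth_on (T \<times> UNIV) (p i)" for i
    unfolding p_def
    by (rule smooth_on_compose[OF oT T _ smooth_on_linear[OF bounded_linear_fst oT] smooth_on_frechet_derivative[OF P]]) auto
  note bl = smooth_on_bounded_linear[OF bounded_linear_fst oT] smooth_on_bounded_linear[OF bounded_linear_snd oT]
  have ss: "smooth_on (T \<times> UNIV) (\<lambda>q :: (real \<times> real) \<times> (real \<times> real). snd q)"
    by (rule smooth_on_linear[OF bounded_linear_snd oT])
  have ds: "smooth_on (T \<times> UNIV) d"
    unfolding d_def by (intro smooth_on_diff smooth_on_mult bl ps oT)
  have "smooth_on (T \<times> UNIV) Q"
    unfolding Q_def
    by (intro smooth_on_Pair smooth_on_divide smooth_on_diff smooth_on_mult bl ps ds ss oT dq)
  then have R: "smooth_on (T \<times> UNIV) R"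
    by (rule smooth_on_cong[OF oT]) (use RQ in auto)
  show "smooth_on S g"
    unfolding smooth_on_def
  proof
    fix k show "Ck_on k S g"
    proof (induction k)
      case 0 then show ?case using g by simp
    next
      case (Suc k)
      show ?case
      proof (rule Ck_on_SucI[OF S D])
        fix v
        have "Ck_on k S (\<lambda>x. (g x, frechet_derivative F (at x) v))"
          using smooth_on_frechet_derivative[OF F] by (intro Ck_on_Pair[OF S Suc]) (simp add: smooth_on_def)
        then have "Ck_on k S (\<lambda>x. R (g x, frechet_derivative F (at x) v))"
          using R g(2) by (rule_tac Ck_on_compose[OF S oT, of "\<lambda>x. (g x, frechet_derivative F (at x) v)"])
            (auto simp: smooth_on_def)
        then show "Ck_on k S (\<lambda>x. inv (frechet_derivative P (at (g x))) (frechet_derivative F (at x) v))"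
          by (simp add: R_def)
      qed
    qed
  qed
  show "bij (frechet_derivative g (at x))" if x: "x \<in> S" and inj: "inj (frechet_derivative F (at x))"
  proof -
    have "linear (frechet_derivative F (at x))"
      using smooth_on_has_derivative[OF S F x] has_derivative_linear by blast
    then have "bij (frechet_derivative F (at x))" using inj by (rule linear_inj_bij)
    moreover have "bij (frechet_derivative P (at (g x)))"
      using x g(2) by (intro linear_inj_bij lin injP) auto
    ultimately have "bij (inv (frechet_derivative P (at (g x))) \<circ> frechet_derivative F (at x))"
      by (intro bij_comp bij_imp_bij_inv)
    then show ?thesis
      using frechet_derivative_at[OF D[OF x]] by (simp add: comp_def)
  qed
qed

section \<open>Algebra of the affine metric\<close>

abbreviation (input) e3 :: "real^3" where "e3 \<equiv> vector [0, 0, 1]"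

text \<open>The determinant of L (1, 0), L (0, 1) and the vertical vector, equally the Jacobian of L
  followed by the projection along the affine normal. That it is non-zero encodes immersion and
  transversality together.\<close>

definition hdet :: "(real \<times> real \<Rightarrow> real^3) \<Rightarrow> real" where
  "hdet L = L (1, 0) $ 1 * L (0, 1) $ 2 - L (0, 1) $ 1 * L (1, 0) $ 2"

lemma linear_plane:
  fixes L :: "real \<times> real \<Rightarrow> 'a::real_vector"
  assumes "linear L"
  shows "L X = fst X *\<^sub>R L (1, 0) + snd X *\<^sub>R L (0, 1)"
  using linear_add[OF assms, of "(fst X, 0)" "(0, snd X)"] linear_cmul[OF assms, of "fst X" "(1, 0)"]
    linear_cmul[OF assms, of "snd X" "(0, 1)"] by simp

lemma hdet_wedge:
  assumes "linear L"
  shows "L X $ 1 * L Y $ 2 - L Y $ 1 * L X $ 2 = hdet L * (fst X * snd Y - fst Y * snd X)"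
  unfolding hdet_def linear_plane[OF assms, of X] linear_plane[OF assms, of Y]
  by (simp add: algebra_simps)

lemma hdet_nonzero:
  assumes L: "linear L" and inj: "inj L" and e: "e3 \<notin> range L"
  shows "hdet L \<noteq> 0"
proof
  assume 0: "hdet L = 0"
  have z: "X = 0" if "L X $ 1 = 0" "L X $ 2 = 0" for X
  proof (rule ccontr)
    assume "X \<noteq> 0"
    then have "L X \<noteq> 0" using L inj linear_injective_0 by blast
    then have c: "L X $ 3 \<noteq> 0" using that by (simp add: vec_eq_iff forall_3)
    have "L ((1 / L X $ 3) *\<^sub>R X) = e3"
      using that c by (simp add: linear_cmul[OF L] vec_eq_iff forall_3)
    then show False using e by (metis rangeI)
  qed
  \<comment> \<open>The image of this vector has i-th component zero identically, and the other
    horizontal component is \<open>hdet L\<close> up to sign. The two cases together annihilate the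
    horizontal part of L (1, 0).\<close>
  have "(L (0, 1) $ i, - L (1, 0) $ i) = 0" if "i \<in> {1, 2}" for i
    using 0 that by (intro z; subst linear_plane[OF L]) (auto simp: hdet_def algebra_simps)
  from this[of 1] this[of 2] have "(1::real, 0::real) = 0"
    by (intro z) (auto simp: prod_eq_iff)
  then show False by (simp add: prod_eq_iff)
qed

lemma hdet_horizontal:
  assumes L: "linear L" and d: "hdet L \<noteq> 0" and X: "L X $ 1 = 0" "L X $ 2 = 0"
  shows "X = 0"
  using hdet_wedge[OF L, of X "(1, 0)"] hdet_wedge[OF L, of X "(0, 1)"] X d by (simp add: prod_eq_iff)

lemma hdet_immersion:
  assumes L: "linear L" and d: "hdet L \<noteq> 0"
  shows "inj L" "e3 \<notin> range L"
proof -
  show "inj L"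
    using hdet_horizontal[OF L d] by (intro linear_injective_0[OF L, THEN iffD2]) auto
  show "e3 \<notin> range L"
  proof
    assume "e3 \<in> range L"
    then obtain X where X: "L X = e3" by auto
    then have "X = 0" by (intro hdet_horizontal[OF L d]) (auto simp: X)
    then have "L X = 0" using linear_0[OF L] by simp
    then show False using X by (simp add: vec_eq_iff forall_3)
  qed
qed

lemma hdet_plane_inj:
  assumes L: "linear L" and d: "hdet L \<noteq> 0"
  shows "inj (\<lambda>X. (L X $ 1, L X $ 2))"
proof (rule injI)
  fix X Y assume "(L X $ 1, L X $ 2) = (L Y $ 1, L Y $ 2)"
  then have "X - Y = 0" by (intro hdet_horizontal[OF L d]) (auto simp: linear_diff[OF L])
  then show "X = Y" by simp
qed

text \<open>The existence half behind the description operator in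
  \<open>affine_metric\<close>.\<close>

lemma tangent_plus_vertical:
  assumes L: "linear L" and d: "hdet L \<noteq> 0"
  shows "\<exists>Z c. w = L Z + c *\<^sub>R e3"
proof -
  have "linear (\<lambda>X. (L X $ 1, L X $ 2))"
    by (intro linearI) (simp_all add: linear_add[OF L] linear_cmul[OF L])
  then have "surj (\<lambda>X. (L X $ 1, L X $ 2))"
    using hdet_plane_inj[OF L d] by (rule linear_injective_imp_surjective) simp
  then obtain Z where Z: "(w $ 1, w $ 2) = (L Z $ 1, L Z $ 2)" by (rule surjE)
  then have "w = L Z + (w $ 3 - L Z $ 3) *\<^sub>R e3" by (simp add: vec_eq_iff forall_3)
  then show ?thesis by blast
qed

section \<open>The affine metric through the conormal\<close>

lemma inner_3: "(x :: real^3) \<bullet> y = x $ 1 * y $ 1 + x $ 2 * y $ 2 + x $ 3 * y $ 3"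
  by (simp add: inner_vec_def sum_3)

lemma affine_conormal_atD:
  assumes "affine_conormal_at e3 f p n"
  shows "n $ 3 = 1" "n \<bullet> e3 = 1" "n \<bullet> frechet_derivative f (at p) X = 0"
  using assms unfolding affine_conormal_at_def by (auto simp: inner_3 simp del: split_paired_All)

text \<open>Pairing with the conormal kills the tangential part and sends the affine normal to 1, so
  it reads off the coefficient.\<close>

lemma affine_metric_conormal:
  assumes L: "linear (frechet_derivative f (at p))" and d: "hdet (frechet_derivative f (at p)) \<noteq> 0"
    and n: "affine_conormal_at e3 f p n"
  shows "affine_metric e3 f p X Y = n \<bullet> second_derivative f p X Y"
  unfolding affine_metric_def
proof (rule the_equality)
  obtain Z c where c: "second_derivative f p X Y = frechet_derivative f (at p) Z + c *\<^sub>R e3"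
    using tangent_plus_vertical[OF L d] by blast
  then have "n \<bullet> second_derivative f p X Y = c"
    by (simp add: affine_conormal_atD[OF n] inner_add_right)
  then show "\<exists>Z. second_derivative f p X Y
      = frechet_derivative f (at p) Z + (n \<bullet> second_derivative f p X Y) *\<^sub>R e3"
    using c by metis
next
  fix c assume "\<exists>Z. second_derivative f p X Y = frechet_derivative f (at p) Z + c *\<^sub>R e3"
  then show "c = n \<bullet> second_derivative f p X Y"
    by (auto simp: affine_conormal_atD[OF n] inner_add_right)
qed

text \<open>Differentiating <n, df(Y)> = 0 moves one derivative from f to the conormal, which leaves
  an expression of first order.\<close>

lemma conormal_second_derivative:
  assumes S: "open S" and p: "p \<in> S" and f: "smooth_on S f"
    and n: "(n has_derivative Dn) (at p)"
    and orth: "\<And>q X. q \<in> S \<Longrightarrow> n q \<bullet> frechet_derivative f (at q) X = 0"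
  shows "n p \<bullet> second_derivative f p X Y = - (Dn X \<bullet> frechet_derivative f (at p) Y)"
proof -
  have D: "((\<lambda>q. n q \<bullet> frechet_derivative f (at q) Y) has_derivative
      (\<lambda>X. n p \<bullet> second_derivative f p X Y + Dn X \<bullet> frechet_derivative f (at p) Y)) (at p)"
    unfolding second_derivative_def
    by (intro has_derivative_inner n smooth_on_has_derivative[OF S smooth_on_frechet_derivative[OF f] p])
  have "((\<lambda>q. 0) has_derivative
      (\<lambda>X. n p \<bullet> second_derivative f p X Y + Dn X \<bullet> frechet_derivative f (at p) Y)) (at p)"
    using has_derivative_transform_within_open[OF D S p] orth by simp
  then have "(\<lambda>X. n p \<bullet> second_derivative f p X Y + Dn X \<bullet> frechet_derivative f (at p) Y) = (\<lambda>X. 0)"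
    by (rule Deriv.has_derivative_zero_unique)
  then show ?thesis by (simp add: fun_eq_iff eq_neg_iff_add_eq_0 del: split_paired_All)
qed

lemma det_vertical:
  "det (vector [v, w, e3] :: real^3^3) = v $ 1 * w $ 2 - w $ 1 * v $ 2"
  by (simp add: det_3)

text \<open>For the form m (dx^2 - dy^2) the discriminant is the square of m times the wedge of X
  and Y, and by \<open>hdet_wedge\<close> the determinant is \<open>hdet\<close> times the same
  wedge. So the volume condition reduces to \<open>hdet\<close> being m.\<close>

lemma param_sphereI:
  assumes S: "open S" and f: "smooth_on S f" and n: "\<And>p. p \<in> S \<Longrightarrow> (n has_derivative Dn p) (at p)"
    and con: "\<And>p. p \<in> S \<Longrightarrow> affine_conormal_at e3 f p (n p)"
    and m: "\<And>p. p \<in> S \<Longrightarrow> m p > 0"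
    and h: "\<And>p X Y. p \<in> S \<Longrightarrow>
      - (Dn p X \<bullet> frechet_derivative f (at p) Y) = m p * (fst X * fst Y - snd X * snd Y)"
    and d: "\<And>p. p \<in> S \<Longrightarrow> hdet (frechet_derivative f (at p)) = m p"
  shows "indef_improper_affine_sphere_param e3 S f"
  unfolding indef_improper_affine_sphere_param_def
proof (intro conjI ballI f)
  fix p assume p: "p \<in> S"
  let ?L = "frechet_derivative f (at p)"
  have L: "linear ?L" using smooth_on_has_derivative[OF S f p] has_derivative_linear by blast
  have m0: "hdet ?L \<noteq> 0" "m p > 0" using d m p by (auto simp: less_le)
  show "inj ?L" "e3 \<notin> range ?L" using hdet_immersion[OF L m0(1)] by auto
  have am: "affine_metric e3 f p X Y = m p * (fst X * fst Y - snd X * snd Y)" for X Y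
    using affine_metric_conormal[OF L m0(1) con[OF p]] conormal_second_derivative[OF S p f n[OF p]]
      affine_conormal_atD(3)[OF con] h[OF p] by simp
  show "lorentzian (affine_metric e3 f p)"
    unfolding lorentzian_def
  proof (intro conjI)
    show "bilinear (affine_metric e3 f p)"
      by (auto simp: bilinear_def am intro!: linearI) (auto simp: algebra_simps)
    show "\<exists>e1 e2. affine_metric e3 f p e1 e1 = 1 \<and> affine_metric e3 f p e2 e2 = - 1 \<and> affine_metric e3 f p e1 e2 = 0"
      using m0(2)
      by (intro exI[of _ "(1 / sqrt (m p), 0)"] exI[of _ "(0, 1 / sqrt (m p))"]) (simp add: am)
  qed (auto simp: am)
  show "\<forall>X Y. sqrt ((affine_metric e3 f p X Y)\<^sup>2 - affine_metric e3 f p X X * affine_metric e3 f p Y Y)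
           = \<bar>det (vector [?L X, ?L Y, e3] :: real^3^3)\<bar>"
  proof (intro allI)
    fix X Y
    have "(affine_metric e3 f p X Y)\<^sup>2 - affine_metric e3 f p X X * affine_metric e3 f p Y Y
        = (m p * (fst X * snd Y - fst Y * snd X))\<^sup>2"
      by (simp add: am power2_eq_square algebra_simps)
    then show "sqrt ((affine_metric e3 f p X Y)\<^sup>2 - affine_metric e3 f p X X * affine_metric e3 f p Y Y)
           = \<bar>det (vector [?L X, ?L Y, e3] :: real^3^3)\<bar>"
      by (simp add: det_vertical hdet_wedge[OF L] d[OF p])
  qed
qed

lemma param_sphere_hdet:
  assumes S: "open S" and f: "indef_improper_affine_sphere_param e3 S f" and p: "p \<in> S"
  shows "linear (frechet_derivative f (at p))" "hdet (frechet_derivative f (at p)) \<noteq> 0"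
proof -
  show "linear (frechet_derivative f (at p))"
    using smooth_on_has_derivative[OF S _ p] f has_derivative_linear
    by (auto simp: indef_improper_affine_sphere_param_def)
  then show "hdet (frechet_derivative f (at p)) \<noteq> 0"
    using f p by (intro hdet_nonzero) (auto simp: indef_improper_affine_sphere_param_def)
qed

text \<open>The conormal is specified only pointwise. With third component 1, orthogonality to two
  tangent vectors is a 2 x 2 linear system of determinant \<open>hdet\<close>, and Cramer's rule
  writes the solution as quotients of smooth functions.\<close>

lemma conormal_smooth:
  assumes S: "open S" and f: "smooth_on S f"
    and d: "\<And>p. p \<in> S \<Longrightarrow> hdet (frechet_derivative f (at p)) \<noteq> 0"
    and con: "\<And>p. p \<in> S \<Longrightarrow> affine_conormal_at e3 f p (n p)"
  shows "smooth_on S n"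
proof -
  define F where "F i p = frechet_derivative f (at p) i" for i p
  define D where "D p = hdet (frechet_derivative f (at p))" for p
  have F: "smooth_on S (\<lambda>p. F i p $ k)" for i k
    unfolding F_def by (rule smooth_on_vec_nth[OF S smooth_on_frechet_derivative[OF f]])
  have D0: "D p \<noteq> 0" if "p \<in> S" for p using d[OF that] by (simp add: D_def)
  have D: "smooth_on S D"
    unfolding D_def hdet_def F_def[symmetric] by (intro smooth_on_diff smooth_on_mult F S)
  have "smooth_on S (\<lambda>p. vector
     [(F (0, 1) p $ 3 * F (1, 0) p $ 2 - F (1, 0) p $ 3 * F (0, 1) p $ 2) / D p,
      (F (1, 0) p $ 3 * F (0, 1) p $ 1 - F (0, 1) p $ 3 * F (1, 0) p $ 1) / D p, 1] :: real^3)"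
    by (intro smooth_on_vector_3 smooth_on_divide smooth_on_diff smooth_on_mult smooth_on_const F D D0 S)
  then show ?thesis
  proof (rule smooth_on_cong[OF S])
    fix p assume p: "p \<in> S"
    have n3: "n p $ 3 = 1" using affine_conormal_atD[OF con[OF p]] by simp
    have eq: "n p $ 1 * F i p $ 1 + n p $ 2 * F i p $ 2 = - F i p $ 3" for i
      using affine_conormal_atD(3)[OF con[OF p], of i] n3 by (simp add: inner_3 F_def eq_neg_iff_add_eq_0)
    have Dp: "D p = F (1, 0) p $ 1 * F (0, 1) p $ 2 - F (0, 1) p $ 1 * F (1, 0) p $ 2" "D p \<noteq> 0"
      using d[OF p] by (auto simp: D_def hdet_def F_def)
    have "n p $ 1 * D p = F (0, 1) p $ 3 * F (1, 0) p $ 2 - F (1, 0) p $ 3 * F (0, 1) p $ 2"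
      "n p $ 2 * D p = F (1, 0) p $ 3 * F (0, 1) p $ 1 - F (0, 1) p $ 3 * F (1, 0) p $ 1"
      using eq[of "(1, 0)"] eq[of "(0, 1)"] unfolding Dp(1) by algebra+
    then show "vector
     [(F (0, 1) p $ 3 * F (1, 0) p $ 2 - F (1, 0) p $ 3 * F (0, 1) p $ 2) / D p,
      (F (1, 0) p $ 3 * F (0, 1) p $ 1 - F (0, 1) p $ 3 * F (1, 0) p $ 1) / D p, 1] = n p"
      using Dp(2) n3 by (simp add: vec_eq_iff forall_3 field_simps)
  qed
qed

text \<open>The wedge of two functionals on the plane is determined by its value on the standard
  basis.\<close>

lemma linear_product_symmetric:
  fixes L M :: "real \<times> real \<Rightarrow> real"
  assumes "linear L" "linear M" "L (1, 0) * M (0, 1) = L (0, 1) * M (1, 0)"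
  shows "L X * M Y = L Y * M X"
proof -
  have "L X * M Y - L Y * M X = (fst X * snd Y - fst Y * snd X) * (L (1, 0) * M (0, 1) - L (0, 1) * M (1, 0))"
    unfolding linear_plane[OF assms(1), of X] linear_plane[OF assms(1), of Y]
      linear_plane[OF assms(2), of X] linear_plane[OF assms(2), of Y]
    by (simp add: algebra_simps)
  then show ?thesis using assms(3) by simp
qed

lemma sphere_null_rank:
  assumes S: "open S" and sp: "indef_improper_affine_sphere_param e3 S f"
    and con: "\<And>p. p \<in> S \<Longrightarrow> affine_conormal_at e3 f p (n p)" and p: "p \<in> S"
    and Dn: "Dn = frechet_derivative n (at p)" and Df: "Df = frechet_derivative f (at p)"
  shows "(Dn X $ 1 - Df X $ 2) * (Dn Y $ 2 + Df Y $ 1) = (Dn Y $ 1 - Df Y $ 2) * (Dn X $ 2 + Df X $ 1)"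
    and "(Dn X $ 1 + Df X $ 2) * (Dn Y $ 2 - Df Y $ 1) = (Dn Y $ 1 + Df Y $ 2) * (Dn X $ 2 - Df X $ 1)"
proof -
  have f: "smooth_on S f" using sp by (simp add: indef_improper_affine_sphere_param_def)
  note hd = param_sphere_hdet[OF S sp]
  have n: "smooth_on S n" using conormal_smooth[OF S f hd(2) con] .
  have lf: "linear Df" using hd(1)[OF p] Df by simp
  have n': "(n has_derivative Dn) (at p)" using smooth_on_has_derivative[OF S n p] Dn by simp
  then have ln: "linear Dn" using has_derivative_linear by blast
  \<comment> \<open>The conormal has constant third component 1, so the metric becomes a pairing of
    planar vectors.\<close>
  have n3: "Dn X $ 3 = 0" for X
  proof -
    have D: "((\<lambda>q. n q $ 3) has_derivative (\<lambda>X. Dn X $ 3)) (at p)"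
      using bounded_linear.has_derivative[OF bounded_linear_vec_nth n'] .
    have "((\<lambda>q. 1) has_derivative (\<lambda>X. Dn X $ 3)) (at p)"
      using has_derivative_transform_within_open[OF D S p] affine_conormal_atD(1)[OF con] by simp
    then show ?thesis
      using has_derivative_unique[OF _ has_derivative_const] by metis
  qed
  have am: "affine_metric e3 f p X Y = - (Dn X $ 1 * Df Y $ 1 + Dn X $ 2 * Df Y $ 2)" for X Y
    using affine_metric_conormal[OF hd(1,2)[OF p] con[OF p]] conormal_second_derivative[OF S p f n']
      affine_conormal_atD(3)[OF con] n3 Df by (simp add: inner_3)
  define P1 where "P1 = Dn (1, 0) $ 1"
  define P2 where "P2 = Dn (1, 0) $ 2"
  define Q1 where "Q1 = Dn (0, 1) $ 1"
  define Q2 where "Q2 = Dn (0, 1) $ 2"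
  define x1 where "x1 = Df (1, 0) $ 1"
  define x2 where "x2 = Df (1, 0) $ 2"
  define y1 where "y1 = Df (0, 1) $ 1"
  define y2 where "y2 = Df (0, 1) $ 2"
  note defs = P1_def P2_def Q1_def Q2_def x1_def x2_def y1_def y2_def
  have "affine_metric e3 f p (1, 0) (0, 1) = affine_metric e3 f p (0, 1) (1, 0)"
    using sp p by (simp add: indef_improper_affine_sphere_param_def lorentzian_def)
  then have sym: "P1 * y1 + P2 * y2 = Q1 * x1 + Q2 * x2"
    unfolding am defs by simp
  have d0: "x1 * y2 - y1 * x2 \<noteq> 0"
    using hd(2)[OF p] unfolding hdet_def Df[symmetric] defs .
  have area: "sqrt ((affine_metric e3 f p X Y)\<^sup>2 - affine_metric e3 f p X X * affine_metric e3 f p Y Y)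
      = \<bar>det (vector [frechet_derivative f (at p) X, frechet_derivative f (at p) Y, e3] :: real^3^3)\<bar>" for X Y
    using sp p unfolding indef_improper_affine_sphere_param_def by blast
  have "sqrt ((P1 * y1 + P2 * y2)\<^sup>2 - (P1 * x1 + P2 * x2) * (Q1 * y1 + Q2 * y2)) = \<bar>x1 * y2 - y1 * x2\<bar>"
    using area[of "(1, 0)" "(0, 1)"] unfolding am det_vertical Df[symmetric] defs
    by (simp only: power2_minus minus_mult_minus)
  then have "(P1 * y1 + P2 * y2)\<^sup>2 - (P1 * x1 + P2 * x2) * (Q1 * y1 + Q2 * y2) = (x1 * y2 - y1 * x2)\<^sup>2"
    by (simp add: real_sqrt_abs[symmetric] del: real_sqrt_abs)
  \<comment> \<open>Symmetry turns the square into a mixed product. Lagrange's identity then makes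
    the discriminant -(P wedge Q)(x wedge y), and cancelling x wedge y gives P wedge Q = -(x wedge
    y).\<close>
  moreover have "(P1 * y1 + P2 * y2)\<^sup>2 - (P1 * x1 + P2 * x2) * (Q1 * y1 + Q2 * y2)
      = (P1 * y1 + P2 * y2) * (Q1 * x1 + Q2 * x2) - (P1 * x1 + P2 * x2) * (Q1 * y1 + Q2 * y2)"
    by (simp add: power2_eq_square sym)
  ultimately have "(x1 * y2 - y1 * x2) * ((P1 * Q2 - P2 * Q1) + (x1 * y2 - y1 * x2)) = 0"
    by (simp add: power2_eq_square algebra_simps)
  then have det: "(P1 * Q2 - P2 * Q1) + (x1 * y2 - y1 * x2) = 0" using d0 by simp
  have l: "linear (\<lambda>X. Dn X $ i)" "linear (\<lambda>X. Df X $ i)" for i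
    by (intro linearI; simp add: linear_add[OF ln] linear_cmul[OF ln] linear_add[OF lf] linear_cmul[OF lf])+
  \<comment> \<open>Expanded, the two Jacobians are (P wedge Q + x wedge y) plus, respectively
    minus, (P.y - Q.x); both brackets vanish.\<close>
  have "(P1 - x2) * (Q2 + y1) = (Q1 - y2) * (P2 + x1)" "(P1 + x2) * (Q2 - y1) = (Q1 + y2) * (P2 - x1)"
    using det sym by (simp_all add: algebra_simps)
  note e = this[unfolded defs]
  show "(Dn X $ 1 - Df X $ 2) * (Dn Y $ 2 + Df Y $ 1) = (Dn Y $ 1 - Df Y $ 2) * (Dn X $ 2 + Df X $ 1)"
    by (rule linear_product_symmetric[OF linear_compose_sub[OF l] linear_compose_add[OF l] e(1)])
  show "(Dn X $ 1 + Df X $ 2) * (Dn Y $ 2 - Df Y $ 1) = (Dn Y $ 1 + Df Y $ 2) * (Dn X $ 2 - Df X $ 1)"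
    by (rule linear_product_symmetric[OF linear_compose_add[OF l] linear_compose_sub[OF l] e(2)])
qed

section \<open>Projection along the affine normal\<close>

definition shadow :: "(real \<times> real \<Rightarrow> real^3) \<Rightarrow> real \<times> real \<Rightarrow> real \<times> real" where
  "shadow f p = (f p $ 1, f p $ 2)"

text \<open>The Jacobian of the projected map is \<open>hdet\<close>. Being a map between planes, it
  admits the inverse function theorem, which the map into space does not.\<close>

lemma shadow_smooth:
  assumes S: "open S" and f: "smooth_on S f"
    and d: "\<And>p. p \<in> S \<Longrightarrow> hdet (frechet_derivative f (at p)) \<noteq> 0"
  shows "smooth_on S (shadow f)" and "p \<in> S \<Longrightarrow> inj (frechet_derivative (shadow f) (at p))"
proof -
  show "smooth_on S (shadow f)"
    unfolding shadow_def[abs_def] by (intro smooth_on_Pair smooth_on_vec_nth S f)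
  assume p: "p \<in> S"
  have f': "(f has_derivative frechet_derivative f (at p)) (at p)" using smooth_on_has_derivative[OF S f p] .
  have D: "(shadow f has_derivative
      (\<lambda>X. (frechet_derivative f (at p) X $ 1, frechet_derivative f (at p) X $ 2))) (at p)"
    unfolding shadow_def[abs_def]
    by (intro has_derivative_Pair bounded_linear.has_derivative[OF bounded_linear_vec_nth f'])
  show "inj (frechet_derivative (shadow f) (at p))"
    unfolding frechet_derivative_at[OF D, symmetric]
    by (rule hdet_plane_inj[OF has_derivative_linear[OF f'] d[OF p]])
qed

lemma shadow_locally_inj:
  assumes S: "open S" and f: "smooth_on S f" and p: "p \<in> S"
    and d: "\<And>p. p \<in> S \<Longrightarrow> hdet (frechet_derivative f (at p)) \<noteq> 0"
  obtains U where "open U" "p \<in> U" "U \<subseteq> S" "inj_on f U"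
proof -
  obtain U V g where U: "open U" "U \<subseteq> S" "p \<in> U" and "homeomorphism U V (shadow f) g"
    by (rule inverse_function_smooth[OF S shadow_smooth(1)[OF S f d] p shadow_smooth(2)[OF S f d p]])
  then have h: "g (shadow f q) = q" if "q \<in> U" for q using that by (simp add: homeomorphism_def)
  have "inj_on f U"
  proof (rule inj_onI)
    fix q q' assume q: "q \<in> U" "q' \<in> U" "f q = f q'"
    then have "shadow f q = shadow f q'" by (simp add: shadow_def)
    then show "q = q'" using h q by metis
  qed
  then show thesis using that U by blast
qed

section \<open>Null coordinates\<close>

text \<open>Since a1 and b1 vary along the curve, the rank conditions make (a1, b1) a coordinate
  system, in which a2 depends on the first coordinate alone and b2 on the second. Rescaling the
  coordinates by A1 and B1 turns the curve into the diagonal. Higher regularity of \<eta> is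
  recovered later, from lifting.\<close>

lemma null_coordinates_aux:
  fixes a1 a2 b1 b2 :: "real \<times> real \<Rightarrow> real" and c :: "real \<Rightarrow> real \<times> real"
  assumes S: "open S" and sm: "smooth_on S a1" "smooth_on S a2" "smooth_on S b1" "smooth_on S b2"
    and ra: "\<And>p X Y. p \<in> S \<Longrightarrow> frechet_derivative a1 (at p) X * frechet_derivative a2 (at p) Y
        = frechet_derivative a1 (at p) Y * frechet_derivative a2 (at p) X"
    and rb: "\<And>p X Y. p \<in> S \<Longrightarrow> frechet_derivative b1 (at p) X * frechet_derivative b2 (at p) Y
        = frechet_derivative b1 (at p) Y * frechet_derivative b2 (at p) X"
    and tr: "\<And>p X. p \<in> S \<Longrightarrow> frechet_derivative a1 (at p) X = 0 \<Longrightarrow> frechet_derivative a2 (at p) X = 0 \<Longrightarrow>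
        frechet_derivative b1 (at p) X = 0 \<Longrightarrow> frechet_derivative b2 (at p) X = 0 \<Longrightarrow> X = 0"
    and J: "open J" "s0 \<in> J" and c: "continuous_on J c" "c ` J \<subseteq> S" "(c has_derivative c') (at s0)"
    and ac: "\<And>s. s \<in> J \<Longrightarrow> a1 (c s) = A1 s" "\<And>s. s \<in> J \<Longrightarrow> a2 (c s) = A2 s"
    and bc: "\<And>s. s \<in> J \<Longrightarrow> b1 (c s) = B1 s" "\<And>s. s \<in> J \<Longrightarrow> b2 (c s) = B2 s"
    and dA: "\<And>s. s \<in> J \<Longrightarrow> (A1 has_real_derivative dA1 s) (at s)" "dA1 s0 \<noteq> 0"
    and dB: "\<And>s. s \<in> J \<Longrightarrow> (B1 has_real_derivative dB1 s) (at s)" "dB1 s0 \<noteq> 0"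
  shows "\<exists>r>0. \<exists>\<eta>. ball s0 r \<subseteq> J \<and> (\<forall>u\<in>ball s0 r. \<forall>v\<in>ball s0 r.
     \<eta> (u, v) \<in> S \<and> \<eta> differentiable (at (u, v)) \<and> \<eta> (u, u) = c u \<and>
     a1 (\<eta> (u, v)) = A1 u \<and> a2 (\<eta> (u, v)) = A2 u \<and> b1 (\<eta> (u, v)) = B1 v \<and> b2 (\<eta> (u, v)) = B2 v)"
proof -
  define G where "G p = (a1 p, b1 p)" for p
  note D = sm[THEN smooth_on_has_derivative[OF S]]
  have c0: "c s0 \<in> S" using J c by auto
  have G: "smooth_on S G" unfolding G_def[abs_def] by (rule smooth_on_Pair[OF S sm(1,3)])
  have G': "frechet_derivative G (at p) = (\<lambda>X. (frechet_derivative a1 (at p) X, frechet_derivative b1 (at p) X))"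
    if "p \<in> S" for p
    unfolding G_def[abs_def]
    by (rule frechet_derivative_at[symmetric, OF has_derivative_Pair[OF D(1,3)[OF that]]])
  have linG: "linear (frechet_derivative G (at (c s0)))"
    using smooth_on_has_derivative[OF S G c0] has_derivative_linear by blast
  have chain: "frechet_derivative g (at (c s0)) (c' 1) = d"
    if "smooth_on S g" "\<And>s. s \<in> J \<Longrightarrow> g (c s) = h s" "(h has_real_derivative d) (at s0)" for g h d
  proof -
    have "((\<lambda>s. g (c s)) has_derivative (\<lambda>x. frechet_derivative g (at (c s0)) (c' x))) (at s0)"
      by (rule has_derivative_compose[OF c(3) smooth_on_has_derivative[OF S that(1) c0]])
    then have "(h has_derivative (\<lambda>x. frechet_derivative g (at (c s0)) (c' x))) (at s0)"
      by (rule has_derivative_transform_within_open[OF _ J that(2)])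
    with that(3) have "(*) d = (\<lambda>x. frechet_derivative g (at (c s0)) (c' x))"
      unfolding has_field_derivative_def by (rule has_derivative_unique)
    from fun_cong[OF this, of 1] show ?thesis by simp
  qed
  \<comment> \<open>For X in the kernel, the rank identities tested against the velocity of c give
    da2(X) dA1 = 0 and db2(X) dB1 = 0, so all four differentials kill X.\<close>
  have inj: "inj (frechet_derivative G (at (c s0)))"
  proof (rule linear_injective_0[OF linG, THEN iffD2], intro allI impI)
    fix X assume "frechet_derivative G (at (c s0)) X = 0"
    then have X: "frechet_derivative a1 (at (c s0)) X = 0" "frechet_derivative b1 (at (c s0)) X = 0"
      by (simp_all add: G'[OF c0] prod_eq_iff)
    show "X = 0"
      using ra[OF c0, of X "c' 1"] rb[OF c0, of X "c' 1"] X dA(2) dB(2)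
        chain[OF sm(1) ac(1) dA(1)[OF J(2)]] chain[OF sm(3) bc(1) dB(1)[OF J(2)]]
      by (intro tr[OF c0]) auto
  qed
  obtain U V h where U: "open U" "U \<subseteq> S" "c s0 \<in> U" and V: "open V" "G (c s0) \<in> V"
    and hom: "homeomorphism U V G h"
    and h: "\<And>y. y \<in> V \<Longrightarrow> (h has_derivative inv (frechet_derivative G (at (h y)))) (at y)"
    using inverse_function_smooth[OF S G c0 inj] by blast
  have hU: "h y \<in> U" "G (h y) = y" if "y \<in> V" for y using hom that by (auto simp: homeomorphism_def)
  have hG: "h (G p) = p" if "p \<in> U" for p using hom that by (auto simp: homeomorphism_def)
  have Gc: "G (c s) = (A1 s, B1 s)" if "s \<in> J" for s using ac bc that by (simp add: G_def)
  \<comment> \<open>A product box: below, one coordinate moves while the other is fixed, along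
    segments that must not leave V.\<close>
  obtain VA VB where VV: "open VA" "open VB" "(A1 s0, B1 s0) \<in> VA \<times> VB" "VA \<times> VB \<subseteq> V"
    using V unfolding Gc[OF J(2)] by (auto elim: open_prod_elim)
  have "A1 s0 \<in> VA" "B1 s0 \<in> VB" using VV(3) by auto
  obtain e1 where e1: "e1 > 0" "ball (A1 s0) e1 \<subseteq> VA" by (rule openE[OF VV(1) \<open>A1 s0 \<in> VA\<close>])
  obtain e2 where e2: "e2 > 0" "ball (B1 s0) e2 \<subseteq> VB" by (rule openE[OF VV(2) \<open>B1 s0 \<in> VB\<close>])
  have box: "(x, y) \<in> V" if "x \<in> ball (A1 s0) e1" "y \<in> ball (B1 s0) e2" for x y
    using that e1(2) e2(2) VV(4) by (meson SigmaI subsetD)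
  have contA: "continuous_on J A1" "continuous_on J B1"
    by (rule DERIV_continuous_on[OF has_field_derivative_at_within[OF dA(1)]]; assumption)
      (rule DERIV_continuous_on[OF has_field_derivative_at_within[OF dB(1)]]; assumption)
  \<comment> \<open>For such parameters the point (A1 u, B1 v) lies in the box, and c u lies where h
    inverts G, so that h (A1 u, B1 u) = c u.\<close>
  define J' where "J' = (J \<inter> c -` U) \<inter> (J \<inter> A1 -` ball (A1 s0) e1) \<inter> (J \<inter> B1 -` ball (B1 s0) e2)"
  have "open J'" unfolding J'_def
    by (intro open_Int continuous_open_preimage[OF _ J(1)] c contA U open_ball)
  moreover have "s0 \<in> J'" using J U e1 e2 by (simp add: J'_def)
  ultimately obtain r where r: "r > 0" "ball s0 r \<subseteq> J'" by (rule openE)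
  define \<eta> where "\<eta> q = h (A1 (fst q), B1 (snd q))" for q
  have con: "a2 (h (x, y)) = a2 (h (x, y'))" "b2 (h (x, y)) = b2 (h (x', y))"
    if x: "x \<in> ball (A1 s0) e1" "x' \<in> ball (A1 s0) e1" and y: "y \<in> ball (B1 s0) e2" "y' \<in> ball (B1 s0) e2"
    for x x' y y'
  proof -
    have dh: "frechet_derivative a1 (at (h q)) (inv (frechet_derivative G (at (h q))) w) = fst w"
      "frechet_derivative b1 (at (h q)) (inv (frechet_derivative G (at (h q))) w) = snd w"
      if q: "q \<in> V" for q w
    proof -
      have hS: "h q \<in> S" using hU(1)[OF q] U(2) by auto
      have "((\<lambda>y. G (h y)) has_derivative
          (\<lambda>w. frechet_derivative G (at (h q)) (inv (frechet_derivative G (at (h q))) w))) (at q)"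
        by (rule has_derivative_compose[OF h[OF q] smooth_on_has_derivative[OF S G hS]])
      then have "((\<lambda>y. y) has_derivative
          (\<lambda>w. frechet_derivative G (at (h q)) (inv (frechet_derivative G (at (h q))) w))) (at q)"
        by (rule has_derivative_transform_within_open[OF _ V(1) q hU(2)])
      then have "(\<lambda>w. frechet_derivative G (at (h q)) (inv (frechet_derivative G (at (h q))) w)) = (\<lambda>w. w)"
        using has_derivative_ident by (rule has_derivative_unique)
      from fun_cong[OF this, of w] show
        "frechet_derivative a1 (at (h q)) (inv (frechet_derivative G (at (h q))) w) = fst w"
        "frechet_derivative b1 (at (h q)) (inv (frechet_derivative G (at (h q))) w) = snd w"
        unfolding G'[OF hS] by (auto simp: prod_eq_iff)
    qed
    \<comment> \<open>The second coordinate field is annihilated by da1; testing the rank identity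
      against the first one, where da1 = 1, forces da2 to vanish on it too. The same with the roles
      exchanged serves b.\<close>
    have z: "frechet_derivative a2 (at (h q)) (inv (frechet_derivative G (at (h q))) (0, 1)) = 0"
      "frechet_derivative b2 (at (h q)) (inv (frechet_derivative G (at (h q))) (1, 0)) = 0"
      if q: "q \<in> V" for q
    proof -
      have hS: "h q \<in> S" using hU(1)[OF q] U(2) by auto
      show "frechet_derivative a2 (at (h q)) (inv (frechet_derivative G (at (h q))) (0, 1)) = 0"
        using ra[OF hS, of "inv (frechet_derivative G (at (h q))) (0, 1)" "inv (frechet_derivative G (at (h q))) (1, 0)"]
          dh[OF q] by simp
      show "frechet_derivative b2 (at (h q)) (inv (frechet_derivative G (at (h q))) (1, 0)) = 0"
        using rb[OF hS, of "inv (frechet_derivative G (at (h q))) (0, 1)" "inv (frechet_derivative G (at (h q))) (1, 0)"]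
          dh[OF q] by simp
    qed
    have lin: "linear (\<lambda>w. frechet_derivative g (at (h q)) (inv (frechet_derivative G (at (h q))) w))"
      "((\<lambda>y. g (h y)) has_derivative
          (\<lambda>w. frechet_derivative g (at (h q)) (inv (frechet_derivative G (at (h q))) w))) (at q)"
      if g: "smooth_on S g" and q: "q \<in> V" for q and g :: "real \<times> real \<Rightarrow> real"
    proof -
      have hS: "h q \<in> S" using hU(1)[OF q] U(2) by auto
      show "((\<lambda>y. g (h y)) has_derivative
          (\<lambda>w. frechet_derivative g (at (h q)) (inv (frechet_derivative G (at (h q))) w))) (at q)"
        by (rule has_derivative_compose[OF h[OF q] smooth_on_has_derivative[OF S g hS]])
      then show "linear (\<lambda>w. frechet_derivative g (at (h q)) (inv (frechet_derivative G (at (h q))) w))"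
        by (rule has_derivative_linear)
    qed
    have vert: "((\<lambda>y. a2 (h (x, y))) has_derivative (\<lambda>t. 0)) (at y within ball (B1 s0) e2)"
      if y: "y \<in> ball (B1 s0) e2" for y
    proof -
      have q: "(x, y) \<in> V" by (rule box[OF x(1) y])
      have "((\<lambda>y. (x, y)) has_derivative (\<lambda>t. (0, t))) (at y within ball (B1 s0) e2)"
        by (intro has_derivative_Pair has_derivative_const has_derivative_ident)
      from has_derivative_compose[OF this lin(2)[OF sm(2) q]]
      show ?thesis
        using linear_cmul[OF lin(1)[OF sm(2) q], of _ "(0, 1)"] z(1)[OF q] by simp
    qed
    have hor: "((\<lambda>x. b2 (h (x, y))) has_derivative (\<lambda>t. 0)) (at x within ball (A1 s0) e1)"
      if x: "x \<in> ball (A1 s0) e1" for x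
    proof -
      have q: "(x, y) \<in> V" by (rule box[OF x y(1)])
      have "((\<lambda>x. (x, y)) has_derivative (\<lambda>t. (t, 0))) (at x within ball (A1 s0) e1)"
        by (intro has_derivative_Pair has_derivative_const has_derivative_ident)
      from has_derivative_compose[OF this lin(2)[OF sm(4) q]]
      show ?thesis
        using linear_cmul[OF lin(1)[OF sm(4) q], of _ "(1, 0)"] z(2)[OF q] by simp
    qed
    show "a2 (h (x, y)) = a2 (h (x, y'))"
      using has_derivative_zero_unique[OF convex_ball vert y] .
    show "b2 (h (x, y)) = b2 (h (x', y))"
      using has_derivative_zero_unique[OF convex_ball hor x] .
  qed
  have "\<eta> (u, v) \<in> S \<and> \<eta> differentiable (at (u, v)) \<and> \<eta> (u, u) = c u \<and>
     a1 (\<eta> (u, v)) = A1 u \<and> a2 (\<eta> (u, v)) = A2 u \<and> b1 (\<eta> (u, v)) = B1 v \<and> b2 (\<eta> (u, v)) = B2 v"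
    if u: "u \<in> ball s0 r" and v: "v \<in> ball s0 r" for u v
  proof -
    have uJ: "u \<in> J" "c u \<in> U" "A1 u \<in> ball (A1 s0) e1" "B1 u \<in> ball (B1 s0) e2"
      and vJ: "v \<in> J" "c v \<in> U" "A1 v \<in> ball (A1 s0) e1" "B1 v \<in> ball (B1 s0) e2"
      using subsetD[OF r(2) u] subsetD[OF r(2) v] by (simp_all add: J'_def)
    have q: "(A1 u, B1 v) \<in> V" by (rule box[OF uJ(3) vJ(4)])
    have diag: "\<eta> (w, w) = c w" if "w \<in> J" "c w \<in> U" for w
      using hG[OF that(2)] Gc[OF that(1)] by (simp add: \<eta>_def)
    have "((\<lambda>q. (A1 (fst q), B1 (snd q))) has_derivative (\<lambda>w. (dA1 u * fst w, dB1 v * snd w))) (at (u, v))"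
      using has_derivative_compose[OF has_derivative_fst[OF has_derivative_ident], of A1 _ "(u, v)" UNIV]
        has_derivative_compose[OF has_derivative_snd[OF has_derivative_ident], of B1 _ "(u, v)" UNIV]
        dA(1)[OF uJ(1)] dB(1)[OF vJ(1)]
      by (intro has_derivative_Pair) (auto simp: has_field_derivative_def)
    from has_derivative_compose[OF this, of h] h[OF q] have "\<eta> differentiable (at (u, v))"
      unfolding \<eta>_def[abs_def] by (auto intro: differentiableI)
    moreover have "\<eta> (u, v) \<in> S" using hU(1)[OF q] U(2) by (auto simp: \<eta>_def)
    moreover have "a1 (\<eta> (u, v)) = A1 u" "b1 (\<eta> (u, v)) = B1 v"
      using hU(2)[OF q] by (auto simp: \<eta>_def G_def)
    \<comment> \<open>Slide the irrelevant coordinate to the diagonal, where the curve supplies the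
      value.\<close>
    moreover have "a2 (\<eta> (u, v)) = a2 (\<eta> (u, u))" "b2 (\<eta> (u, v)) = b2 (\<eta> (v, v))"
      using con[OF uJ(3) vJ(3) vJ(4) uJ(4)] by (simp_all add: \<eta>_def)
    ultimately show ?thesis using diag uJ vJ ac(2) bc(2) by simp
  qed
  moreover have "ball s0 r \<subseteq> J" using r(2) by (auto simp: J'_def)
  ultimately show ?thesis using r(1) by blast
qed

text \<open>Regularity makes at least one component of each pair have non-zero derivative. The
  hypotheses are symmetric under exchanging the components, which settles all four cases.\<close>

lemma null_coordinates:
  fixes a1 a2 b1 b2 :: "real \<times> real \<Rightarrow> real" and c :: "real \<Rightarrow> real \<times> real"
  assumes S: "open S" and sm: "smooth_on S a1" "smooth_on S a2" "smooth_on S b1" "smooth_on S b2"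
    and ra: "\<And>p X Y. p \<in> S \<Longrightarrow> frechet_derivative a1 (at p) X * frechet_derivative a2 (at p) Y
        = frechet_derivative a1 (at p) Y * frechet_derivative a2 (at p) X"
    and rb: "\<And>p X Y. p \<in> S \<Longrightarrow> frechet_derivative b1 (at p) X * frechet_derivative b2 (at p) Y
        = frechet_derivative b1 (at p) Y * frechet_derivative b2 (at p) X"
    and tr: "\<And>p X. p \<in> S \<Longrightarrow> frechet_derivative a1 (at p) X = 0 \<Longrightarrow> frechet_derivative a2 (at p) X = 0 \<Longrightarrow>
        frechet_derivative b1 (at p) X = 0 \<Longrightarrow> frechet_derivative b2 (at p) X = 0 \<Longrightarrow> X = 0"
    and J: "open J" "s0 \<in> J" and c: "continuous_on J c" "c ` J \<subseteq> S" "(c has_derivative c') (at s0)"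
    and ac: "\<And>s. s \<in> J \<Longrightarrow> a1 (c s) = A1 s" "\<And>s. s \<in> J \<Longrightarrow> a2 (c s) = A2 s"
    and bc: "\<And>s. s \<in> J \<Longrightarrow> b1 (c s) = B1 s" "\<And>s. s \<in> J \<Longrightarrow> b2 (c s) = B2 s"
    and dA: "\<And>s. s \<in> J \<Longrightarrow> (A1 has_real_derivative dA1 s) (at s)" "\<And>s. s \<in> J \<Longrightarrow> (A2 has_real_derivative dA2 s) (at s)"
    and dB: "\<And>s. s \<in> J \<Longrightarrow> (B1 has_real_derivative dB1 s) (at s)" "\<And>s. s \<in> J \<Longrightarrow> (B2 has_real_derivative dB2 s) (at s)"
    and nz: "dA1 s0 \<noteq> 0 \<or> dA2 s0 \<noteq> 0" "dB1 s0 \<noteq> 0 \<or> dB2 s0 \<noteq> 0"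
  shows "\<exists>r>0. \<exists>\<eta>. ball s0 r \<subseteq> J \<and> (\<forall>u\<in>ball s0 r. \<forall>v\<in>ball s0 r.
     \<eta> (u, v) \<in> S \<and> \<eta> differentiable (at (u, v)) \<and> \<eta> (u, u) = c u \<and>
     a1 (\<eta> (u, v)) = A1 u \<and> a2 (\<eta> (u, v)) = A2 u \<and> b1 (\<eta> (u, v)) = B1 v \<and> b2 (\<eta> (u, v)) = B2 v)"
proof -
  have ra': "frechet_derivative a2 (at p) X * frechet_derivative a1 (at p) Y
        = frechet_derivative a2 (at p) Y * frechet_derivative a1 (at p) X" if "p \<in> S" for p X Y
    using ra[OF that, of X Y] by (simp add: mult.commute)
  have rb': "frechet_derivative b2 (at p) X * frechet_derivative b1 (at p) Y
        = frechet_derivative b2 (at p) Y * frechet_derivative b1 (at p) X" if "p \<in> S" for p X Y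
    using rb[OF that, of X Y] by (simp add: mult.commute)
  consider "dA1 s0 \<noteq> 0" "dB1 s0 \<noteq> 0" | "dA1 s0 \<noteq> 0" "dB2 s0 \<noteq> 0"
    | "dA2 s0 \<noteq> 0" "dB1 s0 \<noteq> 0" | "dA2 s0 \<noteq> 0" "dB2 s0 \<noteq> 0" using nz by blast
  then show ?thesis
  proof cases
    case 1
    show ?thesis by (rule null_coordinates_aux[OF S sm ra rb tr J c ac bc dA(1) 1(1) dB(1) 1(2)])
  next
    case 2
    show ?thesis
      using null_coordinates_aux[OF S sm(1,2,4,3) ra rb' tr J c ac bc(2,1) dA(1) 2(1) dB(2) 2(2)] by (simp only: conj_ac)
  next
    case 3
    show ?thesis
      using null_coordinates_aux[OF S sm(2,1,3,4) ra' rb tr J c ac(2,1) bc dA(2) 3(1) dB(1) 3(2)] by (simp only: conj_ac)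
  next
    case 4
    show ?thesis
      using null_coordinates_aux[OF S sm(2,1,4,3) ra' rb' tr J c ac(2,1) bc(2,1) dA(2) 4(1) dB(2) 4(2)] by (simp only: conj_ac)
  qed
qed

section \<open>The representation formula\<close>

lemma antiderivative_exists:
  fixes g :: "real \<Rightarrow> real"
  assumes I: "open I" "is_interval I" and g: "continuous_on I g"
  shows "\<exists>F. \<forall>s\<in>I. (F has_real_derivative g s) (at s)"
proof (cases "I = {}")
  case False
  then obtain b where b: "b \<in> I" by blast
  have "((\<lambda>u. LBINT y=b..u. g y) has_real_derivative g s) (at s)" if s: "s \<in> I" for s
  proof -
    obtain e where e: "e > 0" "cball s e \<subseteq> I" using I(1) s by (auto simp: open_contains_cball)
    define a0 where "a0 = min b (s - e)"
    define a1 where "a1 = max b (s + e)"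
    have "s - e \<in> cball s e" "s + e \<in> cball s e" using e(1) by (auto simp: dist_real_def)
    \<comment> \<open>The fundamental theorem is applied on a compact interval inside I with s in
      its interior: [a0, a1] is the hull of b and [s - e, s + e].\<close>
    moreover have "a0 = b \<or> a0 = s - e" "a1 = b \<or> a1 = s + e" by (auto simp: a0_def a1_def)
    ultimately have "a0 \<in> I" "a1 \<in> I" using e(2) b by blast+
    then have sub: "{a0..a1} \<subseteq> I"
      using mem_is_interval_1_I[OF I(2), of a0 a1] by auto
    have "((\<lambda>u. LBINT y=b..u. g y) has_vector_derivative g s) (at s within {a0..a1})"
      by (rule interval_integral_FTC2[OF _ _ continuous_on_subset[OF g sub]])
        (use e in \<open>auto simp: a0_def a1_def\<close>)
    moreover have "s \<in> interior {a0..a1}" using e by (auto simp: a0_def a1_def)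
    ultimately show ?thesis
      by (simp only: at_within_interior[of s "{a0..a1}"] has_real_derivative_iff_has_vector_derivative)
  qed
  then show ?thesis by (intro exI ballI)
qed auto

lemma has_derivative_vector_3:
  fixes f g h :: "'a::real_normed_vector \<Rightarrow> real"
  assumes "(f has_derivative f') F" "(g has_derivative g') F" "(h has_derivative h') F"
  shows "((\<lambda>p. vector [f p, g p, h p] :: real^3) has_derivative (\<lambda>X. vector [f' X, g' X, h' X])) F"
proof -
  have eq: "vector [a, b, c] = a *\<^sub>R axis 1 1 + b *\<^sub>R axis 2 1 + c *\<^sub>R (axis 3 1 :: real^3)" for a b c :: real
    by (simp add: vec_eq_iff forall_3 axis_def)
  show ?thesis
    unfolding eq by (intro has_derivative_add has_derivative_scaleR_left assms)
qed

text \<open>The domain of the split-holomorphic extensions of functions on J; for a bounded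
  interval, a square with J as a diagonal.\<close>

definition diamond :: "real set \<Rightarrow> (real \<times> real) set" where
  "diamond J = {p. fst p + snd p \<in> J \<and> fst p - snd p \<in> J}"

lemma diamond_axis: "(s, 0) \<in> diamond J \<longleftrightarrow> s \<in> J"
  by (simp add: diamond_def)

lemma open_diamond: "open J \<Longrightarrow> open (diamond J)"
  unfolding diamond_def Collect_conj_eq vimage_def[symmetric]
  by (intro open_Int open_vimage continuous_intros)

lemma convex_diamond:
  assumes "convex J"
  shows "convex (diamond J)"
proof (rule convexI)
  fix p q :: "real \<times> real" and x y :: real
  assume h: "p \<in> diamond J" "q \<in> diamond J" "0 \<le> x" "0 \<le> y" "x + y = 1"
  have "x *\<^sub>R (fst p + snd p) + y *\<^sub>R (fst q + snd q) \<in> J" "x *\<^sub>R (fst p - snd p) + y *\<^sub>R (fst q - snd q) \<in> J"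
    using h by (intro convexD[OF assms]; simp add: diamond_def)+
  then show "x *\<^sub>R p + y *\<^sub>R q \<in> diamond J"
    by (simp add: diamond_def algebra_simps)
qed

lemma smooth_on_diamond:
  fixes g :: "real \<Rightarrow> real"
  assumes J: "open J" and g: "smooth_on J g"
  shows "smooth_on (diamond J) (\<lambda>p. g (fst p + snd p))" "smooth_on (diamond J) (\<lambda>p. g (fst p - snd p))"
proof -
  note o = open_diamond[OF J]
  have "smooth_on (diamond J) (\<lambda>p. fst p + snd p)" "smooth_on (diamond J) (\<lambda>p. fst p - snd p)"
    by (intro smooth_on_linear[OF _ o] bounded_linear_add bounded_linear_sub bounded_linear_fst bounded_linear_snd)+
  note l = this
  show "smooth_on (diamond J) (\<lambda>p. g (fst p + snd p))"
    by (rule smooth_on_compose[OF o J _ l(1) g]) (auto simp: diamond_def)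
  show "smooth_on (diamond J) (\<lambda>p. g (fst p - snd p))"
    by (rule smooth_on_compose[OF o J _ l(2) g]) (auto simp: diamond_def)
qed

lemma has_derivative_null:
  fixes g :: "real \<Rightarrow> real" and p :: "real \<times> real"
  shows "(g has_real_derivative d) (at (fst p + snd p)) \<Longrightarrow>
      ((\<lambda>p. g (fst p + snd p)) has_derivative (\<lambda>X. d * (fst X + snd X))) (at p)"
    and "(g has_real_derivative d) (at (fst p - snd p)) \<Longrightarrow>
      ((\<lambda>p. g (fst p - snd p)) has_derivative (\<lambda>X. d * (fst X - snd X))) (at p)"
proof -
  have l: "((\<lambda>p. fst p + snd p) has_derivative (\<lambda>X. fst X + snd X)) (at p)"
    "((\<lambda>p. fst p - snd p) has_derivative (\<lambda>X. fst X - snd X)) (at p)" for p :: "real \<times> real"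
    by (intro has_derivative_add has_derivative_diff has_derivative_fst has_derivative_snd has_derivative_ident)+
  show "(g has_real_derivative d) (at (fst p + snd p)) \<Longrightarrow>
      ((\<lambda>p. g (fst p + snd p)) has_derivative (\<lambda>X. d * (fst X + snd X))) (at p)"
    unfolding has_field_derivative_def by (rule has_derivative_compose[OF l(1)])
  show "(g has_real_derivative d) (at (fst p - snd p)) \<Longrightarrow>
      ((\<lambda>p. g (fst p - snd p)) has_derivative (\<lambda>X. d * (fst X - snd X))) (at p)"
    unfolding has_field_derivative_def by (rule has_derivative_compose[OF l(2)])
qed

section \<open>The explicit surface built from the pair of curves\<close>

locale admissible =
  fixes I :: "real set" and \<alpha> U :: "real \<Rightarrow> real^3"
  assumes open_I: "open I" and interval_I: "is_interval I" and nonempty_I: "I \<noteq> {}"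
    and smooth_alpha: "smooth_on I \<alpha>" and smooth_U: "smooth_on I U"
    and orth: "s \<in> I \<Longrightarrow> vector_derivative \<alpha> (at s) \<bullet> U s = 0"
    and U3: "s \<in> I \<Longrightarrow> U s $ 3 = 1"
    and neg: "s \<in> I \<Longrightarrow> vector_derivative \<alpha> (at s) \<bullet> vector_derivative U (at s) < 0"
begin

text \<open>The restrictions of a and b to the curve; they determine the surface up to a vertical
  translation.\<close>

definition "A1 s = U s $ 1 - \<alpha> s $ 2"
definition "A2 s = U s $ 2 + \<alpha> s $ 1"
definition "B1 s = U s $ 1 + \<alpha> s $ 2"
definition "B2 s = U s $ 2 - \<alpha> s $ 1"

abbreviation "D\<alpha> s \<equiv> vector_derivative \<alpha> (at s)"
abbreviation "DU s \<equiv> vector_derivative U (at s)"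

definition "dA1 s = DU s $ 1 - D\<alpha> s $ 2"
definition "dA2 s = DU s $ 2 + D\<alpha> s $ 1"
definition "dB1 s = DU s $ 1 + D\<alpha> s $ 2"
definition "dB2 s = DU s $ 2 - D\<alpha> s $ 1"

text \<open>The constant left free by the choice is absorbed when the height is normalized at
  \<open>base\<close>.\<close>

definition primitive :: "(real \<Rightarrow> real) \<Rightarrow> real \<Rightarrow> real" where
  "primitive g = (SOME F. \<forall>s\<in>I. (F has_real_derivative g s) (at s))"

text \<open>With A taken at s + t and B at s - t, orthogonality reads -4 d\<psi>3 = (A1 + B1)(dA2 -
  dB2) + (A2 + B2)(dB1 - dA1). The mixed terms are the differential of A2 B1 - A1 B2; the pure terms
  are minus the integrands of \<open>E\<close> and \<open>F\<close>. This is the origin of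
  \<open>third\<close>.\<close>

definition "E = primitive (\<lambda>s. A2 s * dA1 s - A1 s * dA2 s)"
definition "F = primitive (\<lambda>s. B1 s * dB2 s - B2 s * dB1 s)"

definition third :: "real \<times> real \<Rightarrow> real" where
  "third p = (E (fst p + snd p) + F (fst p - snd p) + A1 (fst p + snd p) * B2 (fst p - snd p)
      - A2 (fst p + snd p) * B1 (fst p - snd p)) / 4"

definition "base = (SOME s. s \<in> I)"

definition surf :: "real \<times> real \<Rightarrow> real^3" where
  "surf p = vector [(A2 (fst p + snd p) - B2 (fst p - snd p)) / 2, (B1 (fst p - snd p) - A1 (fst p + snd p)) / 2,
     third p + (\<alpha> base $ 3 - third (base, 0))]"

definition con :: "real \<times> real \<Rightarrow> real^3" where
  "con p = vector [(A1 (fst p + snd p) + B1 (fst p - snd p)) / 2, (A2 (fst p + snd p) + B2 (fst p - snd p)) / 2, 1]"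

definition dsurf12 :: "real \<times> real \<Rightarrow> real \<times> real \<Rightarrow> real \<times> real" where
  "dsurf12 p X = ((dA2 (fst p + snd p) * (fst X + snd X) - dB2 (fst p - snd p) * (fst X - snd X)) / 2,
     (dB1 (fst p - snd p) * (fst X - snd X) - dA1 (fst p + snd p) * (fst X + snd X)) / 2)"

text \<open>The third component is written through \<open>con\<close>, so that orthogonality to the
  conormal holds by construction; that this is the derivative of the height is the content of
  \<open>deriv_surf\<close>.\<close>

definition dsurf :: "real \<times> real \<Rightarrow> real \<times> real \<Rightarrow> real^3" where
  "dsurf p X = vector [fst (dsurf12 p X), snd (dsurf12 p X),
     - (con p $ 1 * fst (dsurf12 p X) + con p $ 2 * snd (dsurf12 p X))]"

definition dcon :: "real \<times> real \<Rightarrow> real \<times> real \<Rightarrow> real^3" where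
  "dcon p X = vector [(dA1 (fst p + snd p) * (fst X + snd X) + dB1 (fst p - snd p) * (fst X - snd X)) / 2,
     (dA2 (fst p + snd p) * (fst X + snd X) + dB2 (fst p - snd p) * (fst X - snd X)) / 2, 0]"

text \<open>Half the determinant of the velocities of A and B. It is the conformal factor of the
  metric \<mu> (ds^2 - dt^2) and also the Jacobian of the projected surface; the agreement of the
  two is the volume condition.\<close>

definition \<mu> :: "real \<times> real \<Rightarrow> real" where
  "\<mu> p = (dA1 (fst p + snd p) * dB2 (fst p - snd p) - dA2 (fst p + snd p) * dB1 (fst p - snd p)) / 2"

lemma base_in: "base \<in> I"
  unfolding base_def using nonempty_I by (simp add: some_in_eq)

lemma deriv_component:
  assumes f: "smooth_on I f" and s: "s \<in> I"
  shows "((\<lambda>s. (f s :: real^3) $ i) has_real_derivative vector_derivative f (at s) $ i) (at s)"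
proof -
  have "f differentiable at s"
    using smooth_on_has_derivative[OF open_I f s] by (rule differentiableI)
  then have "(f has_vector_derivative vector_derivative f (at s)) (at s)"
    by (simp add: vector_derivative_works)
  from bounded_linear.has_vector_derivative[OF bounded_linear_vec_nth this]
  show ?thesis by (simp add: has_real_derivative_iff_has_vector_derivative)
qed

lemma deriv_AB:
  assumes "s \<in> I"
  shows "(A1 has_real_derivative dA1 s) (at s)" "(A2 has_real_derivative dA2 s) (at s)"
    "(B1 has_real_derivative dB1 s) (at s)" "(B2 has_real_derivative dB2 s) (at s)"
  unfolding A1_def[abs_def] A2_def[abs_def] B1_def[abs_def] B2_def[abs_def] dA1_def dA2_def dB1_def dB2_def
  by (intro DERIV_diff DERIV_add deriv_component smooth_alpha smooth_U assms)+

lemma smooth_AB: "smooth_on I A1" "smooth_on I A2" "smooth_on I B1" "smooth_on I B2"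
  unfolding A1_def[abs_def] A2_def[abs_def] B1_def[abs_def] B2_def[abs_def]
  by (intro smooth_on_diff smooth_on_add smooth_on_vec_nth open_I smooth_alpha smooth_U)+

lemma smooth_deriv:
  fixes g :: "real \<Rightarrow> real"
  assumes "smooth_on I g" "\<And>s. s \<in> I \<Longrightarrow> (g has_real_derivative d s) (at s)"
  shows "smooth_on I d"
proof (rule smooth_on_cong[OF open_I smooth_on_frechet_derivative[OF assms(1), of 1]])
  fix s assume "s \<in> I"
  from frechet_derivative_at[OF assms(2)[OF this, unfolded has_field_derivative_def]]
  show "frechet_derivative g (at s) 1 = d s" by (metis mult.right_neutral)
qed

lemma smooth_dAB: "smooth_on I dA1" "smooth_on I dA2" "smooth_on I dB1" "smooth_on I dB2"
  by (rule smooth_deriv[OF smooth_AB(1) deriv_AB(1)] smooth_deriv[OF smooth_AB(2) deriv_AB(2)]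
      smooth_deriv[OF smooth_AB(3) deriv_AB(3)] smooth_deriv[OF smooth_AB(4) deriv_AB(4)]; assumption)+

lemma deriv_primitive:
  assumes "smooth_on I g" "s \<in> I"
  shows "(primitive g has_real_derivative g s) (at s)"
  using someI_ex[OF antiderivative_exists[OF open_I interval_I smooth_on_continuous_on[OF assms(1)]]] assms(2)
  unfolding primitive_def by blast

lemma smooth_integrands:
  "smooth_on I (\<lambda>s. A2 s * dA1 s - A1 s * dA2 s)" "smooth_on I (\<lambda>s. B1 s * dB2 s - B2 s * dB1 s)"
  by (intro smooth_on_diff smooth_on_mult smooth_AB smooth_dAB open_I)+

lemma smooth_EF: "smooth_on I E" "smooth_on I F"
  unfolding E_def F_def
  by (rule smooth_on_antiderivative[OF open_I smooth_integrands(1) deriv_primitive[OF smooth_integrands(1)]]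
      smooth_on_antiderivative[OF open_I smooth_integrands(2) deriv_primitive[OF smooth_integrands(2)]]; assumption)+

lemma smooth_surf: "smooth_on (diamond I) surf"
  unfolding surf_def[abs_def] third_def divide_inverse
  by (intro smooth_on_vector_3 smooth_on_add smooth_on_diff smooth_on_mult smooth_on_const
      smooth_on_diamond open_I open_diamond smooth_AB smooth_EF)

lemma deriv_surf:
  assumes p: "p \<in> diamond I"
  shows "(surf has_derivative dsurf p) (at p)"
proof -
  have uv: "fst p + snd p \<in> I" "fst p - snd p \<in> I" using p by (auto simp: diamond_def)
  have E: "(E has_real_derivative (A2 s * dA1 s - A1 s * dA2 s)) (at s)"
    and F: "(F has_real_derivative (B1 s * dB2 s - B2 s * dB1 s)) (at s)" if "s \<in> I" for s
    using deriv_primitive[OF smooth_integrands(1) that] deriv_primitive[OF smooth_integrands(2) that]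
    by (simp_all add: E_def F_def)
  note D = deriv_AB(1,2)[OF uv(1), THEN has_derivative_null(1)] deriv_AB(3,4)[OF uv(2), THEN has_derivative_null(2)]
    E[OF uv(1), THEN has_derivative_null(1)] F[OF uv(2), THEN has_derivative_null(2)]
  define u where "u = fst p + snd p"
  define v where "v = fst p - snd p"
  define T where "T X = (((A2 u * dA1 u - A1 u * dA2 u) * (fst X + snd X) + (B1 v * dB2 v - B2 v * dB1 v) * (fst X - snd X)
      + (A1 u * (dB2 v * (fst X - snd X)) + dA1 u * (fst X + snd X) * B2 v))
      - (A2 u * (dB1 v * (fst X - snd X)) + dA2 u * (fst X + snd X) * B1 v)) / 4" for X :: "real \<times> real"
  have T: "((\<lambda>p. third p + (\<alpha> base $ 3 - third (base, 0))) has_derivative T) (at p)"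
    unfolding third_def T_def[abs_def] u_def v_def
    by (intro bounded_linear.has_derivative[OF bounded_linear_divide] has_derivative_add_const
        has_derivative_add has_derivative_diff has_derivative_mult D)
  have "(surf has_derivative (\<lambda>X. vector [(dA2 u * (fst X + snd X) - dB2 v * (fst X - snd X)) / 2,
      (dB1 v * (fst X - snd X) - dA1 u * (fst X + snd X)) / 2, T X])) (at p)"
    unfolding surf_def[abs_def] u_def v_def
    by (intro has_derivative_vector_3 T bounded_linear.has_derivative[OF bounded_linear_divide] has_derivative_diff D)
  moreover have "vector [(dA2 u * (fst X + snd X) - dB2 v * (fst X - snd X)) / 2,
      (dB1 v * (fst X - snd X) - dA1 u * (fst X + snd X)) / 2, T X] = dsurf p X" for X
    by (simp add: dsurf_def dsurf12_def con_def T_def u_def[symmetric] v_def[symmetric] vec_eq_iff forall_3 field_simps)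
  ultimately show ?thesis by simp
qed

lemma deriv_con:
  assumes p: "p \<in> diamond I"
  shows "(con has_derivative dcon p) (at p)"
proof -
  have uv: "fst p + snd p \<in> I" "fst p - snd p \<in> I" using p by (auto simp: diamond_def)
  note D = deriv_AB(1,2)[OF uv(1), THEN has_derivative_null(1)] deriv_AB(3,4)[OF uv(2), THEN has_derivative_null(2)]
  show ?thesis
    unfolding con_def[abs_def] dcon_def[abs_def]
    by (rule has_derivative_vector_3; (rule derivative_eq_intros D refl)+; simp add: fun_eq_iff)
qed

lemma con_dsurf: "con p \<bullet> dsurf p X = 0"
  by (simp add: inner_3 dsurf_def con_def)

lemma metric_surf: "- (dcon p X \<bullet> dsurf p Y) = \<mu> p * (fst X * fst Y - snd X * snd Y)"
  by (simp add: inner_3 dcon_def dsurf_def dsurf12_def \<mu>_def field_simps)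

lemma hdet_surf: "hdet (dsurf p) = \<mu> p"
  by (simp add: hdet_def dsurf_def dsurf12_def \<mu>_def field_simps)

text \<open>On the axis \<mu> is the given - <\<alpha>', U'>; the third components drop out because
  U3 is constant.\<close>

lemma mu_axis: "s \<in> I \<Longrightarrow> \<mu> (s, 0) > 0"
proof -
  assume s: "s \<in> I"
  have "((\<lambda>s. 1) has_real_derivative DU s $ 3) (at s)"
    using has_derivative_transform_within_open[OF deriv_component[OF smooth_U s, of 3, unfolded has_field_derivative_def] open_I s U3]
    unfolding has_field_derivative_def .
  then have "DU s $ 3 = 0" using DERIV_unique DERIV_const by blast
  then have "\<mu> (s, 0) = - (D\<alpha> s \<bullet> DU s)"
    by (simp add: \<mu>_def inner_3 dA1_def dA2_def dB1_def dB2_def field_simps)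
  then show "\<mu> (s, 0) > 0" using neg[OF s] by simp
qed

lemma con_axis: "s \<in> I \<Longrightarrow> con (s, 0) = U s"
  using U3[of s] by (simp add: con_def vec_eq_iff forall_3 A1_def A2_def B1_def B2_def)

lemma surf_axis:
  assumes s: "s \<in> I"
  shows "surf (s, 0) = \<alpha> s"
proof -
  have 12: "surf (s, 0) $ 1 = \<alpha> s $ 1" "surf (s, 0) $ 2 = \<alpha> s $ 2" for s
    by (simp_all add: surf_def A1_def A2_def B1_def B2_def)
  \<comment> \<open>Orthogonality to the common conormal U dictates the derivative of both heights,
    and the normalization at \<open>base\<close> fixes the constant.\<close>
  have "((\<lambda>s. surf (s, 0) $ 3 - \<alpha> s $ 3) has_derivative (\<lambda>h. 0)) (at s)" if s: "s \<in> I" for s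
  proof -
    have "((\<lambda>s. (s, 0)) has_derivative (\<lambda>h. (h, 0 :: real))) (at s)"
      by (intro has_derivative_Pair has_derivative_ident has_derivative_const)
    from has_derivative_compose[OF this deriv_surf] s
    have D: "((\<lambda>s. surf (s, 0)) has_derivative (\<lambda>h. dsurf (s, 0) (h, 0))) (at s)"
      by (simp add: diamond_axis)
    note D3 = bounded_linear.has_derivative[OF bounded_linear_vec_nth D, of 3]
    have "((\<lambda>s. surf (s, 0) $ 3 - \<alpha> s $ 3) has_derivative (\<lambda>h. dsurf (s, 0) (h, 0) $ 3 - D\<alpha> s $ 3 * h)) (at s)"
      using deriv_component[OF smooth_alpha s, of 3]
      by (intro has_derivative_diff D3) (simp add: has_field_derivative_def)
    moreover have "dsurf (s, 0) (h, 0) $ 3 = D\<alpha> s $ 3 * h" for h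
    proof -
      have "dsurf12 (s, 0) (h, 0) = (D\<alpha> s $ 1 * h, D\<alpha> s $ 2 * h)"
        by (simp add: dsurf12_def dA1_def dA2_def dB1_def dB2_def field_simps)
      then have "dsurf (s, 0) (h, 0) $ 3 = - (U s $ 1 * D\<alpha> s $ 1 + U s $ 2 * D\<alpha> s $ 2) * h"
        using con_axis[OF s] by (simp add: dsurf_def algebra_simps)
      also have "- (U s $ 1 * D\<alpha> s $ 1 + U s $ 2 * D\<alpha> s $ 2) = D\<alpha> s $ 3"
        using orth[OF s] U3[OF s] by (simp add: inner_3 algebra_simps)
      finally show ?thesis .
    qed
    ultimately show ?thesis by simp
  qed
  then have "surf (s, 0) $ 3 - \<alpha> s $ 3 = surf (base, 0) $ 3 - \<alpha> base $ 3"
    using has_derivative_zero_unique[of I "\<lambda>s. surf (s, 0) $ 3 - \<alpha> s $ 3" s base] interval_I s base_in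
    by (simp add: is_interval_convex has_derivative_at_withinI)
  also have "\<dots> = 0" by (simp add: surf_def)
  finally show ?thesis using 12 by (simp add: vec_eq_iff forall_3)
qed

end


section \<open>Lifting the explicit surface into a chart of a given sphere\<close>

context admissible begin

text \<open>Null coordinates give the conormal and the first two coordinates of the sphere the form
  of the representation. The heights then have equal differentials, both being determined by the
  same conormal, and they agree on the curve.\<close>

lemma chart_lift:
  fixes f :: "real \<times> real \<Rightarrow> real^3" and c :: "real \<Rightarrow> real \<times> real"
  assumes S: "open S" and sp: "indef_improper_affine_sphere_param e3 S f"
    and cn: "\<And>p. p \<in> S \<Longrightarrow> affine_conormal_at e3 f p (n p)"
    and J: "open J" "J \<subseteq> I" "s0 \<in> J" and c: "continuous_on J c" "c ` J \<subseteq> S" "c differentiable (at s0)"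
    and fc: "\<And>s. s \<in> J \<Longrightarrow> f (c s) = \<alpha> s" and nc: "\<And>s. s \<in> J \<Longrightarrow> n (c s) = U s"
  obtains r \<eta> where "r > 0" "ball s0 r \<subseteq> J" "continuous_on (diamond (ball s0 r)) \<eta>"
    "\<eta> ` diamond (ball s0 r) \<subseteq> S" "\<And>s. s \<in> ball s0 r \<Longrightarrow> \<eta> (s, 0) = c s"
    "\<And>p. p \<in> diamond (ball s0 r) \<Longrightarrow> f (\<eta> p) = surf p"
proof -
  have f: "smooth_on S f" using sp by (simp add: indef_improper_affine_sphere_param_def)
  note hd = param_sphere_hdet[OF S sp]
  have n: "smooth_on S n" by (rule conormal_smooth[OF S f hd(2) cn])
  define a1 where "a1 p = n p $ 1 - f p $ 2" for p
  define a2 where "a2 p = n p $ 2 + f p $ 1" for p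
  define b1 where "b1 p = n p $ 1 + f p $ 2" for p
  define b2 where "b2 p = n p $ 2 - f p $ 1" for p
  note defs = a1_def[abs_def] a2_def[abs_def] b1_def[abs_def] b2_def[abs_def]
  have sm: "smooth_on S a1" "smooth_on S a2" "smooth_on S b1" "smooth_on S b2"
    unfolding defs by (intro smooth_on_add smooth_on_diff smooth_on_vec_nth S n f)+
  have D: "frechet_derivative a1 (at p) X = frechet_derivative n (at p) X $ 1 - frechet_derivative f (at p) X $ 2"
    "frechet_derivative a2 (at p) X = frechet_derivative n (at p) X $ 2 + frechet_derivative f (at p) X $ 1"
    "frechet_derivative b1 (at p) X = frechet_derivative n (at p) X $ 1 + frechet_derivative f (at p) X $ 2"
    "frechet_derivative b2 (at p) X = frechet_derivative n (at p) X $ 2 - frechet_derivative f (at p) X $ 1"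
    if p: "p \<in> S" for p X
  proof -
    note d = bounded_linear.has_derivative[OF bounded_linear_vec_nth smooth_on_has_derivative[OF S n p]]
      bounded_linear.has_derivative[OF bounded_linear_vec_nth smooth_on_has_derivative[OF S f p]]
    show "frechet_derivative a1 (at p) X = frechet_derivative n (at p) X $ 1 - frechet_derivative f (at p) X $ 2"
      using fun_cong[OF frechet_derivative_at[OF has_derivative_diff[OF d(1)[of 1] d(2)[of 2]]], of X] by (simp add: defs)
    show "frechet_derivative a2 (at p) X = frechet_derivative n (at p) X $ 2 + frechet_derivative f (at p) X $ 1"
      using fun_cong[OF frechet_derivative_at[OF has_derivative_add[OF d(1)[of 2] d(2)[of 1]]], of X] by (simp add: defs)
    show "frechet_derivative b1 (at p) X = frechet_derivative n (at p) X $ 1 + frechet_derivative f (at p) X $ 2"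
      using fun_cong[OF frechet_derivative_at[OF has_derivative_add[OF d(1)[of 1] d(2)[of 2]]], of X] by (simp add: defs)
    show "frechet_derivative b2 (at p) X = frechet_derivative n (at p) X $ 2 - frechet_derivative f (at p) X $ 1"
      using fun_cong[OF frechet_derivative_at[OF has_derivative_diff[OF d(1)[of 2] d(2)[of 1]]], of X] by (simp add: defs)
  qed
  have ra: "frechet_derivative a1 (at p) X * frechet_derivative a2 (at p) Y
        = frechet_derivative a1 (at p) Y * frechet_derivative a2 (at p) X" if "p \<in> S" for p X Y
    unfolding D[OF that] by (rule sphere_null_rank(1)[OF S sp cn that refl refl])
  have rb: "frechet_derivative b1 (at p) X * frechet_derivative b2 (at p) Y
        = frechet_derivative b1 (at p) Y * frechet_derivative b2 (at p) X" if "p \<in> S" for p X Y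
    unfolding D[OF that] by (rule sphere_null_rank(2)[OF S sp cn that refl refl])
  \<comment> \<open>Differences of the four differentials are twice df1 and df2, so X has no
    horizontal image and \<open>hdet\<close> excludes X other than 0.\<close>
  have tr: "X = 0" if p: "p \<in> S" and z: "frechet_derivative a1 (at p) X = 0" "frechet_derivative a2 (at p) X = 0"
    "frechet_derivative b1 (at p) X = 0" "frechet_derivative b2 (at p) X = 0" for p X
    by (rule hdet_horizontal[OF hd[OF p]]) (use z in \<open>simp_all add: D[OF p]\<close>)
  obtain c' where c': "(c has_derivative c') (at s0)" using c(3) by (auto simp: differentiable_def)
  have sI: "s \<in> I" if "s \<in> J" for s using that J(2) by auto
  \<comment> \<open>\<mu> is half the determinant of the two velocities, so its positivity makes
    both of them non-zero.\<close>
  have nz: "dA1 s0 \<noteq> 0 \<or> dA2 s0 \<noteq> 0" "dB1 s0 \<noteq> 0 \<or> dB2 s0 \<noteq> 0"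
    using mu_axis[OF sI[OF J(3)]] by (auto simp: \<mu>_def)
  have ac: "a1 (c s) = A1 s" "a2 (c s) = A2 s" "b1 (c s) = B1 s" "b2 (c s) = B2 s" if "s \<in> J" for s
    using fc[OF that] nc[OF that] by (simp_all add: a1_def a2_def b1_def b2_def A1_def A2_def B1_def B2_def)
  have "\<exists>r>0. \<exists>\<tau>. ball s0 r \<subseteq> J \<and> (\<forall>u\<in>ball s0 r. \<forall>v\<in>ball s0 r.
     \<tau> (u, v) \<in> S \<and> \<tau> differentiable (at (u, v)) \<and> \<tau> (u, u) = c u \<and>
     a1 (\<tau> (u, v)) = A1 u \<and> a2 (\<tau> (u, v)) = A2 u \<and> b1 (\<tau> (u, v)) = B1 v \<and> b2 (\<tau> (u, v)) = B2 v)"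
    by (rule null_coordinates[OF S sm ra rb tr J(1,3) c(1,2) c' ac deriv_AB[OF sI] nz]; assumption)
  then obtain r \<tau> where r: "r > 0" "ball s0 r \<subseteq> J" and h: "\<forall>u\<in>ball s0 r. \<forall>v\<in>ball s0 r.
     \<tau> (u, v) \<in> S \<and> \<tau> differentiable (at (u, v)) \<and> \<tau> (u, u) = c u \<and>
     a1 (\<tau> (u, v)) = A1 u \<and> a2 (\<tau> (u, v)) = A2 u \<and> b1 (\<tau> (u, v)) = B1 v \<and> b2 (\<tau> (u, v)) = B2 v"
    by blast
  let ?D = "diamond (ball s0 r)"
  \<comment> \<open>Passage from the null coordinates to (s, t), under which the diagonal becomes
    the axis.\<close>
  define \<eta> where "\<eta> p = \<tau> (fst p + snd p, fst p - snd p)" for p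
  have eS: "\<eta> p \<in> S" and edif: "\<eta> differentiable (at p)"
    and eab: "a1 (\<eta> p) = A1 (fst p + snd p)" "a2 (\<eta> p) = A2 (fst p + snd p)"
      "b1 (\<eta> p) = B1 (fst p - snd p)" "b2 (\<eta> p) = B2 (fst p - snd p)" if p: "p \<in> ?D" for p
  proof -
    have uv: "fst p + snd p \<in> ball s0 r" "fst p - snd p \<in> ball s0 r" using p by (auto simp: diamond_def)
    note * = bspec[OF bspec[OF h uv(1)] uv(2)]
    show "\<eta> p \<in> S" "a1 (\<eta> p) = A1 (fst p + snd p)" "a2 (\<eta> p) = A2 (fst p + snd p)"
      "b1 (\<eta> p) = B1 (fst p - snd p)" "b2 (\<eta> p) = B2 (fst p - snd p)"
      using * by (simp_all add: \<eta>_def)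
    have l: "((\<lambda>p. (fst p + snd p, fst p - snd p)) has_derivative (\<lambda>X. (fst X + snd X, fst X - snd X))) (at p)"
      by (intro has_derivative_Pair has_derivative_add has_derivative_diff has_derivative_fst
          has_derivative_snd has_derivative_ident)
    have "(\<tau> has_derivative frechet_derivative \<tau> (at (fst p + snd p, fst p - snd p))) (at (fst p + snd p, fst p - snd p))"
      using * by (simp add: frechet_derivative_works)
    from has_derivative_compose[OF l this] show "\<eta> differentiable (at p)"
      unfolding \<eta>_def[abs_def] by (rule differentiableI)
  qed
  have axis: "\<eta> (s, 0) = c s" if "s \<in> ball s0 r" for s
    using h that by (simp add: \<eta>_def)
  have DI: "?D \<subseteq> diamond I" using subset_trans[OF r(2) J(2)] unfolding diamond_def by blast
  have oD: "open ?D" by (rule open_diamond[OF open_ball])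
  have n12: "n (\<eta> p) $ 1 = con p $ 1" "n (\<eta> p) $ 2 = con p $ 2"
    "f (\<eta> p) $ 1 = surf p $ 1" "f (\<eta> p) $ 2 = surf p $ 2" if p: "p \<in> ?D" for p
    using eab[OF p] by (simp_all add: a1_def a2_def b1_def b2_def con_def surf_def)
  have n3: "n (\<eta> p) $ 3 = 1" if "p \<in> ?D" for p
    using affine_conormal_atD(1)[OF cn[OF eS[OF that]]] .
  have "((\<lambda>p. f (\<eta> p) $ 3 - surf p $ 3) has_derivative (\<lambda>X. 0)) (at p)" if p: "p \<in> ?D" for p
  proof -
    define L where "L X = frechet_derivative f (at (\<eta> p)) (frechet_derivative \<eta> (at p) X)" for X
    have "(\<eta> has_derivative frechet_derivative \<eta> (at p)) (at p)"
      using edif[OF p] by (simp add: frechet_derivative_works)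
    from has_derivative_compose[OF this smooth_on_has_derivative[OF S f eS[OF p]]]
    have L: "((\<lambda>p. f (\<eta> p)) has_derivative L) (at p)"
      unfolding L_def[abs_def] .
    note Li = bounded_linear.has_derivative[OF bounded_linear_vec_nth L]
    have s: "(surf has_derivative dsurf p) (at p)" using deriv_surf p DI by blast
    note si = bounded_linear.has_derivative[OF bounded_linear_vec_nth s]
    have "(\<lambda>X. L X $ 1) = (\<lambda>X. dsurf p X $ 1)" "(\<lambda>X. L X $ 2) = (\<lambda>X. dsurf p X $ 2)"
      by (rule has_derivative_unique[OF has_derivative_transform_within_open[OF Li oD p] si]; simp add: n12)+
    then have L12: "L X $ 1 = dsurf p X $ 1" "L X $ 2 = dsurf p X $ 2" for X by metis+
    have "n (\<eta> p) \<bullet> L X = 0" for X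
      using affine_conormal_atD(3)[OF cn[OF eS[OF p]]] by (simp add: L_def)
    moreover have "con p $ 3 = 1" by (simp add: con_def)
    ultimately have "con p $ 1 * dsurf p X $ 1 + con p $ 2 * dsurf p X $ 2 + L X $ 3 = 0"
      "con p $ 1 * dsurf p X $ 1 + con p $ 2 * dsurf p X $ 2 + dsurf p X $ 3 = 0" for X
      using con_dsurf[of p X] n12[OF p] n3[OF p] L12 unfolding inner_3 by simp_all
    then have "L X $ 3 = dsurf p X $ 3" for X by (metis add_left_cancel)
    then show ?thesis using has_derivative_diff[OF Li[of 3] si[of 3]] by simp
  qed
  note zero = this
  have s0D: "(s0, 0) \<in> ?D" using r(1) by (simp add: diamond_axis)
  have "f (\<eta> p) $ 3 - surf p $ 3 = f (\<eta> (s0, 0)) $ 3 - surf (s0, 0) $ 3" if p: "p \<in> ?D" for p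
    by (rule has_derivative_zero_unique[OF convex_diamond[OF convex_ball] has_derivative_at_withinI[OF zero] p s0D])
  moreover have "f (\<eta> (s0, 0)) = surf (s0, 0)"
    using axis[of s0] r(1) fc[OF J(3)] surf_axis[OF sI[OF J(3)]] by simp
  ultimately have "f (\<eta> p) = surf p" if "p \<in> ?D" for p
    using n12[OF that] that by (simp add: vec_eq_iff forall_3)
  moreover have "continuous_on ?D \<eta>"
    using edif by (intro continuous_at_imp_continuous_on ballI differentiable_imp_continuous_within)
  moreover have "\<eta> ` ?D \<subseteq> S" using eS by blast
  ultimately show thesis using that r axis by blast
qed

text \<open>On \<mu> > 0 the metric \<mu> (ds^2 - dt^2) is non-degenerate; the component through the
  axis provides connectedness.\<close>

definition W :: "(real \<times> real) set" where
  "W = connected_component_set {p \<in> diamond I. \<mu> p > 0} (base, 0)"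

lemma open_positive: "open {p \<in> diamond I. \<mu> p > 0}"
proof -
  have "smooth_on (diamond I) \<mu>"
    unfolding \<mu>_def[abs_def] divide_inverse
    by (intro smooth_on_diff smooth_on_mult smooth_on_const smooth_on_diamond open_I open_diamond smooth_dAB)
  then have "open (diamond I \<inter> \<mu> -` {0<..})"
    by (intro continuous_open_preimage smooth_on_continuous_on open_diamond open_I) auto
  moreover have "diamond I \<inter> \<mu> -` {0<..} = {p \<in> diamond I. \<mu> p > 0}" by auto
  ultimately show ?thesis by simp
qed

lemma open_W: "open W"
  unfolding W_def by (rule open_connected_component[OF open_positive])

lemma connected_W: "connected W"
  unfolding W_def by (rule connected_connected_component)

lemma W_subset: "W \<subseteq> {p \<in> diamond I. \<mu> p > 0}"
  unfolding W_def by (rule connected_component_subset)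

lemma axis_W: "(\<lambda>s. (s, 0)) ` I \<subseteq> W"
  unfolding W_def
proof (rule connected_component_maximal)
  show "(base, 0) \<in> (\<lambda>s. (s, 0)) ` I" using base_in by blast
  show "connected ((\<lambda>s. (s, 0 :: real)) ` I)"
    using interval_I by (intro connected_continuous_image continuous_intros) (simp add: is_interval_connected)
  show "(\<lambda>s. (s, 0)) ` I \<subseteq> {p \<in> diamond I. \<mu> p > 0}"
    using mu_axis by (auto simp: diamond_axis)
qed

text \<open>Stated for every f that agrees with \<open>surf\<close> on W, since in the planar atlas
  the surface appears as \<open>surf\<close> after \<open>inv_into W (\<lambda>p. p)\<close>, which
  is controlled on W only.\<close>

lemma frechet_surf_W:
  assumes "p \<in> W" "\<And>q. q \<in> W \<Longrightarrow> f q = surf q"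
  shows "frechet_derivative f (at p) = dsurf p"
proof -
  have "p \<in> diamond I" using assms(1) W_subset by auto
  from has_derivative_transform_within_open[OF deriv_surf[OF this] open_W assms(1)] assms(2)
  show ?thesis by (intro frechet_derivative_at[symmetric]) simp
qed

lemma con_conormal_W:
  assumes "p \<in> W" "\<And>q. q \<in> W \<Longrightarrow> f q = surf q"
  shows "affine_conormal_at e3 f p (con p)"
proof -
  have "frechet_derivative f (at p) = dsurf p" by (rule frechet_surf_W[OF assms])
  then show ?thesis
    using con_dsurf[of p] by (simp add: affine_conormal_at_def inner_3[of _ e3] con_def[of p])
qed

lemma surf_sphere:
  assumes f: "\<And>q. q \<in> W \<Longrightarrow> f q = surf q"
  shows "indef_improper_affine_sphere_param e3 W f"
proof (rule param_sphereI[where n = con and Dn = dcon and m = \<mu>])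
  have "smooth_on W surf" by (rule smooth_on_subset[OF smooth_surf]) (use W_subset in blast)
  then show "smooth_on W f" by (rule smooth_on_cong[OF open_W]) (simp add: f)
  fix p assume W: "p \<in> W"
  then have p: "p \<in> diamond I" "\<mu> p > 0" using W_subset by auto
  show "(con has_derivative dcon p) (at p)" by (rule deriv_con[OF p(1)])
  have L: "frechet_derivative f (at p) = dsurf p" by (rule frechet_surf_W[OF W f])
  show "affine_conormal_at e3 f p (con p)" by (rule con_conormal_W[OF W f])
  show "\<mu> p > 0" by (rule p)
  show "- (dcon p X \<bullet> frechet_derivative f (at p) Y) = \<mu> p * (fst X * fst Y - snd X * snd Y)" for X Y
    unfolding L by (rule metric_surf)
  show "hdet (frechet_derivative f (at p)) = \<mu> p"
    unfolding L by (rule hdet_surf)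
qed (rule open_W)

lemma surf_representation: "split_representation I \<alpha> U W surf con"
  unfolding split_representation_def
proof (intro conjI ballI)
  fix z assume "z \<in> W"
  then have z: "z \<in> diamond I" using W_subset by auto
  obtain s t where st: "z = (s, t)" by (cases z)
  show "con z = vector [fst (2 *\<^sub>R Phi1 \<alpha> U z), fst (2 *\<^sub>R Phi2 \<alpha> U z), 1]"
    by (simp add: con_def vec_eq_iff forall_3 Phi1_def Phi2_def split_mult_def split_j_def split_ext_def st
        A1_def A2_def B1_def B2_def field_simps)
  show "surf z $ 1 = snd (2 *\<^sub>R Phi2 \<alpha> U z)" "surf z $ 2 = snd (- 2 *\<^sub>R Phi1 \<alpha> U z)"
    by (simp_all add: surf_def Phi1_def Phi2_def split_mult_def split_j_def split_ext_def st
        A1_def A2_def B1_def B2_def field_simps)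
  have d: "frechet_derivative (\<lambda>z. surf z $ i) (at z) X = dsurf z X $ i" for i X
    using fun_cong[OF frechet_derivative_at[OF bounded_linear.has_derivative[OF bounded_linear_vec_nth deriv_surf[OF z]]], of X]
    by simp
  \<comment> \<open>The real and imaginary parts of the split equation are the cases X = (1, 0) and
    X = (0, 1) of this orthogonality.\<close>
  have *: "dsurf z X $ 3 = - (con z $ 1 * dsurf z X $ 1 + con z $ 2 * dsurf z X $ 2)" for X
    by (simp add: dsurf_def)
  show "- split_dz (\<lambda>z. surf z $ 3) z =
        (con z $ 1) *\<^sub>R split_dz (\<lambda>z. surf z $ 1) z + (con z $ 2) *\<^sub>R split_dz (\<lambda>z. surf z $ 2) z"
    unfolding split_dz_def d * by (simp add: split_mult_def split_j_def algebra_simps)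
next
  show "(\<lambda>z. surf z $ 3) differentiable_on W"
    unfolding differentiable_on_def
  proof
    fix z assume "z \<in> W"
    then have "z \<in> diamond I" using W_subset by auto
    from bounded_linear.has_derivative[OF bounded_linear_vec_nth deriv_surf[OF this], of 3]
    show "(\<lambda>z. surf z $ 3) differentiable at z within W"
      by (rule differentiable_at_withinI[OF differentiableI])
  qed
next
  show "\<exists>s0\<in>I. surf (s0, 0) $ 3 = \<alpha> s0 $ 3"
    using base_in surf_axis by metis
qed

end

section \<open>The plane domain as an analytic surface\<close>

lemma real_analytic_on_affine:
  fixes L :: "'a::euclidean_space \<Rightarrow> 'b::real_normed_vector"
  assumes L: "linear L" and S: "open S" and f: "\<And>p. p \<in> S \<Longrightarrow> f p = L p"
  shows "real_analytic_on S f"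
  unfolding real_analytic_on_def
proof
  fix p assume p: "p \<in> S"
  then obtain r where r: "r > 0" "ball p r \<subseteq> S" using S openE by blast
  \<comment> \<open>Taylor expansion of L at p: coefficient L p at the zero multi-index, L j at the
    unit multi-index of j, and 0 elsewhere.\<close>
  define m0 :: "'a \<Rightarrow> nat" where "m0 = (\<lambda>i\<in>Basis. 0)"
  define m1 :: "'a \<Rightarrow> 'a \<Rightarrow> nat" where "m1 j = (\<lambda>i\<in>Basis. if i = j then 1 else 0)" for j
  have m01: "m1 j \<noteq> m0" if "j \<in> Basis" for j
    using that by (auto simp: m0_def m1_def fun_eq_iff)
  have inj: "inj_on m1 Basis"
  proof (rule inj_onI)
    fix j k :: 'a assume "j \<in> Basis" "k \<in> Basis" "m1 j = m1 k"
    then show "j = k" by (auto simp: m1_def dest!: fun_cong[of _ _ j] split: if_splits)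
  qed
  define a where "a m = (if m = m0 then L p else if m \<in> m1 ` Basis then L (the_inv_into Basis m1 m) else 0)" for m
  show "\<exists>r>0. \<exists>a. \<forall>q\<in>ball p r.
     ((\<lambda>m. (\<Prod>i\<in>Basis. ((q - p) \<bullet> i) ^ m i) *\<^sub>R a m) has_sum f q) (Basis \<rightarrow>\<^sub>E UNIV)"
  proof (intro exI[of _ r] conjI exI[of _ a] ballI r(1))
    fix q assume q: "q \<in> ball p r"
    let ?t = "\<lambda>m. (\<Prod>i\<in>Basis. ((q - p) \<bullet> i) ^ m i) *\<^sub>R a m"
    have t0: "?t m0 = L p" by (simp add: m0_def a_def)
    have t1: "?t (m1 j) = ((q - p) \<bullet> j) *\<^sub>R L j" if j: "j \<in> Basis" for j
    proof -
      have "(\<Prod>i\<in>Basis. ((q - p) \<bullet> i) ^ m1 j i) = (\<Prod>i\<in>Basis. if i = j then (q - p) \<bullet> i else 1)"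
        by (intro prod.cong) (auto simp: m1_def)
      also have "\<dots> = (q - p) \<bullet> j" using j by simp
      finally show ?thesis using j m01[OF j] by (simp add: a_def the_inv_into_f_f[OF inj])
    qed
    have "sum ?t (insert m0 (m1 ` Basis)) = L p + (\<Sum>j\<in>Basis. ((q - p) \<bullet> j) *\<^sub>R L j)"
      using m01 t0 t1 by (subst sum.insert) (auto simp: sum.reindex[OF inj])
    also have "(\<Sum>j\<in>Basis. ((q - p) \<bullet> j) *\<^sub>R L j) = L (\<Sum>j\<in>Basis. ((q - p) \<bullet> j) *\<^sub>R j)"
      by (simp add: linear_sum[OF L] linear_cmul[OF L])
    also have "L p + \<dots> = L q" by (simp only: euclidean_representation) (simp add: linear_diff[OF L])
    also have "\<dots> = f q" using f r(2) q by auto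
    finally have s: "sum ?t (insert m0 (m1 ` Basis)) = f q" .
    show "(?t has_sum f q) (Basis \<rightarrow>\<^sub>E UNIV)"
      by (rule has_sum_finite_neutralI[OF _ _ _ s[symmetric]]) (auto simp: a_def, auto simp: m0_def m1_def)
  qed
qed

lemma second_countable_euclidean: "second_countable (euclidean :: 'a::second_countable_topology topology)"
proof -
  obtain B :: "'a set set" where B: "countable B" "topological_basis B"
    using ex_countable_basis by blast
  have "\<exists>V\<in>B. x \<in> V \<and> V \<subseteq> U" if "openin euclidean U \<and> x \<in> U" for U x
  proof -
    have "open U" "x \<in> U" using that by auto
    then obtain V where "V \<in> B" "x \<in> V" "V \<subseteq> U" by (rule topological_basisE[OF B(2)])
    then show ?thesis by blast
  qed
  then show ?thesis
    unfolding second_countable_def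
    by (intro exI[of _ B]) (simp add: B(1) topological_basis_open[OF B(2)])
qed

lemma analytic_surface_planar:
  assumes W: "open W"
  shows "analytic_surface (top_of_set W) (planar_atlas W)"
proof -
  have "inv_into W (\<lambda>p. p) p = p" if "p \<in> W" for p :: "real \<times> real"
    using inv_into_f_f[of "\<lambda>p. p" W p] that by simp
  then have "real_analytic_on W ((\<lambda>p. p) \<circ> inv_into W (\<lambda>p. p))"
    by (intro real_analytic_on_affine[where L = "\<lambda>p. p"] W) (auto intro: linearI)
  moreover have "homeomorphic_map (top_of_set W) (top_of_set W) (\<lambda>p. p)"
    using homeomorphic_map_id[of "top_of_set W"] by (simp only: id_def)
  moreover have "Hausdorff_space (top_of_set W)"
    by (rule Hausdorff_space_subtopology) (simp add: Hausdorff_space_euclidean)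
  moreover have "second_countable (top_of_set W)"
    by (rule second_countable_subtopology) (rule second_countable_euclidean)
  ultimately show ?thesis
    using W unfolding analytic_surface_def by (simp add: subtopology_subtopology)
qed

section \<open>Gluing and injectivity\<close>

text \<open>The coincidence set is closed because X is Hausdorff, and open because F is injective
  near every common value; connectedness does the rest.\<close>

lemma lifts_agree:
  fixes g1 g2 :: "'a::topological_space \<Rightarrow> 'p"
  assumes Q: "connected Q" and X: "Hausdorff_space X"
    and g: "continuous_map (top_of_set Q) X g1" "continuous_map (top_of_set Q) X g2"
    and F: "\<And>x. x \<in> topspace X \<Longrightarrow> \<exists>U. openin X U \<and> x \<in> U \<and> inj_on F U"
    and eq: "\<And>q. q \<in> Q \<Longrightarrow> F (g1 q) = F (g2 q)" and q0: "q0 \<in> Q" "g1 q0 = g2 q0" and q: "q \<in> Q"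
  shows "g1 q = g2 q"
proof -
  let ?E = "{q \<in> Q. g1 q = g2 q}"
  have "closedin (top_of_set Q) ?E"
    using closedin_continuous_maps_eq[OF X g] by simp
  moreover have "openin (top_of_set Q) ?E"
  proof (subst openin_subopen, intro ballI)
    fix p assume p: "p \<in> ?E"
    then have "g1 p \<in> topspace X" using continuous_map_image_subset_topspace[OF g(1)] by auto
    then obtain U where U: "openin X U" "g1 p \<in> U" "inj_on F U" using F by blast
    let ?T = "{q \<in> Q. g1 q \<in> U} \<inter> {q \<in> Q. g2 q \<in> U}"
    have "openin (top_of_set Q) ?T"
      using openin_continuous_map_preimage[OF g(1) U(1)] openin_continuous_map_preimage[OF g(2) U(1)]
      by (intro openin_Int) simp_all
    moreover have "p \<in> ?T" using p U(2) by auto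
    moreover have "?T \<subseteq> ?E" using eq inj_onD[OF U(3)] by auto
    ultimately show "\<exists>T. openin (top_of_set Q) T \<and> p \<in> T \<and> T \<subseteq> ?E" by blast
  qed
  ultimately have "?E = {} \<or> ?E = Q" using Q unfolding connected_clopen by blast
  then show ?thesis using q0 q by blast
qed

lemma openin_preimage_open:
  assumes "open V" "continuous_map (top_of_set V) X g" "openin X U"
  shows "open {p \<in> V. g p \<in> U}"
  using openin_continuous_map_preimage[OF assms(2,3)] assms(1) openin_open_eq[of V "{p \<in> V. g p \<in> U}"]
  by simp

text \<open>Points of \<open>\<phi>(V)\<close> may accumulate at a point of \<open>\<phi>(K)\<close> although \<open>\<phi>\<close> embeds \<open>K\<close>, so the neighbourhood has
  to shrink along \<open>K\<close>: the ball around \<open>x\<close> is compared only with the compact set \<open>C (k x)\<close>, and of two balls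
  the one with the smaller index lies in the compact set of the other.\<close>

lemma injective_neighbourhood:
  fixes K V :: "'a::euclidean_space set"
  assumes V: "open V" "K \<subseteq> V" and X: "Hausdorff_space X" and g: "continuous_map (top_of_set V) X g"
    and loc: "\<And>x. x \<in> K \<Longrightarrow> \<exists>U. open U \<and> x \<in> U \<and> inj_on g U"
    and emb: "\<And>x U. x \<in> K \<Longrightarrow> open U \<Longrightarrow> x \<in> U \<Longrightarrow> \<exists>G. openin X G \<and> g x \<in> G \<and> (\<forall>y\<in>K. g y \<in> G \<longrightarrow> y \<in> U)"
  obtains V' where "open V'" "K \<subseteq> V'" "V' \<subseteq> V" "inj_on g V'"
proof -
  \<comment> \<open>Points near K are compared with K alone at this stage: if g p = g y with p near
    x, the embedding condition puts y near x, where g is injective.\<close>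
  have "\<exists>e>0. ball x e \<subseteq> V \<and> (\<forall>p\<in>ball x e. \<forall>y\<in>K. g p = g y \<longrightarrow> p = y)" if x: "x \<in> K" for x
  proof -
    obtain U where U: "open U" "x \<in> U" "inj_on g U" using loc[OF x] by blast
    obtain G where G: "openin X G" "g x \<in> G" "\<And>y. y \<in> K \<Longrightarrow> g y \<in> G \<Longrightarrow> y \<in> U"
      using emb[OF x U(1,2)] by blast
    have "open ({p \<in> V. g p \<in> G} \<inter> U)" by (intro open_Int openin_preimage_open[OF V(1) g G(1)] U(1))
    moreover have "x \<in> {p \<in> V. g p \<in> G} \<inter> U" using x V(2) G(2) U(2) by auto
    ultimately obtain e where e: "e > 0" "ball x e \<subseteq> {p \<in> V. g p \<in> G} \<inter> U" by (rule openE)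
    have "p = y" if "p \<in> ball x e" "y \<in> K" "g p = g y" for p y
    proof -
      have p: "p \<in> U" "g p \<in> G" using e(2) that(1) by auto
      then have "y \<in> U" using G(3)[OF that(2)] that(3) by simp
      then show ?thesis using inj_onD[OF U(3) that(3)] p by blast
    qed
    moreover have "ball x e \<subseteq> V" using e(2) by blast
    ultimately show ?thesis using e(1) by blast
  qed
  then obtain e where e: "\<And>x. x \<in> K \<Longrightarrow> e x > 0" "\<And>x. x \<in> K \<Longrightarrow> ball x (e x) \<subseteq> V"
    "\<And>x p y. x \<in> K \<Longrightarrow> p \<in> ball x (e x) \<Longrightarrow> y \<in> K \<Longrightarrow> g p = g y \<Longrightarrow> p = y"
    by metis
  define V1 where "V1 = (\<Union>x\<in>K. ball x (e x))"
  have V1: "open V1" "K \<subseteq> V1" "V1 \<subseteq> V" using e(1,2) by (auto simp: V1_def)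
  have sep: "p = y" if "p \<in> V1" "y \<in> K" "g p = g y" for p y
    using that e(3) by (auto simp: V1_def)
  obtain C where C: "\<And>n. compact (C n)" "\<And>n. C n \<subseteq> V1" "\<And>n. C n \<subseteq> interior (C (Suc n))"
    "\<Union> (range C) = V1"
    using open_Union_compact_subsets[OF V1(1)] by metis
  have mono: "C m \<subseteq> C n" if "m \<le> n" for m n
    by (rule lift_Suc_mono_le[OF _ that]) (use C(3) interior_subset in blast)
  define k where "k x = (LEAST n. x \<in> interior (C n))" for x
  have k: "x \<in> interior (C (k x))" if "x \<in> K" for x
  proof -
    have "x \<in> \<Union> (range C)" using that V1(2) C(4) by auto
    then obtain n where "x \<in> C n" by auto
    then have "x \<in> interior (C (Suc n))" using C(3) by blast
    then show ?thesis unfolding k_def by (rule LeastI)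
  qed
  have "\<exists>d>0. ball x d \<subseteq> interior (C (k x)) \<and> (\<forall>p\<in>ball x d. \<forall>q\<in>C (k x). g p = g q \<longrightarrow> p = q)"
    if x: "x \<in> K" for x
  proof -
    have xV: "x \<in> V" using x V(2) by auto
    obtain d where d: "d > 0" "ball x d \<subseteq> interior (C (k x))"
      using k[OF x] openE[OF open_interior] by metis
    obtain U where U: "open U" "x \<in> U" "inj_on g U" using loc[OF x] by blast
    \<comment> \<open>Otherwise there are p n tending to x and, along a subsequence, q n tending to
      some y in C (k x). The Hausdorff property gives g y = g x, so y = x by \<open>sep\<close>, and
      both sequences enter a set on which g is injective.\<close>
    have "\<exists>r>0. \<forall>p\<in>ball x r. \<forall>q\<in>C (k x). g p = g q \<longrightarrow> p = q"
    proof (rule ccontr)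
      assume "\<not> ?thesis"
      then have "\<forall>n. \<exists>p q. p \<in> ball x (1 / real (Suc n)) \<and> q \<in> C (k x) \<and> g p = g q \<and> p \<noteq> q"
        by (metis of_nat_0_less_iff zero_less_Suc zero_less_divide_1_iff)
      then obtain p q where pq: "\<And>n. p n \<in> ball x (1 / real (Suc n))" "\<And>n. q n \<in> C (k x)"
        "\<And>n. g (p n) = g (q n)" "\<And>n. p n \<noteq> q n" by metis
      have "p \<longlonglongrightarrow> x"
      proof (rule metric_LIMSEQ_I)
        fix r :: real assume "r > 0"
        then obtain N where N: "1 / real (Suc N) < r" using nat_approx_posE by metis
        have "dist (p n) x < r" if "n \<ge> N" for n
        proof -
          have "1 / real (Suc n) \<le> 1 / real (Suc N)" using that by (simp add: frac_le)
          then show ?thesis using pq(1)[of n] N by (simp add: dist_commute)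
        qed
        then show "\<exists>N. \<forall>n\<ge>N. dist (p n) x < r" by blast
      qed
      obtain y \<sigma> where y: "y \<in> C (k x)" "strict_mono \<sigma>" "(q \<circ> \<sigma>) \<longlonglongrightarrow> y"
        using C(1)[of "k x"] pq(2) unfolding compact_def by metis
      have p': "(p \<circ> \<sigma>) \<longlonglongrightarrow> x" by (rule LIMSEQ_subseq_LIMSEQ[OF \<open>p \<longlonglongrightarrow> x\<close> y(2)])
      have yV: "y \<in> V1" "y \<in> V" using y(1) C(2) V1(3) by auto
      have "g y = g x"
      proof (rule ccontr)
        assume ne: "g y \<noteq> g x"
        have "g y \<in> topspace X" "g x \<in> topspace X"
          using continuous_map_image_subset_topspace[OF g] xV yV by auto
        then obtain G H where GH: "openin X G" "openin X H" "g y \<in> G" "g x \<in> H" "disjnt G H"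
          using X ne unfolding Hausdorff_space_def by metis
        have "\<forall>\<^sub>F n in sequentially. (q \<circ> \<sigma>) n \<in> {p \<in> V. g p \<in> G}"
          by (rule topological_tendstoD[OF y(3) openin_preimage_open[OF V(1) g GH(1)]]) (use yV GH in auto)
        moreover have "\<forall>\<^sub>F n in sequentially. (p \<circ> \<sigma>) n \<in> {p \<in> V. g p \<in> H}"
          by (rule topological_tendstoD[OF p' openin_preimage_open[OF V(1) g GH(2)]]) (use xV GH in auto)
        ultimately have "\<forall>\<^sub>F n in sequentially. False"
          by eventually_elim (use GH(5) pq(3) in \<open>auto simp: disjnt_iff\<close>)
        then show False by simp
      qed
      then have "y = x" using sep[OF yV(1) x] by blast
      then have "(q \<circ> \<sigma>) \<longlonglongrightarrow> x" using y(3) by simp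
      then have "\<forall>\<^sub>F n in sequentially. (q \<circ> \<sigma>) n \<in> U" by (rule topological_tendstoD[OF _ U(1,2)])
      moreover have "\<forall>\<^sub>F n in sequentially. (p \<circ> \<sigma>) n \<in> U" by (rule topological_tendstoD[OF p' U(1,2)])
      ultimately have "\<forall>\<^sub>F n in sequentially. False"
      proof eventually_elim
        case (elim n)
        then show ?case using inj_onD[OF U(3) pq(3)[of "\<sigma> n"]] pq(4)[of "\<sigma> n"] by simp
      qed
      then show False by simp
    qed
    then obtain r where r: "r > 0" "\<And>p q. p \<in> ball x r \<Longrightarrow> q \<in> C (k x) \<Longrightarrow> g p = g q \<Longrightarrow> p = q"
      by blast
    have "ball x (min d r) \<subseteq> ball x d" "ball x (min d r) \<subseteq> ball x r" by auto
    then show ?thesis using d r by (intro exI[of _ "min d r"]) auto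
  qed
  then obtain d where d: "\<And>x. x \<in> K \<Longrightarrow> d x > 0" "\<And>x. x \<in> K \<Longrightarrow> ball x (d x) \<subseteq> interior (C (k x))"
    "\<And>x p q. x \<in> K \<Longrightarrow> p \<in> ball x (d x) \<Longrightarrow> q \<in> C (k x) \<Longrightarrow> g p = g q \<Longrightarrow> p = q"
    by metis
  show thesis
  proof (rule that)
    show "open (\<Union>x\<in>K. ball x (d x))" by auto
    show "K \<subseteq> (\<Union>x\<in>K. ball x (d x))" using d(1) by auto
    have dC: "ball x (d x) \<subseteq> C (k x)" if "x \<in> K" for x using d(2)[OF that] interior_subset by blast
    then show "(\<Union>x\<in>K. ball x (d x)) \<subseteq> V" using C(2) V1(3) by blast
    show "inj_on g (\<Union>x\<in>K. ball x (d x))"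
    proof (rule inj_onI)
      fix p q assume "p \<in> (\<Union>x\<in>K. ball x (d x))" "q \<in> (\<Union>x\<in>K. ball x (d x))" and eq: "g p = g q"
      then obtain x y where x: "x \<in> K" "p \<in> ball x (d x)" and y: "y \<in> K" "q \<in> ball y (d y)" by blast
      show "p = q"
      proof (cases "k x \<le> k y")
        case True
        then have "p \<in> C (k y)" using dC[OF x(1)] x(2) mono by blast
        then show ?thesis using d(3)[OF y] eq by metis
      next
        case False
        then have "q \<in> C (k x)" using dC[OF y(1)] y(2) mono[of "k y" "k x"] by auto
        then show ?thesis using d(3)[OF x _ eq] by blast
      qed
    qed
  qed
qed

section \<open>Charts of an abstract surface\<close>

lemma chart_facts:
  assumes A: "analytic_surface X A" and D: "(D, \<kappa>) \<in> A"
  shows "openin X D" "D \<subseteq> topspace X" "open (\<kappa> ` D)" "inj_on \<kappa> D"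
    "continuous_map (subtopology X D) (top_of_set (\<kappa> ` D)) \<kappa>"
    "continuous_map (top_of_set (\<kappa> ` D)) X (inv_into D \<kappa>)"
proof -
  have h: "openin X D" "open (\<kappa> ` D)" "homeomorphic_map (subtopology X D) (top_of_set (\<kappa> ` D)) \<kappa>"
    using A D unfolding analytic_surface_def by auto
  then show "openin X D" "open (\<kappa> ` D)" by auto
  show sub: "D \<subseteq> topspace X" using h(1) openin_subset by blast
  have top: "topspace (subtopology X D) = D" using sub by auto
  show inj: "inj_on \<kappa> D" using h(3) top unfolding homeomorphic_map_def by simp
  show "continuous_map (subtopology X D) (top_of_set (\<kappa> ` D)) \<kappa>"
    using h(3) homeomorphic_imp_continuous_map by blast
  obtain i where i: "homeomorphic_maps (subtopology X D) (top_of_set (\<kappa> ` D)) \<kappa> i"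
    using h(3) homeomorphic_map_maps by blast
  then have "continuous_map (top_of_set (\<kappa> ` D)) (subtopology X D) i" by (simp add: homeomorphic_maps_def)
  then have "continuous_map (top_of_set (\<kappa> ` D)) X i" by (simp add: continuous_map_in_subtopology)
  then show "continuous_map (top_of_set (\<kappa> ` D)) X (inv_into D \<kappa>)"
  proof (rule continuous_map_eq)
    fix y assume "y \<in> topspace (top_of_set (\<kappa> ` D))"
    then obtain x where x: "x \<in> D" "y = \<kappa> x" by auto
    have "i (\<kappa> x) = x" using i x(1) top unfolding homeomorphic_maps_def by blast
    then show "i y = inv_into D \<kappa> y" using x inv_into_f_f[OF inj] by simp
  qed
qed

lemma atlas_covers:
  assumes A: "analytic_surface X A" and x: "x \<in> topspace X"
  obtains D \<kappa> where "(D, \<kappa>) \<in> A" "x \<in> D"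
proof -
  have "x \<in> \<Union> (fst ` A)" using A x by (simp add: analytic_surface_def)
  then show thesis using that by force
qed

lemma sphere_locally_inj:
  assumes sp: "indef_improper_affine_sphere e3 X A \<psi>" and x: "x \<in> topspace X"
  shows "\<exists>U. openin X U \<and> x \<in> U \<and> inj_on \<psi> U"
proof -
  have A: "analytic_surface X A" using sp by (simp add: indef_improper_affine_sphere_def)
  obtain D \<kappa> where D: "(D, \<kappa>) \<in> A" "x \<in> D" by (rule atlas_covers[OF A x])
  note ch = chart_facts[OF A D(1)]
  have par: "indef_improper_affine_sphere_param e3 (\<kappa> ` D) (\<psi> \<circ> inv_into D \<kappa>)"
    using sp D(1) unfolding indef_improper_affine_sphere_def by blast
  then have sm: "smooth_on (\<kappa> ` D) (\<psi> \<circ> inv_into D \<kappa>)" by (simp add: indef_improper_affine_sphere_param_def)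
  obtain U where U: "open U" "\<kappa> x \<in> U" "U \<subseteq> \<kappa> ` D" "inj_on (\<psi> \<circ> inv_into D \<kappa>) U"
    using shadow_locally_inj[OF ch(3) sm imageI[OF D(2)] param_sphere_hdet(2)[OF ch(3) par]] by metis
  have "openin (top_of_set (\<kappa> ` D)) U" using U(1,3) ch(3) by (simp add: openin_open_eq)
  from openin_continuous_map_preimage[OF ch(5) this]
  have "openin (subtopology X D) {y \<in> D. \<kappa> y \<in> U}" using ch(2) by (simp add: Int_absorb1)
  then have "openin X {y \<in> D. \<kappa> y \<in> U}" using ch(1) openin_trans_full by blast
  moreover have "inj_on \<psi> {y \<in> D. \<kappa> y \<in> U}"
  proof (rule inj_onI)
    fix y z assume h: "y \<in> {y \<in> D. \<kappa> y \<in> U}" "z \<in> {y \<in> D. \<kappa> y \<in> U}" "\<psi> y = \<psi> z"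
    then have "(\<psi> \<circ> inv_into D \<kappa>) (\<kappa> y) = (\<psi> \<circ> inv_into D \<kappa>) (\<kappa> z)"
      using inv_into_f_f[OF ch(4)] by simp
    then have "\<kappa> y = \<kappa> z" using inj_onD[OF U(4)] h by blast
    then show "y = z" using inj_onD[OF ch(4)] h by blast
  qed
  ultimately show ?thesis using D(2) U(2) by blast
qed

section \<open>Uniqueness\<close>

text \<open>In a chart, g is a continuous lift of the projected \<open>surf\<close> through the
  projected sphere. Both are planar maps with invertible derivative, so the regularity of lifts
  applies.\<close>

lemma lift_local_diffeo:
  assumes sp: "indef_improper_affine_sphere e3 X A \<psi>'" and V: "open V"
    and surf: "smooth_on V surf" "\<And>p. p \<in> V \<Longrightarrow> hdet (frechet_derivative surf (at p)) \<noteq> 0"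
    and g: "continuous_map (top_of_set V) X g" and eq: "\<And>p. p \<in> V \<Longrightarrow> \<psi>' (g p) = surf p"
  shows "local_diffeo V X A g"
  unfolding local_diffeo_def
proof (intro conjI g, safe)
  have A: "analytic_surface X A" using sp by (simp add: indef_improper_affine_sphere_def)
  fix D \<kappa> assume D: "(D, \<kappa>) \<in> A"
  note ch = chart_facts[OF A D]
  let ?f = "\<psi>' \<circ> inv_into D \<kappa>"
  let ?S = "{p \<in> V. g p \<in> D}"
  have par: "indef_improper_affine_sphere_param e3 (\<kappa> ` D) ?f"
    using sp D unfolding indef_improper_affine_sphere_def by blast
  then have sm: "smooth_on (\<kappa> ` D) ?f" by (simp add: indef_improper_affine_sphere_param_def)
  note hd = param_sphere_hdet(2)[OF ch(3) par]
  have S: "open ?S" by (rule openin_preimage_open[OF V g ch(1)])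
  have ss: "smooth_on ?S surf" by (rule smooth_on_subset[OF surf(1)]) auto
  have hs: "hdet (frechet_derivative surf (at p)) \<noteq> 0" if "p \<in> ?S" for p using surf(2) that by simp
  have "continuous_map (top_of_set ?S) (subtopology X D) g"
  proof (rule continuous_map_into_subtopology)
    show "continuous_map (top_of_set ?S) X g"
      using continuous_map_from_subtopology[OF g, of ?S]
      by (simp add: subtopology_subtopology Int_absorb1 Collect_restrict)
  qed auto
  from continuous_map_compose[OF this ch(5)]
  have c: "continuous_on ?S (\<kappa> \<circ> g)" by (simp add: continuous_map_in_subtopology)
  have P: "shadow ?f ((\<kappa> \<circ> g) p) = shadow surf p" if "p \<in> ?S" for p
    using that eq inv_into_f_f[OF ch(4)] by (simp add: shadow_def)
  have im: "(\<kappa> \<circ> g) ` ?S \<subseteq> \<kappa> ` D" by auto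
  note lift = smooth_on_lift[OF S ch(3) shadow_smooth(1)[OF ch(3) sm hd] shadow_smooth(2)[OF ch(3) sm hd]
      shadow_smooth(1)[OF S ss hs] c im P]
  show "smooth_on ?S (\<kappa> \<circ> g)" by (rule lift(1))
  fix a b assume "(a, b) \<in> V" "g (a, b) \<in> D"
  then have p: "(a, b) \<in> ?S" by simp
  have inj: "inj (frechet_derivative (shadow surf) (at (a, b)))"
    by (rule shadow_smooth(2)[OF S ss hs p])
  show "bij (frechet_derivative (\<kappa> \<circ> g) (at (a, b)))"
    by (rule lift(2)[OF _ _ _ _ _ p inj])
qed

context admissible begin

lemma hdet_surf_W: "p \<in> W \<Longrightarrow> hdet (frechet_derivative surf (at p)) \<noteq> 0"
  using frechet_surf_W[of p surf] hdet_surf[of p] W_subset by auto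

lemma smooth_surf_W: "smooth_on W surf"
  by (rule smooth_on_subset[OF smooth_surf]) (use W_subset in blast)

lemma small_diamond:
  assumes "open G" "(s, 0) \<in> G"
  obtains r where "r > 0" "diamond (ball s r) \<subseteq> G"
proof -
  obtain e where e: "e > 0" "ball (s, 0) e \<subseteq> G" using assms by (rule openE)
  have "diamond (ball s (e / 2)) \<subseteq> ball (s, 0) e"
  proof
    fix p assume "p \<in> diamond (ball s (e / 2))"
    then have "\<bar>s - (fst p + snd p)\<bar> < e / 2" "\<bar>s - (fst p - snd p)\<bar> < e / 2"
      by (auto simp: diamond_def dist_real_def)
    then have "\<bar>fst p - s\<bar> + \<bar>snd p\<bar> < e" using e(1) by arith
    moreover have "norm (p - (s, 0)) \<le> norm (fst p - s) + norm (snd p)"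
      using norm_Pair_le[of "fst p - s" "snd p"] by (cases p) simp
    ultimately show "p \<in> ball (s, 0) e" by (simp add: dist_norm norm_minus_commute)
  qed
  then show thesis using that[of "e / 2"] e by auto
qed

lemma diamond_mono: "J \<subseteq> J' \<Longrightarrow> diamond J \<subseteq> diamond J'"
  by (auto simp: diamond_def)

lemma local_reparametrization:
  assumes sp: "indef_improper_affine_sphere e3 X A \<psi>'" and ct: "contains_with_conormal e3 X A \<psi>' I \<alpha> U \<beta>"
    and s0: "s0 \<in> I"
  shows "\<exists>r>0. \<exists>g. ball s0 r \<subseteq> I \<and> diamond (ball s0 r) \<subseteq> W \<and> continuous_map (top_of_set (diamond (ball s0 r))) X g
      \<and> (\<forall>s\<in>ball s0 r. g (s, 0) = \<beta> s) \<and> (\<forall>p\<in>diamond (ball s0 r). \<psi>' (g p) = surf p)"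
proof -
  have A: "analytic_surface X A" using sp by (simp add: indef_improper_affine_sphere_def)
  obtain N where N: "affine_conormal e3 A \<psi>' N" "\<And>s. s \<in> I \<Longrightarrow> \<psi>' (\<beta> s) = \<alpha> s" "\<And>s. s \<in> I \<Longrightarrow> N (\<beta> s) = U s"
    and \<beta>: "continuous_map (top_of_set I) X \<beta>"
      "\<And>D \<kappa>. (D, \<kappa>) \<in> A \<Longrightarrow> regular_analytic_curve {s \<in> I. \<beta> s \<in> D} (\<kappa> \<circ> \<beta>)"
    using ct unfolding contains_with_conormal_def surface_curve_def by blast
  have "\<beta> s0 \<in> topspace X" using continuous_map_image_subset_topspace[OF \<beta>(1)] s0 by auto
  then obtain D \<kappa> where D: "(D, \<kappa>) \<in> A" "\<beta> s0 \<in> D" by (rule atlas_covers[OF A])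
  note ch = chart_facts[OF A D(1)]
  let ?f = "\<psi>' \<circ> inv_into D \<kappa>"
  let ?n = "N \<circ> inv_into D \<kappa>"
  have par: "indef_improper_affine_sphere_param e3 (\<kappa> ` D) ?f"
    using sp D unfolding indef_improper_affine_sphere_def by blast
  have cn: "affine_conormal_at e3 ?f p (?n p)" if p: "p \<in> \<kappa> ` D" for p
  proof -
    obtain x where x: "x \<in> D" "p = \<kappa> x" using p by blast
    have "affine_conormal_at e3 ?f (\<kappa> x) (N x)" using N(1) D(1) x(1) unfolding affine_conormal_def by blast
    then show ?thesis using x inv_into_f_f[OF ch(4)] by simp
  qed
  define J where "J = {s \<in> I. \<beta> s \<in> D}"
  have J: "open J" "J \<subseteq> I" "s0 \<in> J"
    using openin_preimage_open[OF open_I \<beta>(1) ch(1)] s0 D(2) by (auto simp: J_def)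
  define c where "c = \<kappa> \<circ> \<beta>"
  have an: "real_analytic_on J c" using \<beta>(2)[OF D(1)] by (simp add: J_def c_def regular_analytic_curve_def)
  have "smooth_on J (\<lambda>s. (fst (c s), snd (c s)))"
    by (intro smooth_on_Pair J(1) real_analytic_on_smooth_on
        real_analytic_on_bounded_linear[OF bounded_linear_fst an] real_analytic_on_bounded_linear[OF bounded_linear_snd an])
  then have c: "smooth_on J c" by simp
  have cJ: "c ` J \<subseteq> \<kappa> ` D" by (auto simp: c_def J_def)
  have inverse_c: "inv_into D \<kappa> (c s) = \<beta> s" if "s \<in> J" for s
    using that inv_into_f_f[OF ch(4)] by (simp add: c_def J_def)
  have fc: "?f (c s) = \<alpha> s" "?n (c s) = U s" if "s \<in> J" for s
    using inverse_c[OF that] N that J(2) by auto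
  obtain r0 \<eta> where r0: "r0 > 0" "ball s0 r0 \<subseteq> J" and \<eta>: "continuous_on (diamond (ball s0 r0)) \<eta>"
    "\<eta> ` diamond (ball s0 r0) \<subseteq> \<kappa> ` D" "\<And>s. s \<in> ball s0 r0 \<Longrightarrow> \<eta> (s, 0) = c s"
    "\<And>p. p \<in> diamond (ball s0 r0) \<Longrightarrow> ?f (\<eta> p) = surf p"
    by (rule chart_lift[OF ch(3) par cn J smooth_on_continuous_on[OF c] cJ
        differentiableI[OF smooth_on_has_derivative[OF J(1) c J(3)]] fc]; blast)
  obtain r1 where r1: "r1 > 0" "diamond (ball s0 r1) \<subseteq> W"
    by (rule small_diamond[OF open_W, of s0]) (use axis_W s0 in auto)
  define r where "r = min r0 r1"
  have r: "r > 0" "ball s0 r \<subseteq> ball s0 r0" "ball s0 r \<subseteq> ball s0 r1" using r0 r1 by (auto simp: r_def)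
  have dr: "diamond (ball s0 r) \<subseteq> diamond (ball s0 r0)" "diamond (ball s0 r) \<subseteq> W"
    using diamond_mono[OF r(2)] diamond_mono[OF r(3)] r1(2) by auto
  have "continuous_map (top_of_set (diamond (ball s0 r))) (top_of_set (\<kappa> ` D)) \<eta>"
    using continuous_on_subset[OF \<eta>(1) dr(1)] \<eta>(2) dr(1) by (auto simp: continuous_map_in_subtopology)
  from continuous_map_compose[OF this ch(6)]
  have "continuous_map (top_of_set (diamond (ball s0 r))) X (inv_into D \<kappa> \<circ> \<eta>)" .
  moreover have "(inv_into D \<kappa> \<circ> \<eta>) (s, 0) = \<beta> s" if "s \<in> ball s0 r" for s
  proof -
    have "s \<in> ball s0 r0" "s \<in> J" using that r(2) r0(2) by blast+
    then show ?thesis using \<eta>(3) inverse_c by simp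
  qed
  moreover have "\<psi>' ((inv_into D \<kappa> \<circ> \<eta>) p) = surf p" if "p \<in> diamond (ball s0 r)" for p
    using \<eta>(4)[of p] that dr(1) by auto
  moreover have "ball s0 r \<subseteq> I" using r(2) r0(2) J(2) by blast
  ultimately show ?thesis using r(1) dr(2) by blast
qed

lemma reparametrization:
  assumes sp: "indef_improper_affine_sphere e3 X A \<psi>'" and ct: "contains_with_conormal e3 X A \<psi>' I \<alpha> U \<beta>"
  obtains V g where "open V" "(\<lambda>s. (s, 0)) ` I \<subseteq> V" "V \<subseteq> W" "continuous_map (top_of_set V) X g"
    "\<And>s. s \<in> I \<Longrightarrow> g (s, 0) = \<beta> s" "\<And>p. p \<in> V \<Longrightarrow> \<psi>' (g p) = surf p"
proof -
  have X: "Hausdorff_space X"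
    using sp by (simp add: indef_improper_affine_sphere_def analytic_surface_def)
  have "\<forall>s0\<in>I. \<exists>r g. r > 0 \<and> ball s0 r \<subseteq> I \<and> diamond (ball s0 r) \<subseteq> W
      \<and> continuous_map (top_of_set (diamond (ball s0 r))) X g
      \<and> (\<forall>s\<in>ball s0 r. g (s, 0) = \<beta> s) \<and> (\<forall>p\<in>diamond (ball s0 r). \<psi>' (g p) = surf p)"
    using local_reparametrization[OF sp ct] by blast
  then obtain r h where rh: "\<And>s0. s0 \<in> I \<Longrightarrow> r s0 > 0 \<and> ball s0 (r s0) \<subseteq> I \<and> diamond (ball s0 (r s0)) \<subseteq> W
      \<and> continuous_map (top_of_set (diamond (ball s0 (r s0)))) X (h s0)
      \<and> (\<forall>s\<in>ball s0 (r s0). h s0 (s, 0) = \<beta> s) \<and> (\<forall>p\<in>diamond (ball s0 (r s0)). \<psi>' (h s0 p) = surf p)"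
    by metis
  define T where "T s0 = diamond (ball s0 (r s0))" for s0
  have T: "open (T s0)" for s0 unfolding T_def by (rule open_diamond[OF open_ball])
  define V where "V = (\<Union>s0\<in>I. T s0)"
  have oV: "open V" unfolding V_def using T by blast
  have axT: "(s0, 0) \<in> T s0" if "s0 \<in> I" for s0 using rh[OF that] by (simp add: T_def diamond_axis)
  have hc: "continuous_map (top_of_set (T s0)) X (h s0)" and hs: "\<And>p. p \<in> T s0 \<Longrightarrow> \<psi>' (h s0 p) = surf p"
    and hb: "\<And>s. s \<in> ball s0 (r s0) \<Longrightarrow> h s0 (s, 0) = \<beta> s" if "s0 \<in> I" for s0
    using rh[OF that] by (auto simp: T_def)
  have agree: "h s1 p = h s2 p" if s: "s1 \<in> I" "s2 \<in> I" and p: "p \<in> T s1" "p \<in> T s2" for s1 s2 p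
  proof (rule lifts_agree[where Q = "T s1 \<inter> T s2" and F = \<psi>' and X = X])
    show "connected (T s1 \<inter> T s2)"
      unfolding T_def by (intro convex_connected convex_Int convex_diamond convex_ball)
    show "continuous_map (top_of_set (T s1 \<inter> T s2)) X (h s1)" "continuous_map (top_of_set (T s1 \<inter> T s2)) X (h s2)"
      using continuous_map_from_subtopology[OF hc[OF s(1)], of "T s2"]
        continuous_map_from_subtopology[OF hc[OF s(2)], of "T s1"]
      by (simp_all add: subtopology_subtopology Int_commute)
    show "\<psi>' (h s1 q) = \<psi>' (h s2 q)" if "q \<in> T s1 \<inter> T s2" for q
      using that hs s by simp
    \<comment> \<open>A point p of both diamonds has s + t in both balls, so the convex overlap
      contains a point of the axis, where both lifts equal \<beta>.\<close>
    show "(fst p + snd p, 0) \<in> T s1 \<inter> T s2" using p by (auto simp: T_def diamond_def)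
    show "h s1 (fst p + snd p, 0) = h s2 (fst p + snd p, 0)"
      using p hb[OF s(1)] hb[OF s(2)] by (auto simp: T_def diamond_def)
    show "p \<in> T s1 \<inter> T s2" using p by blast
  qed (fact X sphere_locally_inj[OF sp])+
  obtain g where g: "continuous_map (top_of_set V) X g" "\<And>p s. s \<in> I \<Longrightarrow> p \<in> V \<inter> T s \<Longrightarrow> g p = h s p"
  proof (rule pasting_lemma_exists[where X = "top_of_set V" and Y = X and I = I and T = T and f = h])
    show "openin (top_of_set V) (T s)" if "s \<in> I" for s
      using T oV that by (auto simp: openin_open_eq V_def)
    show "continuous_map (subtopology (top_of_set V) (T s)) X (h s)" if "s \<in> I" for s
    proof -
      have "V \<inter> T s = T s" using that by (auto simp: V_def)
      then show ?thesis using hc[OF that] by (simp add: subtopology_subtopology)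
    qed
    show "topspace (top_of_set V) \<subseteq> (\<Union>s\<in>I. T s)" by (simp add: V_def)
    show "h s1 p = h s2 p" if "s1 \<in> I" "s2 \<in> I" "p \<in> topspace (top_of_set V) \<inter> T s1 \<inter> T s2" for s1 s2 p
      by (rule agree) (use that in auto)
  qed simp
  show thesis
  proof (rule that[OF oV _ _ g(1)])
    show "(\<lambda>s. (s, 0)) ` I \<subseteq> V" using axT by (auto simp: V_def)
    show "V \<subseteq> W" using rh by (auto simp: V_def T_def)
    show "g (s, 0) = \<beta> s" if s: "s \<in> I" for s
      using g(2)[OF s, of "(s, 0)"] axT[OF s] hb[OF s, of s] rh[OF s] s by (auto simp: V_def)
    show "\<psi>' (g p) = surf p" if p: "p \<in> V" for p
    proof -
      obtain s where "s \<in> I" "p \<in> T s" using p unfolding V_def by blast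
      then show ?thesis using g(2)[of s p] hs p by simp
    qed
  qed
qed

lemma uniqueness:
  assumes sp: "indef_improper_affine_sphere e3 X A \<psi>'" and ct: "contains_with_conormal e3 X A \<psi>' I \<alpha> U \<beta>"
  shows "\<exists>V \<phi>. open V \<and> (\<lambda>s. (s, 0)) ` I \<subseteq> V \<and> V \<subseteq> W \<and> local_diffeo V X A \<phi> \<and>
     (\<forall>s\<in>I. \<phi> (s, 0) = \<beta> s) \<and> (\<forall>p\<in>V. \<psi>' (\<phi> p) = surf p) \<and>
     (embedding_map (top_of_set I) X \<beta> \<longrightarrow> inj_on \<phi> V)"
proof -
  have X: "Hausdorff_space X"
    using sp by (simp add: indef_improper_affine_sphere_def analytic_surface_def)
  let ?K = "(\<lambda>s. (s, 0 :: real)) ` I"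
  obtain V g where V: "open V" "?K \<subseteq> V" "V \<subseteq> W" and g: "continuous_map (top_of_set V) X g"
    and gb: "\<And>s. s \<in> I \<Longrightarrow> g (s, 0) = \<beta> s" and gs: "\<And>p. p \<in> V \<Longrightarrow> \<psi>' (g p) = surf p"
    by (rule reparametrization[OF sp ct]; blast)
  \<comment> \<open>Proved for every smaller open set, because injectivity may force V to
    shrink.\<close>
  have diffeo: "local_diffeo V' X A g" if V': "open V'" "V' \<subseteq> V" for V'
  proof (rule lift_local_diffeo[OF sp V'(1)])
    show "smooth_on V' surf" by (rule smooth_on_subset[OF smooth_surf_W]) (use V' V in blast)
    show "hdet (frechet_derivative surf (at p)) \<noteq> 0" if "p \<in> V'" for p
      using hdet_surf_W that V' V by blast
    show "continuous_map (top_of_set V') X g"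
      using continuous_map_from_subtopology[OF g, of V'] V'(2) by (simp add: subtopology_subtopology Int_absorb1)
  qed (use gs V' in blast)
  have "\<exists>V'. open V' \<and> ?K \<subseteq> V' \<and> V' \<subseteq> V \<and> (embedding_map (top_of_set I) X \<beta> \<longrightarrow> inj_on g V')"
  proof (cases "embedding_map (top_of_set I) X \<beta>")
    case True
    have hm: "homeomorphic_map (top_of_set I) (subtopology X (\<beta> ` I)) \<beta>"
      using True by (simp add: embedding_map_def)
    \<comment> \<open>\<open>surf\<close> factors through g, so local injectivity of
      \<open>surf\<close> passes to g.\<close>
    have loc: "\<exists>G. open G \<and> x \<in> G \<and> inj_on g G" if x: "x \<in> ?K" for x
    proof -
      have "x \<in> V" using x V(2) by blast
      moreover have "smooth_on V surf" by (rule smooth_on_subset[OF smooth_surf_W V(3)])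
      moreover have "hdet (frechet_derivative surf (at p)) \<noteq> 0" if "p \<in> V" for p
        using hdet_surf_W that V(3) by blast
      ultimately obtain G where G: "open G" "x \<in> G" "G \<subseteq> V" "inj_on surf G"
        using shadow_locally_inj[OF V(1)] by metis
      have "inj_on g G"
      proof (rule inj_onI)
        fix p q assume pq: "p \<in> G" "q \<in> G" "g p = g q"
        then have "surf p = surf q" using gs[of p] gs[of q] subsetD[OF G(3)] by metis
        then show "p = q" using inj_onD[OF G(4)] pq by blast
      qed
      then show ?thesis using G by blast
    qed
    \<comment> \<open>\<beta> is a homeomorphism onto its image, so the part of the curve coming
      from Z is relatively open: it is cut out by an open G of X, which meets the curve nowhere
      else.\<close>
    have emb: "\<exists>G. openin X G \<and> g x \<in> G \<and> (\<forall>y\<in>?K. g y \<in> G \<longrightarrow> y \<in> Z)"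
      if x: "x \<in> ?K" and Z: "open Z" "x \<in> Z" for x Z
    proof -
      let ?B = "{s \<in> I. (s, 0) \<in> Z}"
      have "open ((\<lambda>s. (s, 0)) -` Z)" by (intro open_vimage Z continuous_intros)
      then have "openin (top_of_set I) ?B" by (auto simp: openin_open)
      then have "openin (subtopology X (\<beta> ` I)) (\<beta> ` ?B)"
        using homeomorphic_imp_open_map[OF hm] unfolding open_map_def by blast
      then obtain G where G: "openin X G" "\<beta> ` ?B = G \<inter> \<beta> ` I" by (auto simp: openin_subtopology)
      have inj: "inj_on \<beta> I" using hm unfolding homeomorphic_map_def by simp
      obtain s where s: "s \<in> I" "x = (s, 0)" using x by blast
      have "\<beta> s \<in> G" using G(2) s Z(2) by blast
      moreover have "y \<in> Z" if y: "y \<in> ?K" "g y \<in> G" for y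
      proof -
        obtain t where t: "t \<in> I" "y = (t, 0)" using y(1) by blast
        then have "\<beta> t \<in> \<beta> ` ?B" using G(2) gb y(2) by auto
        then have "t \<in> ?B" using t(1) inj by (auto dest: inj_onD)
        then show ?thesis using t by simp
      qed
      ultimately show ?thesis using G(1) gb s by auto
    qed
    obtain V' where "open V'" "?K \<subseteq> V'" "V' \<subseteq> V" "inj_on g V'"
      by (rule injective_neighbourhood[OF V(1,2) X g loc emb])
    then show ?thesis by blast
  qed (use V in blast)
  then obtain V' where V': "open V'" "?K \<subseteq> V'" "V' \<subseteq> V" "embedding_map (top_of_set I) X \<beta> \<longrightarrow> inj_on g V'"
    by blast
  show ?thesis
    by (intro exI[of _ V'] exI[of _ g] conjI ballI diffeo gb gs) (use V V' in auto)
qed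

section \<open>The explicit surface as a solution, and conclusion\<close>

lemma surf_indef_improper_affine_sphere:
  "indef_improper_affine_sphere e3 (top_of_set W) (planar_atlas W) surf"
  unfolding indef_improper_affine_sphere_def
proof (intro conjI)
  have "inv_into W (\<lambda>p. p) p = p" if "p \<in> W" for p
    using inv_into_f_f[of "\<lambda>p. p" W p] that by simp
  then show "\<forall>(D, \<kappa>)\<in>planar_atlas W. indef_improper_affine_sphere_param e3 (\<kappa> ` D) (surf \<circ> inv_into D \<kappa>)"
    using surf_sphere[of "surf \<circ> inv_into W (\<lambda>p. p)"] by simp
qed (use analytic_surface_planar[OF open_W] in \<open>simp_all add: vec_eq_iff forall_3\<close>)

lemma con_affine_conormal: "affine_conormal e3 (planar_atlas W) surf con"
proof -
  have "inv_into W (\<lambda>p. p) p = p" if "p \<in> W" for p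
    using inv_into_f_f[of "\<lambda>p. p" W p] that by simp
  then have "affine_conormal_at e3 (surf \<circ> inv_into W (\<lambda>p. p)) p (con p)" if "p \<in> W" for p
    by (intro con_conormal_W[OF that]) simp
  then show ?thesis unfolding affine_conormal_def by simp
qed

lemma surf_contains: "contains_with_conormal e3 (top_of_set W) (planar_atlas W) surf I \<alpha> U (\<lambda>s. (s, 0))"
  unfolding contains_with_conormal_def
proof (intro conjI exI[of _ con] con_affine_conormal)
  have "{s \<in> I. (s, 0) \<in> W} = I" using axis_W by auto
  moreover have "vector_derivative (\<lambda>s. (s, 0 :: real)) (at s) = (1, 0)" for s :: real
  proof (rule vector_derivative_at)
    have "((\<lambda>s. (s, 0 :: real)) has_derivative (\<lambda>h. (h, 0))) (at s)"
      by (intro has_derivative_Pair has_derivative_ident has_derivative_const)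
    then show "((\<lambda>s. (s, 0 :: real)) has_vector_derivative (1, 0)) (at s)"
      by (simp add: has_vector_derivative_def)
  qed
  moreover have "real_analytic_on I (\<lambda>s. (s, 0 :: real))"
    by (rule real_analytic_on_affine[OF _ open_I, of "\<lambda>s. (s, 0)"]) (auto intro: linearI)
  moreover have "continuous_map (top_of_set I) (top_of_set W) (\<lambda>s. (s, 0))"
    using axis_W by (auto simp: continuous_map_in_subtopology intro!: continuous_intros)
  ultimately show "surface_curve (top_of_set W) (planar_atlas W) I (\<lambda>s. (s, 0))"
    unfolding surface_curve_def regular_analytic_curve_def by (simp add: comp_def zero_prod_def)
qed (simp add: surf_axis con_axis)

end

theorem theorem3p2:
  fixes I :: "real set" and \<alpha> U :: "real \<Rightarrow> real^3" and \<xi> :: "real^3"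
  assumes "is_interval I" and "open I" and "I \<noteq> {}"
    and "\<xi> = vector [0, 0, 1]"
    and "admissible_pair \<xi> I \<alpha> U"
  shows "\<exists>W \<psi> N.
     open W \<and> connected W \<and> (\<lambda>s. (s, 0)) ` I \<subseteq> W \<and>
     W \<subseteq> {(s, t). s + t \<in> I \<and> s - t \<in> I} \<and>
     split_representation I \<alpha> U W \<psi> N \<and>
     indef_improper_affine_sphere \<xi> (top_of_set W) (planar_atlas W) \<psi> \<and>
     affine_conormal \<xi> (planar_atlas W) \<psi> N \<and>
     contains_with_conormal \<xi> (top_of_set W) (planar_atlas W) \<psi> I \<alpha> U (\<lambda>s. (s, 0)) \<and>
     (\<forall>(X :: 'p topology) A \<psi>' \<beta>.
        indef_improper_affine_sphere \<xi> X A \<psi>' \<and> contains_with_conormal \<xi> X A \<psi>' I \<alpha> U \<beta> \<longrightarrow>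
        (\<exists>V \<phi>. open V \<and> (\<lambda>s. (s, 0)) ` I \<subseteq> V \<and> V \<subseteq> W \<and>
           local_diffeo V X A \<phi> \<and>
           (\<forall>s\<in>I. \<phi> (s, 0) = \<beta> s) \<and>
           (\<forall>p\<in>V. \<psi>' (\<phi> p) = \<psi> p) \<and>
           (embedding_map (top_of_set I) X \<beta> \<longrightarrow> inj_on \<phi> V)))"
proof -
  \<comment> \<open>The positive function of the admissible pair enters as the negative sign of
    <\<alpha>', U'>, which yields \<mu> > 0 on the axis.\<close>
  have ad: "real_analytic_on I \<alpha>" "real_analytic_on I U"
    "\<And>s. s \<in> I \<Longrightarrow> vector_derivative \<alpha> (at s) \<bullet> U s = 0 \<and> e3 \<bullet> U s = 1
        \<and> vector_derivative \<alpha> (at s) \<bullet> vector_derivative U (at s) < 0"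
    using assms(5) unfolding assms(4) admissible_pair_def regular_analytic_curve_def by force+
  interpret admissible I \<alpha> U
    by unfold_locales (use assms ad real_analytic_on_smooth_on_vec in \<open>auto simp: inner_3[of e3]\<close>)
  have "W \<subseteq> {(s, t). s + t \<in> I \<and> s - t \<in> I}"
    using W_subset by (auto simp: diamond_def)
  moreover have "\<exists>V \<phi>. open V \<and> (\<lambda>s. (s, 0)) ` I \<subseteq> V \<and> V \<subseteq> W \<and> local_diffeo V X A \<phi> \<and>
      (\<forall>s\<in>I. \<phi> (s, 0) = \<beta> s) \<and> (\<forall>p\<in>V. \<psi>' (\<phi> p) = surf p) \<and>
      (embedding_map (top_of_set I) X \<beta> \<longrightarrow> inj_on \<phi> V)"
    if "indef_improper_affine_sphere e3 X A \<psi>' \<and> contains_with_conormal e3 X A \<psi>' I \<alpha> U \<beta>"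
    for X :: "'p topology" and A \<psi>' \<beta>
    using that by (intro uniqueness) simp_all
  ultimately show ?thesis
    unfolding assms(4)
    using open_W connected_W axis_W surf_representation surf_indef_improper_affine_sphere
      con_affine_conormal surf_contains
    by (rule_tac exI[of _ W], rule_tac exI[of _ surf], rule_tac exI[of _ con])
      (intro conjI allI impI; assumption?)
qed

end
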